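(* Let $S=\langle g_1,g_2,g_3\rangle$ be a $3$-generated numerical semigroup with $g_1<g_2<g_3$ and let $R=K[[t^S]]$ with maximal ideal $\mathbf m$. Then the following conditions are equivalent: (i) $G(\mathbf m)$ is Buchsbaum and not Cohen-Macaulay; (ii) $(0:_{G(\mathbf m)}\mathcal M^r)=G(\mathbf m)\,\overline{t^{kg_3}}$ for some integer $k\ge1$, with $\overline{t^{kg_3}}\in(0:_{G(\mathbf m)}\mathcal M)$; (iii) $\lambda=1$, where $\lambda$ is the length of $H^0_{\mathcal M}=(0:_{G(\mathbf m)}\mathcal M^r)$ as a $G(\mathbf m)$-module.
   Context: $K$ is an infinite field. $S\subseteq\mathbb N$ is the numerical semigroup with minimal generators $g_1<g_2<g_3$, $\gcd(g_1,g_2,g_3)=1$. $R=K[[t^S]]=K[[t^{g_1},t^{g_2},t^{g_3}]]$, $\mathbf m=(t^{g_1},t^{g_2},t^{g_3})$, $G(\mathbf m)=\bigoplus_{i\ge0}\mathbf m^i/\mathbf m^{i+1}$, $\mathcal M$ is the homogeneous maximal ideal of $G(\mathbf m)$, and $r$ is the reduction number of $\mathbf m$, i.e. the least $r\ge 0$ with $\mathbf m^{r+1}=t^{g_1}\mathbf m^r$. $H^0_{\mathcal M}=\bigcup_{k\ge1}(0:_{G(\mathbf m)}\mathcal M^k)$, which equals $(0:_{G(\mathbf m)}\mathcal M^r)$; $G(\mathbf m)$ is called Buchsbaum if $\mathcal M\cdot H^0_{\mathcal M}=0$. Let $M=S\setminus\{0\}$, $hM=M+\dots+M$ ($h$ summands),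 $0M=S$. For $s\in S$ with $s\in hM\setminus(h+1)M$, $\overline{t^s}$ denotes the (nonzero) class of $t^s$ in $\mathbf m^h/\mathbf m^{h+1}\subset G(\mathbf m)$. *)

theory Defs
  imports
    "HOL-Algebra.Algebra"
    "HOL-Algebra.Algebraic_Closure_Type"
    "HOL-Computational_Algebra.Formal_Power_Series"
    "HOL-Library.Extended_Nat"
begin

section \<open>Numerical semigroups\<close>

inductive_set semigroup_gen :: "nat set \<Rightarrow> nat set" for A :: "nat set" where
  zero: "0 \<in> semigroup_gen A"
| add: "s \<in> semigroup_gen A \<Longrightarrow> g \<in> A \<Longrightarrow> s + g \<in> semigroup_gen A"

definition minimal_generators :: "nat set \<Rightarrow> nat set \<Rightarrow> bool" where
  "minimal_generators A S \<longleftrightarrow> semigroup_gen A = S \<and> (\<forall>B. B \<subset> A \<longrightarrow> semigroup_gen B \<noteq> S)"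

text \<open>The set $hM$ of sums of $h$ elements of $M = S - \{0\}$, with the convention $0M = S$.\<close>

definition sumset_power :: "nat set \<Rightarrow> nat \<Rightarrow> nat set" where
  "sumset_power S h =
     (if h = 0 then S else {sum_list xs |xs. length xs = h \<and> set xs \<subseteq> S - {0}})"

definition semigroup_order :: "nat set \<Rightarrow> nat \<Rightarrow> nat" where
  "semigroup_order S s = (THE h. s \<in> sumset_power S h - sumset_power S (Suc h))"

section \<open>Commutative algebra over an arbitrary ring\<close>

primrec ideal_power :: "('a, 'b) ring_scheme \<Rightarrow> 'a set \<Rightarrow> nat \<Rightarrow> 'a set" where
  "ideal_power A I 0 = carrier A"
| "ideal_power A I (Suc n) = ideal_prod A (ideal_power A I n) I"

definition zero_colon :: "('a, 'b) ring_scheme \<Rightarrow> 'a set \<Rightarrow> 'a set" where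
  "zero_colon A J = {x \<in> carrier A. \<forall>y\<in>J. x \<otimes>\<^bsub>A\<^esub> y = \<zero>\<^bsub>A\<^esub>}"

definition local_cohomology_0 :: "('a, 'b) ring_scheme \<Rightarrow> 'a set \<Rightarrow> 'a set" where
  "local_cohomology_0 A J = (\<Union>k\<in>{1..}. zero_colon A (ideal_power A J k))"

definition module_length ::
    "('a, 'b) ring_scheme \<Rightarrow> ('a, 'c, 'd) module_scheme \<Rightarrow> enat" where
  "module_length A N = Sup {enat n |n. \<exists>C :: nat \<Rightarrow> 'c set.
     (\<forall>i\<le>n. submodule (C i) A N) \<and> (\<forall>i<n. C i \<subset> C (Suc i))}"

text \<open>An ideal viewed as a module; the \<open>mult\<close> and \<open>one\<close> fields of the module record play no
  role.\<close>

definition ideal_module :: "('a, 'b) ring_scheme \<Rightarrow> 'a set \<Rightarrow> ('a, 'a) module" where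
  "ideal_module A J = \<lparr>carrier = J, monoid.mult = (\<otimes>\<^bsub>A\<^esub>),
     one = \<one>\<^bsub>A\<^esub>, ring.zero = \<zero>\<^bsub>A\<^esub>, add = (\<oplus>\<^bsub>A\<^esub>), module.smult = (\<otimes>\<^bsub>A\<^esub>)\<rparr>"

definition regular_sequence :: "('a, 'b) ring_scheme \<Rightarrow> 'a list \<Rightarrow> bool" where
  "regular_sequence A xs \<longleftrightarrow> set xs \<subseteq> carrier A \<and> Idl\<^bsub>A\<^esub> (set xs) \<noteq> carrier A \<and>
     (\<forall>i<length xs. \<forall>y\<in>carrier A.
        xs ! i \<otimes>\<^bsub>A\<^esub> y \<in> Idl\<^bsub>A\<^esub> (set (take i xs)) \<longrightarrow> y \<in> Idl\<^bsub>A\<^esub> (set (take i xs)))"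

definition ideal_depth :: "('a, 'b) ring_scheme \<Rightarrow> 'a set \<Rightarrow> enat" where
  "ideal_depth A I = Sup {enat (length xs) |xs. set xs \<subseteq> I \<and> regular_sequence A xs}"

definition prime_height :: "('a, 'b) ring_scheme \<Rightarrow> 'a set \<Rightarrow> enat" where
  "prime_height A P = Sup {enat n |n. \<exists>C :: nat \<Rightarrow> 'a set.
     (\<forall>i\<le>n. primeideal (C i) A) \<and> (\<forall>i<n. C i \<subset> C (Suc i)) \<and> C n = P}"

text \<open>A Noetherian commutative ring is Cohen-Macaulay if the depth of each maximal ideal on the
  ring equals its codimension (Eisenbud, Commutative Algebra, Section 18.2).\<close>

definition cohen_macaulay :: "('a, 'b) ring_scheme \<Rightarrow> bool" where
  "cohen_macaulay A \<longleftrightarrow> cring A \<and> noetherian_ring A \<and>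
     (\<forall>P. maximalideal P A \<longrightarrow> ideal_depth A P = prime_height A P)"

section \<open>The associated graded ring\<close>

text \<open>Elements of $\bigoplus_i I^i/I^{i+1}$ are finitely supported families of cosets; the zero of
  degree $i$ is $I^{i+1}$ itself. The product of the components of degrees $i$ and $n-i$ is computed
  on representatives, as a coset of $I^{n+1}$.\<close>

definition assoc_graded :: "('a, 'b) ring_scheme \<Rightarrow> 'a set \<Rightarrow> (nat \<Rightarrow> 'a set) ring" where
  "assoc_graded A I = \<lparr>
     carrier = {f. (\<forall>i. \<exists>x\<in>ideal_power A I i. f i = ideal_power A I (Suc i) +>\<^bsub>A\<^esub> x) \<and>
                   finite {i. f i \<noteq> ideal_power A I (Suc i)}},
     monoid.mult = (\<lambda>f g n. finsum (A Quot ideal_power A I (Suc n))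
       (\<lambda>i. rcoset_mult A (ideal_power A I (Suc n)) (f i) (g (n - i))) {..n}),
     one = (\<lambda>n. if n = 0 then ideal_power A I 1 +>\<^bsub>A\<^esub> \<one>\<^bsub>A\<^esub> else ideal_power A I (Suc n)),
     ring.zero = (\<lambda>n. ideal_power A I (Suc n)),
     add = (\<lambda>f g n. f n <+>\<^bsub>A\<^esub> g n)\<rparr>"

text \<open>The ideal of elements of positive degree, which is the homogeneous maximal ideal when
  $A/I$ is a field.\<close>

definition graded_max_ideal :: "('a, 'b) ring_scheme \<Rightarrow> 'a set \<Rightarrow> (nat \<Rightarrow> 'a set) set" where
  "graded_max_ideal A I = {f \<in> carrier (assoc_graded A I). f 0 = \<zero>\<^bsub>assoc_graded A I\<^esub> 0}"

text \<open>The class of $x \in I^h$ in $I^h/I^{h+1}$, as a homogeneous element of degree $h$.\<close>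

definition graded_class :: "('a, 'b) ring_scheme \<Rightarrow> 'a set \<Rightarrow> nat \<Rightarrow> 'a \<Rightarrow> nat \<Rightarrow> 'a set" where
  "graded_class A I h x =
     (\<lambda>n. if n = h then ideal_power A I (Suc h) +>\<^bsub>A\<^esub> x else ideal_power A I (Suc n))"

definition is_buchsbaum :: "('a, 'b) ring_scheme \<Rightarrow> 'a set \<Rightarrow> bool" where
  "is_buchsbaum G J \<longleftrightarrow> ideal_prod G J (local_cohomology_0 G J) = {\<zero>\<^bsub>G\<^esub>}"

definition reduction_number :: "('a, 'b) ring_scheme \<Rightarrow> 'a set \<Rightarrow> 'a \<Rightarrow> nat" where
  "reduction_number A I x =
     (LEAST r. ideal_power A I (Suc r) = (\<lambda>y. x \<otimes>\<^bsub>A\<^esub> y) ` ideal_power A I r)"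

section \<open>Numerical semigroup rings\<close>

definition semigroup_ring :: "nat set \<Rightarrow> 'k::field fps ring" where
  "semigroup_ring S =
     ring_of_type_algebra\<lparr>carrier := {f. \<forall>n. fps_nth f n \<noteq> 0 \<longrightarrow> n \<in> S}\<rparr>"

end

theory Submission
  imports Defs
begin

text \<open>The ring $G = G(\mathbf m)$ has a $K$-basis $\overline{t^s}$, $s \in S$, with
  $\overline{t^s}\,\overline{t^u} = \overline{t^{s+u}}$ if $\mathrm{ord}(s+u) = \mathrm{ord}(s) +
  \mathrm{ord}(u)$ and $0$ otherwise. Hence $H^0_{\mathcal M}$ is spanned by the $\overline{t^u}$ with $u$
  in the set $T$ of those $u$ for which $\mathrm{ord}(u + k g_1) > \mathrm{ord}(u) + k$ for some $k$.
  Condition (iii) says that $T$ is a singleton, (ii) that $T = \{k g_3\}$, and (i) that $T$ is nonempty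
  and its elements are killed by $\mathcal M$, because $G$ is Cohen-Macaulay iff $T = \emptyset$.

  Assume that $\mathcal M$ kills $T$ and let $s \in T$. A representation of $s$ of maximal length does not
  involve $g_1$, since otherwise $s - g_1 \in T$ is not killed by $\overline{t^{g_1}}$. Write
  $s = b g_2 + c g_3$. The element $s + g_1$ has a representation with at least two more
  summands; it cannot involve $g_1$ either, and comparing sizes gives a relation
  $g_1 + q g_3 = p g_2$ with $1 \le q \le c$ and $p \ge q + 2$. If $s \ne q g_3$, one can
  remove a summand $g_2$ or $g_3$ from $s$ so that the relation still applies; the result is in $T$ but
  is not killed by the removed generator. So $s = q g_3$, and the same argument shows that $q$
  does not depend on $s$.

  For the Cohen-Macaulay property, $G$ contains $K[x]$ with $x = \overline{t^{g_1}}$ as a retract with nil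
  kernel, so all maximal ideals have height one; $G$ is torsion-free over $K[x]$ iff
  $T = \emptyset$.\<close>

section \<open>Polynomials with the product of the associated graded ring\<close>

text \<open>Elements of G are families of cosets of power series, which are awkward to compute with.
  They are replaced by polynomials supported on S with a modified product, so that the Buchsbaum
  condition, annihilators of powers of the maximal ideal and the length become statements about sets
  of exponents. The reduction number enters only through one rule: an s with ord(s) > r is g + u
  with ord(u) at least r. The rule turns annihilation by a power of the maximal ideal into
  annihilation by a power of x, and it bounds s - g ord(s). This bound is the source of the nil
  kernel of the map onto K[x]. The obstacle on the Cohen-Macaulay side is that the definition ranges
  over all maximal ideals of G, not just the homogeneous one. Monomials say nothing about the
  others, hence the comparison of all primes with those of K[x]. That the depth is at most one
  everywhere rests on the fact that a regular element divides a nonzero element of K[x].\<close>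

definition supported :: "nat set \<Rightarrow> 'k::zero poly set" where
  "supported A = {p. \<forall>n. coeff p n \<noteq> 0 \<longrightarrow> n \<in> A}"

lemma supportedI: "(\<And>n. coeff p n \<noteq> 0 \<Longrightarrow> n \<in> A) \<Longrightarrow> p \<in> supported A"
  by (simp add: supported_def)

lemma supportedD: "p \<in> supported A \<Longrightarrow> coeff p n \<noteq> 0 \<Longrightarrow> n \<in> A"
  by (simp add: supported_def)

lemma supported_0 [simp]: "0 \<in> supported A"
  by (simp add: supported_def)

lemma supported_add:
  fixes p q :: "'k::comm_monoid_add poly"
  shows "p \<in> supported A \<Longrightarrow> q \<in> supported A \<Longrightarrow> p + q \<in> supported A"
  by (simp add: supported_def) (metis add_0)

lemma supported_uminus [simp]:
  fixes p :: "'k::ab_group_add poly"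
  shows "- p \<in> supported A \<longleftrightarrow> p \<in> supported A"
  by (simp add: supported_def)

lemma supported_diff:
  fixes p q :: "'k::ab_group_add poly"
  shows "p \<in> supported A \<Longrightarrow> q \<in> supported A \<Longrightarrow> p - q \<in> supported A"
  using supported_add[of p A "- q"] by simp

lemma supported_mono: "A \<subseteq> B \<Longrightarrow> supported A \<subseteq> supported B"
  by (auto simp: supported_def)

lemma monom_supported_iff [simp]: "monom c n \<in> supported A \<longleftrightarrow> c = 0 \<or> n \<in> A"
  by (auto simp: supported_def split: if_splits)

text \<open>\<open>ord\<close> abstracts the maximal length of a representation. Superadditivity
  makes the filtration by \<open>ord\<close> multiplicative; \<open>ord_split\<close> says that the
  graded ring is generated in degree one.\<close>

locale semigroup_with_order =
  fixes S :: "nat set" and ord :: "nat \<Rightarrow> nat"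
  assumes zero_mem: "0 \<in> S"
    and add_mem: "s \<in> S \<Longrightarrow> u \<in> S \<Longrightarrow> s + u \<in> S"
    and ord_zero: "ord 0 = 0"
    and ord_eq_0: "s \<in> S \<Longrightarrow> ord s = 0 \<Longrightarrow> s = 0"
    and ord_add: "s \<in> S \<Longrightarrow> u \<in> S \<Longrightarrow> ord s + ord u \<le> ord (s + u)"
    and ord_split: "s \<in> S \<Longrightarrow> s \<noteq> 0 \<Longrightarrow>
      \<exists>u\<in>S. \<exists>v\<in>S. s = u + v \<and> ord v = 1 \<and> ord s = Suc (ord u)"
begin

definition strict :: "nat \<Rightarrow> nat \<Rightarrow> bool" where
  "strict s u \<longleftrightarrow> ord (s + u) = ord s + ord u"

lemma strict_commute: "strict s u \<longleftrightarrow> strict u s"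
  by (simp add: strict_def add.commute)

lemma strict_0 [simp]: "strict s 0" "strict 0 s"
  by (simp_all add: strict_def ord_zero)

text \<open>In \<open>ord s + ord u + ord v \<le> ord (s + u) + ord v \<le> ord (s + u + v)\<close>
  the outer terms agree only if both steps are equalities. The resulting condition is symmetric in
  the three elements, whence the associativity of \<open>star\<close>.\<close>

lemma strict_assoc:
  assumes "s \<in> S" "u \<in> S" "v \<in> S"
  shows "strict s u \<and> strict (s + u) v \<longleftrightarrow> ord (s + u + v) = ord s + ord u + ord v"
  using ord_add[of s u] ord_add[of "s + u" v] add_mem[of s u] assms
  by (auto simp: strict_def)

text \<open>The product of the associated graded ring in the basis $\overline{t^s}$: a product of two basis
  elements vanishes unless the orders add up.\<close>

definition star :: "'k::field poly \<Rightarrow> 'k poly \<Rightarrow> 'k poly" where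
  "star p q = Abs_poly (\<lambda>n. \<Sum>i=0..n. if strict i (n - i)
     then coeff p i * coeff q (n - i) else 0)"

lemma coeff_star: "coeff (star p q) n = (\<Sum>i=0..n. if strict i (n - i)
     then coeff p i * coeff q (n - i) else 0)"
proof -
  have "(\<Sum>i=0..n. if strict i (n - i)
     then coeff p i * coeff q (n - i) else 0) = 0"
    if "n > degree p + degree q" for n
  proof (rule sum.neutral, safe)
    fix i assume "i \<in> {0..n}"
    show "(if strict i (n - i) then coeff p i * coeff q (n - i) else 0) = 0"
    proof (cases "i \<le> degree p")
      case True
      hence "n - i > degree q" using that by linarith
      thus ?thesis by (simp add: coeff_eq_0)
    qed (simp add: coeff_eq_0)
  qed
  thus ?thesis unfolding star_def by (subst coeff_Abs_poly) auto
qed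

lemma star_in_supported:
  assumes "p \<in> supported A" "q \<in> supported B"
    and "\<And>a b. a \<in> A \<Longrightarrow> b \<in> B \<Longrightarrow> strict a b \<Longrightarrow> a + b \<in> C"
  shows "star p q \<in> supported C"
proof (rule supportedI)
  fix n assume "coeff (star p q) n \<noteq> 0"
  then obtain i where i: "i \<in> {0..n}"
      and "(if strict i (n - i) then coeff p i * coeff q (n - i) else 0) \<noteq> 0"
    unfolding coeff_star by (rule sum.not_neutral_contains_not_neutral)
  hence "strict i (n - i)" "coeff p i \<noteq> 0" "coeff q (n - i) \<noteq> 0"
    by (auto split: if_splits)
  thus "n \<in> C" using assms(3)[of i "n - i"] assms(1,2) i by (auto simp: supported_def)
qed

lemma star_supported:
  "p \<in> supported S \<Longrightarrow> q \<in> supported S \<Longrightarrow> star p q \<in> supported S"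
  by (erule star_in_supported) (auto simp: add_mem)

lemma star_commute: "star p q = star q p"
proof (rule poly_eqI)
  fix n
  have "coeff (star p q) n = (\<Sum>i=0..n. if strict (n - i) i
     then coeff p (n - i) * coeff q i else 0)"
    unfolding coeff_star by (rule sum.reindex_bij_witness[of _ "\<lambda>i. n - i" "\<lambda>i. n - i"]) auto
  thus "coeff (star p q) n = coeff (star q p) n"
    unfolding coeff_star by (simp add: mult.commute strict_commute cong: if_cong)
qed

lemma star_add_left: "star (p + q) r = star p r + star q r"
  by (rule poly_eqI) (auto simp: coeff_star distrib_right simp flip: sum.distrib intro!: sum.cong)

lemma coeff_star_monom:
  "coeff (star p (monom c v)) n =
     (if v \<le> n \<and> strict (n - v) v then coeff p (n - v) * c else 0)"
proof -
  have "(if strict i (n - i) then coeff p i * coeff (monom c v) (n - i) else 0)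
     = (if i = n - v then if v \<le> n \<and> strict (n - v) v then coeff p (n - v) * c else 0 else 0)"
    if "i \<in> {0..n}" for i using that by auto
  hence "coeff (star p (monom c v)) n = (\<Sum>i=0..n. (if i = n - v then if v \<le> n \<and> strict (n - v) v then coeff p (n - v) * c else 0 else 0))"
    unfolding coeff_star by (intro sum.cong) auto
  thus ?thesis by (simp add: sum.delta)
qed

lemma star_monom_monom: "star (monom a u) (monom b v) =
   (if strict u v then monom (a * b) (u + v) else 0)"
  by (rule poly_eqI) (auto simp: coeff_star_monom)

lemma star_const: "star p (monom c 0) = Polynomial.smult c p"
  by (rule poly_eqI) (auto simp: coeff_star_monom)

lemma star_1 [simp]: "star p 1 = p" "star 1 p = p"
  using star_const[of p 1] star_commute[of 1 p] by (simp_all add: monom_eq_1)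

lemma star_assoc:
  assumes "p \<in> supported S" "q \<in> supported S" "r \<in> supported S"
  shows "star (star p q) r = star p (star q r)"
proof (rule poly_eqI)
  fix n
  \<comment> \<open>\<open>F\<close> is the contribution of a triple of exponents. Its condition
    does not see the bracketing, so both sides of the claim are the sum of \<open>F\<close> over all
    triples with sum \<open>n\<close>.\<close>
  define F where "F a b c = (if ord (a + b + c) = ord a + ord b + ord c
    then coeff p a * coeff q b * coeff r c else 0)" for a b c
  have F: "F a b c = (if strict a b \<and> strict (a + b) c then coeff p a * coeff q b * coeff r c else 0)"
    "F a b c = (if strict b c \<and> strict a (b + c) then coeff p a * coeff q b * coeff r c else 0)" for a b c
  proof -
    have *: "ord (a + b + c) = ord a + ord b + ord c \<longleftrightarrow> strict a b \<and> strict (a + b) c"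
      "ord (a + b + c) = ord a + ord b + ord c \<longleftrightarrow> strict b c \<and> strict a (b + c)"
      if "coeff p a * coeff q b * coeff r c \<noteq> 0"
    proof -
      have "a \<in> S" "b \<in> S" "c \<in> S" using that assms by (auto simp: supported_def)
      thus "ord (a + b + c) = ord a + ord b + ord c \<longleftrightarrow> strict a b \<and> strict (a + b) c"
        by (simp add: strict_assoc)
      have "strict b c \<and> strict a (b + c) \<longleftrightarrow> ord (b + c + a) = ord b + ord c + ord a"
        using strict_assoc[of b c a] strict_commute[of a "b + c"] \<open>a \<in> S\<close> \<open>b \<in> S\<close> \<open>c \<in> S\<close> by simp
      thus "ord (a + b + c) = ord a + ord b + ord c \<longleftrightarrow> strict b c \<and> strict a (b + c)"
        by (simp add: ac_simps)
    qed
    show "F a b c = (if strict a b \<and> strict (a + b) c then coeff p a * coeff q b * coeff r c else 0)"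
      unfolding F_def using *(1) by auto
    show "F a b c = (if strict b c \<and> strict a (b + c) then coeff p a * coeff q b * coeff r c else 0)"
      unfolding F_def using *(2) by auto
  qed
  have "coeff (star (star p q) r) n = (\<Sum>j=0..n. \<Sum>i=0..j. F i (j - i) (n - j))"
  proof -
    have "(if strict j (n - j) then coeff (star p q) j * coeff r (n - j) else 0) =
        (\<Sum>i=0..j. F i (j - i) (n - j))" for j
    proof -
      have "F i (j - i) (n - j) = (if strict j (n - j) then
          (if strict i (j - i) then coeff p i * coeff q (j - i) else 0) * coeff r (n - j) else 0)"
        if "i \<in> {0..j}" for i
        using that unfolding F(1) by simp
      thus ?thesis by (simp add: coeff_star sum_distrib_right)
    qed
    thus ?thesis by (simp only: coeff_star[of "star p q"])
  qed
  also have "\<dots> = (\<Sum>j=0..n. \<Sum>i=0..n - j. F j i (n - j - i))"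
    by (rule fps_mult_assoc_lemma)
  also have "\<dots> = coeff (star p (star q r)) n"
  proof -
    have "(if strict j (n - j) then coeff p j * coeff (star q r) (n - j) else 0) =
        (\<Sum>i=0..n - j. F j i (n - j - i))" for j
    proof -
      have "F j i (n - j - i) = (if strict j (n - j) then
          coeff p j * (if strict i (n - j - i) then coeff q i * coeff r (n - j - i) else 0) else 0)"
        if "i \<in> {0..n - j}" for i
      proof -
        have "i + (n - j - i) = n - j" using that by simp
        thus ?thesis unfolding F(2) by (simp only: mult.assoc if_distrib mult_zero_right) auto
      qed
      thus ?thesis by (simp add: coeff_star sum_distrib_left)
    qed
    thus ?thesis by (simp only: coeff_star[of p "star q r"])
  qed
  finally show "coeff (star (star p q) r) n = coeff (star p (star q r)) n" .
qed

text \<open>Multiplication by a monomial shifts all exponents by the same amount, so surviving terms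
  cannot cancel. This is why annihilators of monomials are again spanned by monomials.\<close>

lemma star_monom_eq_0_iff:
  "star p (monom 1 v) = 0 \<longleftrightarrow> (\<forall>n. coeff p n \<noteq> 0 \<longrightarrow> \<not> strict n v)"
  (is "?l \<longleftrightarrow> ?r")
proof
  assume ?l
  hence "coeff (star p (monom 1 v)) (n + v) = 0" for n by simp
  hence "strict n v \<Longrightarrow> coeff p n = 0" for n
    unfolding coeff_star_monom by (metis add_diff_cancel_right' le_add2 mult.right_neutral)
  thus ?r by blast
next
  assume ?r
  thus ?l by (intro poly_eqI) (simp add: coeff_star_monom, metis)
qed

end

text \<open>\<open>G\<close> is only a record with operations here; its ring axioms are carried over
  from \<open>star\<close> along \<open>\<Phi>\<close>, which avoids checking them on families of
  cosets.\<close>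

locale graded_monomial_algebra = semigroup_with_order S ord
  for S ord +
  fixes G :: "('g, 'b) ring_scheme" (structure) and \<Phi> :: "'k::field poly \<Rightarrow> 'g"
  assumes bij: "bij_betw \<Phi> (supported S) (carrier G)"
    and \<Phi>_add: "p \<in> supported S \<Longrightarrow> q \<in> supported S \<Longrightarrow> \<Phi> (p + q) = \<Phi> p \<oplus> \<Phi> q"
    and \<Phi>_star: "p \<in> supported S \<Longrightarrow> q \<in> supported S \<Longrightarrow> \<Phi> (star p q) = \<Phi> p \<otimes> \<Phi> q"
    and \<Phi>_0: "\<Phi> 0 = \<zero>"
    and \<Phi>_1: "\<Phi> 1 = \<one>"
begin

lemma one_supported [simp]: "(1 :: 'k poly) \<in> supported S"
  using monom_supported_iff[of "1::'k" 0 S] zero_mem by (simp add: monom_eq_1)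

lemma \<Phi>_closed: "p \<in> supported S \<Longrightarrow> \<Phi> p \<in> carrier G"
  using bij by (auto simp: bij_betw_def)

lemma carrier_eq: "carrier G = \<Phi> ` supported S"
  using bij by (auto simp: bij_betw_def)

lemma \<Phi>_inject: "p \<in> supported S \<Longrightarrow> q \<in> supported S \<Longrightarrow> \<Phi> p = \<Phi> q \<longleftrightarrow> p = q"
  using bij by (auto simp: bij_betw_def inj_on_def)

lemma \<Phi>_eq_0: "p \<in> supported S \<Longrightarrow> \<Phi> p = \<zero> \<longleftrightarrow> p = 0"
  using \<Phi>_inject[of p 0] by (simp add: \<Phi>_0)

lemma is_cring: "cring G"
proof (rule cringI)
  show "abelian_group G"
  proof (rule abelian_groupI)
    fix x assume "x \<in> carrier G"
    then obtain p where p: "p \<in> supported S" "x = \<Phi> p" by (auto simp: carrier_eq)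
    have "\<Phi> (- p) \<oplus> x = \<zero>"
      using \<Phi>_add[of "- p" p] p by (simp add: \<Phi>_0)
    thus "\<exists>y\<in>carrier G. y \<oplus> x = \<zero>" using p(1) by (metis \<Phi>_closed supported_uminus)
  qed (auto simp: carrier_eq supported_add ac_simps simp flip: \<Phi>_add \<Phi>_0)
  show "comm_monoid G"
  proof (rule comm_monoidI)
    fix x y z assume "x \<in> carrier G" "y \<in> carrier G" "z \<in> carrier G"
    thus "x \<otimes> y \<otimes> z = x \<otimes> (y \<otimes> z)"
      by (auto simp: carrier_eq star_supported star_assoc simp flip: \<Phi>_star)
  next
    fix x y assume "x \<in> carrier G" "y \<in> carrier G"
    thus "x \<otimes> y = y \<otimes> x"
      unfolding carrier_eq by clarify (metis \<Phi>_star star_commute)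
  qed (auto simp: carrier_eq star_supported simp flip: \<Phi>_star \<Phi>_1)
qed (auto simp: carrier_eq star_supported star_add_left supported_add simp flip: \<Phi>_star \<Phi>_add)

sublocale cring G by (rule is_cring)

lemma \<Phi>_uminus: "p \<in> supported S \<Longrightarrow> \<ominus> \<Phi> p = \<Phi> (- p)"
  by (rule sum_zero_eq_neg[symmetric]) (simp_all add: \<Phi>_closed \<Phi>_0 flip: \<Phi>_add)

end

section \<open>Ideals spanned by monomials\<close>

lemma supported_inject:
  "(supported A :: 'k::zero_neq_one poly set) = supported B \<longleftrightarrow> A = B"
proof
  assume *: "(supported A :: 'k poly set) = supported B"
  have "n \<in> A \<longleftrightarrow> n \<in> B" for n
    using monom_supported_iff[of "1::'k" n A] monom_supported_iff[of "1::'k" n B] * by simp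
  thus "A = B" by blast
qed simp

lemma supported_empty: "supported {} = {0}"
  by (auto simp: supported_def poly_eq_iff)

lemma supported_singleton: "p \<in> supported {n} \<longleftrightarrow> p = Polynomial.monom (Polynomial.coeff p n) n"
  by (auto simp: supported_def poly_eq_iff split: if_splits)

text \<open>\<open>reduction\<close> is the exponent form of the equality m^(r+1) = t^g m^r;
  \<open>ord_mult_g\<close> says that no power of the class of t^g vanishes.\<close>

locale semigroup_with_reduction = semigroup_with_order +
  fixes g r :: nat
  assumes g_mem: "g \<in> S" and g_pos: "0 < g"
    and ord_mult_g: "ord (k * g) = k"
    and reduction: "s \<in> S \<Longrightarrow> Suc r \<le> ord s \<Longrightarrow> \<exists>u\<in>S. r \<le> ord u \<and> s = g + u"
begin

lemma mult_g_mem: "k * g \<in> S"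
  by (induction k) (auto simp: zero_mem add_mem g_mem)

lemma ord_g: "ord g = 1"
  using ord_mult_g[of 1] by simp

text \<open>The equality m^(j+1) = t^g m^j propagates upwards from j = r: split off a summand of
  order one, treat the rest by induction, and add the summand back.\<close>

lemma reduction_ge:
  "s \<in> S \<Longrightarrow> r \<le> j \<Longrightarrow> Suc j \<le> ord s \<Longrightarrow> \<exists>u\<in>S. j \<le> ord u \<and> s = g + u"
proof (induction j arbitrary: s)
  case 0
  thus ?case using reduction[of s] by auto
next
  case (Suc j)
  show ?case
  proof (cases "r = Suc j")
    case True
    thus ?thesis using reduction[of s] Suc by auto
  next
    case False
    have "s \<noteq> 0" using Suc.prems ord_zero by (cases "s = 0") auto
    then obtain u v where uv: "u \<in> S" "v \<in> S" "s = u + v" "ord v = 1" "ord s = Suc (ord u)"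
      using ord_split Suc.prems by blast
    then obtain w where "w \<in> S" "j \<le> ord w" "u = g + w"
      using Suc.IH[of u] Suc.prems False by auto
    thus ?thesis using uv ord_add[of w v] add_mem[of w v]
      by (intro bexI[of _ "w + v"]) auto
  qed
qed

text \<open>If the order jumped by two or more, \<open>u + g\<close> would be \<open>g + w\<close>
  with \<open>ord w\<close> above \<open>ord u\<close>, and cancelling \<open>g\<close> gives
  \<open>u = w\<close>.\<close>

lemma strict_g_of_large:
  assumes "u \<in> S" "r \<le> ord u"
  shows "strict u g"
proof (rule ccontr)
  assume "\<not> strict u g"
  hence "Suc (Suc (ord u)) \<le> ord (u + g)"
    using ord_add[of u g] assms g_mem ord_g by (auto simp: strict_def)
  then obtain w where "w \<in> S" "Suc (ord u) \<le> ord w" "u + g = g + w"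
    using reduction_ge[of "u + g" "Suc (ord u)"] assms add_mem g_mem by auto
  thus False by simp
qed

lemma ord_add_mult_g:
  assumes "u \<in> S" "r \<le> ord u"
  shows "ord (u + k * g) = ord u + k"
proof (induction k)
  case (Suc k)
  have "strict (u + k * g) g"
    using strict_g_of_large[of "u + k * g"] Suc assms add_mem mult_g_mem by auto
  thus ?case using Suc by (simp add: strict_def ord_g ac_simps)
qed simp

text \<open>The exponents of the monomials annihilated by $\mathcal M^k$.\<close>

definition torsion :: "nat \<Rightarrow> nat set" where
  "torsion k = {u \<in> S. \<forall>s\<in>S. k \<le> ord s \<longrightarrow> \<not> strict u s}"

lemma torsion_mono: "k \<le> l \<Longrightarrow> torsion k \<subseteq> torsion l"
  by (auto simp: torsion_def)

text \<open>The annihilators of the powers of the maximal ideal stop growing at \<open>r\<close>: a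
  nonzero product of \<open>u\<close> with an \<open>s\<close> of order at least \<open>r\<close>
  stays nonzero after multiplication by x^k, and \<open>s + k * g\<close> has order at least
  \<open>k\<close>.\<close>

lemma torsion_le_r: "torsion k \<subseteq> torsion r"
proof
  fix u assume u: "u \<in> torsion k"
  have "\<not> strict u s" if s: "s \<in> S" "r \<le> ord s" for s
  proof
    assume st: "strict u s"
    have "ord (u + s + k * g) = ord (u + s) + k"
      using ord_add_mult_g[of "u + s"] s u st add_mem by (auto simp: torsion_def strict_def)
    moreover have "ord (s + k * g) = ord s + k"
      using ord_add_mult_g[of s] s by auto
    ultimately have "strict u (s + k * g)"
      using st by (simp add: strict_def ac_simps)
    moreover have "s + k * g \<in> S" "k \<le> ord (s + k * g)"
      using s mult_g_mem add_mem \<open>ord (s + k * g) = ord s + k\<close> by auto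
    ultimately show False using u by (auto simp: torsion_def)
  qed
  thus "u \<in> torsion r" using u by (auto simp: torsion_def)
qed

text \<open>An element of order at least \<open>r + k\<close> is \<open>k * g + w\<close> with
  \<open>ord w\<close> at least \<open>r\<close>, so a product that vanishes at \<open>k * g\<close>
  vanishes at all of them. Being killed by a power of the maximal ideal thus becomes being killed by
  a power of x alone.\<close>

lemma torsion_iff: "u \<in> torsion r \<longleftrightarrow> u \<in> S \<and> (\<exists>k. \<not> strict u (k * g))"
proof safe
  assume u: "u \<in> torsion r"
  thus "u \<in> S" by (auto simp: torsion_def)
  show "\<exists>k. \<not> strict u (k * g)"
    using u ord_mult_g[of r] mult_g_mem[of r] by (auto simp: torsion_def intro!: exI[of _ r])
next
  fix k assume u: "u \<in> S" and k: "\<not> strict u (k * g)"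
  hence less: "ord u + k < ord (u + k * g)"
    using ord_add[of u "k * g"] ord_mult_g[of k] mult_g_mem[of k] by (auto simp: strict_def)
  have ex: "\<exists>w\<in>S. r \<le> ord w \<and> s = k * g + w" if "s \<in> S" "r + k \<le> ord s" for s
    using that
  proof (induction k arbitrary: s)
    case (Suc k)
    obtain w where w: "w \<in> S" "r + k \<le> ord w" "s = g + w"
      using reduction_ge[of s "r + k"] Suc.prems by auto
    thus ?case using Suc.IH[of w] by (auto simp: ac_simps)
  qed auto
  have "\<not> strict u s" if s: "s \<in> S" "r + k \<le> ord s" for s
  proof
    assume "strict u s"
    obtain w where w: "w \<in> S" "r \<le> ord w" "s = k * g + w" using ex[OF s] by blast
    have "ord s = ord w + k" using ord_add_mult_g[of w k] w by (simp add: ac_simps)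
    moreover have "ord (u + k * g) + ord w \<le> ord (u + s)"
      using ord_add[of "u + k * g" w] add_mem[of u "k * g"] mult_g_mem[of k] u w by (simp add: ac_simps)
    ultimately show False using less \<open>strict u s\<close> by (simp add: strict_def)
  qed
  hence "u \<in> torsion (r + k)" using u by (auto simp: torsion_def)
  thus "u \<in> torsion r" using torsion_le_r by blast
qed

lemma torsion_add:
  assumes "u \<in> torsion k" "s \<in> S" "strict u s"
  shows "u + s \<in> torsion k"
proof -
  have "\<not> strict (u + s) v" if v: "v \<in> S" "k \<le> ord v" for v
  proof
    assume "strict (u + s) v"
    hence "ord (u + s + v) = ord u + ord s + ord v" using assms by (simp add: strict_def)
    moreover have "u \<in> S" using assms by (auto simp: torsion_def)
    ultimately have "strict u (s + v)" "k \<le> ord (s + v)"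
      using ord_add[of s v] ord_add[of u "s + v"] add_mem[of s v] v assms(2)
      by (simp_all add: strict_def add.assoc)
    thus False using assms v add_mem by (auto simp: torsion_def)
  qed
  thus ?thesis using assms add_mem by (auto simp: torsion_def)
qed

text \<open>The exponents of the monomials annihilated by $\mathcal M$.\<close>

definition socle :: "nat set" where
  "socle = {u \<in> S. \<forall>s\<in>S - {0}. \<not> strict u s}"

text \<open>A nonzero product of \<open>w\<close> with a basis element of positive degree would be a
  second torsion exponent.\<close>

lemma socle_if_torsion_singleton:
  assumes w: "torsion k = {w}"
  shows "w \<in> socle"
proof -
  have "\<not> strict w s" if "s \<in> S" "s \<noteq> 0" for s
    using torsion_add[of w k s] that w by auto
  moreover have "w \<in> S" using w by (auto simp: torsion_def)
  ultimately show ?thesis by (auto simp: socle_def)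
qed

end

section \<open>Ideals, powers of the maximal ideal and annihilators in terms of exponents\<close>

context graded_monomial_algebra
begin

lemma \<Phi>_mem_iff: "A \<subseteq> S \<Longrightarrow> p \<in> supported S \<Longrightarrow> \<Phi> p \<in> \<Phi> ` supported A \<longleftrightarrow> p \<in> supported A"
  using \<Phi>_inject supported_mono by blast

lemma image_supported_inject:
  assumes "A \<subseteq> S" "B \<subseteq> S"
  shows "\<Phi> ` supported A = \<Phi> ` supported B \<longleftrightarrow> A = B"
proof -
  have "inj_on \<Phi> (supported S)" using bij by (rule bij_betw_imp_inj_on)
  hence "\<Phi> ` supported A = \<Phi> ` supported B \<longleftrightarrow> (supported A :: 'k poly set) = supported B"
    by (rule inj_on_image_eq_iff) (simp_all add: assms supported_mono)
  thus ?thesis by (simp add: supported_inject)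
qed

lemma star_eq_0:
  assumes "p \<in> supported A" "q \<in> supported B"
    and "\<And>a b. a \<in> A \<Longrightarrow> b \<in> B \<Longrightarrow> \<not> strict a b"
  shows "star p q = 0"
  using star_in_supported[OF assms(1,2), of "{}"] assms(3) by (auto simp: supported_empty)

lemma ideal_supported:
  assumes "A \<subseteq> S" "\<And>a s. a \<in> A \<Longrightarrow> s \<in> S \<Longrightarrow> strict a s \<Longrightarrow> a + s \<in> A"
  shows "ideal (\<Phi> ` supported A) G"
proof (rule idealI)
  have *: "p \<in> supported A \<Longrightarrow> p \<in> supported S" for p :: "'k poly"
    using supported_mono assms(1) by blast
  show "subgroup (\<Phi> ` supported A) (add_monoid G)"
  proof (rule add.subgroupI)
    show "\<Phi> ` supported A \<noteq> {}" using supported_0 by blast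
  qed (auto simp: * \<Phi>_closed \<Phi>_uminus supported_add simp flip: \<Phi>_add)
  fix a x assume "a \<in> \<Phi> ` supported A" "x \<in> carrier G"
  then obtain p q where pq: "p \<in> supported A" "q \<in> supported S" "a = \<Phi> p" "x = \<Phi> q"
    by (auto simp: carrier_eq)
  have "star p q \<in> supported A" using star_in_supported[OF pq(1,2)] assms(2) by blast
  thus "a \<otimes> x \<in> \<Phi> ` supported A" using pq * by (auto simp flip: \<Phi>_star)
  moreover have "x \<otimes> a = a \<otimes> x" using pq * \<Phi>_closed m_comm by auto
  ultimately show "x \<otimes> a \<in> \<Phi> ` supported A" by simp
qed (rule ring_axioms)

definition max_ideal :: "'g set" where
  "max_ideal = \<Phi> ` supported (S - {0})"

lemma ideal_max_ideal: "ideal max_ideal G"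
  unfolding max_ideal_def by (rule ideal_supported) (auto simp: add_mem)

lemma max_ideal_power_subset:
  "ideal_power G max_ideal k \<subseteq> \<Phi> ` supported {s\<in>S. k \<le> ord s}"
proof (induction k)
  case 0
  thus ?case by (simp add: carrier_eq)
next
  case (Suc k)
  show ?case
  proof
    fix x assume "x \<in> ideal_power G max_ideal (Suc k)"
    hence "x \<in> ideal_prod G (ideal_power G max_ideal k) max_ideal" by simp
    thus "x \<in> \<Phi> ` supported {s\<in>S. Suc k \<le> ord s}"
    proof (induction rule: ideal_prod.induct)
      case (prod i j)
      obtain p where p: "p \<in> supported {s\<in>S. k \<le> ord s}" "i = \<Phi> p" using Suc prod by blast
      obtain q where q: "q \<in> supported (S - {0})" "j = \<Phi> q" using prod by (auto simp: max_ideal_def)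
      have "star p q \<in> supported {s\<in>S. Suc k \<le> ord s}"
      proof (rule star_in_supported[OF p(1) q(1)])
        fix a b assume "a \<in> {s\<in>S. k \<le> ord s}" "b \<in> S - {0}" "strict a b"
        moreover from this have "ord b \<noteq> 0" using ord_eq_0 by blast
        ultimately show "a + b \<in> {s\<in>S. Suc k \<le> ord s}" by (auto simp: strict_def add_mem)
      qed
      moreover have "p \<in> supported S" "q \<in> supported S" using p q by (auto simp: supported_def)
      ultimately show ?case using p q by (auto simp flip: \<Phi>_star)
    next
      case (sum s1 s2)
      then obtain p q where pq: "p \<in> supported {s\<in>S. Suc k \<le> ord s}" "q \<in> supported {s\<in>S. Suc k \<le> ord s}"
        "s1 = \<Phi> p" "s2 = \<Phi> q" by blast
      hence "p + q \<in> supported {s\<in>S. Suc k \<le> ord s}"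
        by (intro supported_add)
      moreover have "p \<in> supported S" "q \<in> supported S"
        using pq by (auto simp: supported_def)
      ultimately show ?case using pq by (auto simp flip: \<Phi>_add)
    qed
  qed
qed

lemma monom_in_max_ideal_power:
  "s \<in> S \<Longrightarrow> k \<le> ord s \<Longrightarrow> \<Phi> (Polynomial.monom 1 s) \<in> ideal_power G max_ideal k"
proof (induction k arbitrary: s)
  case 0
  thus ?case by (simp add: \<Phi>_closed)
next
  case (Suc k)
  have "s \<noteq> 0" using Suc.prems ord_zero by (cases "s = 0") auto
  then obtain u v where uv: "u \<in> S" "v \<in> S" "s = u + v" "ord v = 1" "ord s = Suc (ord u)"
    using ord_split Suc.prems by blast
  hence "v \<noteq> 0" using ord_zero by (cases "v = 0") auto
  hence "\<Phi> (Polynomial.monom 1 v) \<in> max_ideal" using uv by (auto simp: max_ideal_def)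
  moreover have "\<Phi> (Polynomial.monom 1 u) \<in> ideal_power G max_ideal k" using Suc uv by auto
  ultimately have "\<Phi> (Polynomial.monom 1 u) \<otimes> \<Phi> (Polynomial.monom 1 v) \<in> ideal_power G max_ideal (Suc k)"
    by (simp add: ideal_prod.prod)
  moreover have "\<Phi> (Polynomial.monom 1 u) \<otimes> \<Phi> (Polynomial.monom 1 v) = \<Phi> (Polynomial.monom 1 s)"
    using uv by (simp add: star_monom_monom strict_def flip: \<Phi>_star)
  ultimately show ?case by simp
qed

text \<open>\<open>N\<close> is only required to lie between the monomials with exponents in
  \<open>A\<close> and their span. Powers of the maximal ideal are known in exactly this form, and
  both bounds have the same annihilator.\<close>

lemma zero_colon_eq:
  assumes "A \<subseteq> S" "N \<subseteq> \<Phi> ` supported A" "\<And>s. s \<in> A \<Longrightarrow> \<Phi> (Polynomial.monom 1 s) \<in> N"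
  shows "zero_colon G N = \<Phi> ` supported {u\<in>S. \<forall>s\<in>A. \<not> strict u s}"
proof safe
  fix x assume x: "x \<in> zero_colon G N"
  then obtain p where p: "p \<in> supported S" "x = \<Phi> p" by (auto simp: zero_colon_def carrier_eq)
  have "star p (Polynomial.monom 1 s) = 0" if "s \<in> A" for s
  proof -
    have "\<Phi> p \<otimes> \<Phi> (Polynomial.monom 1 s) = \<zero>"
      using x p assms(3)[OF that] by (simp add: zero_colon_def)
    moreover have "Polynomial.monom 1 s \<in> supported S" using that assms(1) by auto
    ultimately show ?thesis using p(1) \<Phi>_eq_0 star_supported by (metis \<Phi>_star)
  qed
  hence "p \<in> supported {u\<in>S. \<forall>s\<in>A. \<not> strict u s}"
    using p by (auto simp: star_monom_eq_0_iff supported_def)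
  thus "x \<in> \<Phi> ` supported {u\<in>S. \<forall>s\<in>A. \<not> strict u s}" using p by blast
next
  fix p :: "'k poly" assume p: "p \<in> supported {u\<in>S. \<forall>s\<in>A. \<not> strict u s}"
  hence pS: "p \<in> supported S" by (auto simp: supported_def)
  have "\<Phi> p \<otimes> y = \<zero>" if "y \<in> N" for y
  proof -
    obtain q where q: "q \<in> supported A" "y = \<Phi> q" using assms \<open>y \<in> N\<close> by blast
    have "star p q = 0" by (rule star_eq_0[OF p q(1)]) auto
    moreover have "q \<in> supported S" using q assms supported_mono by blast
    ultimately show ?thesis using q pS \<Phi>_star[of p q] by (simp add: \<Phi>_0)
  qed
  thus "\<Phi> p \<in> zero_colon G N" using pS \<Phi>_closed by (auto simp: zero_colon_def)
qed

lemma PIdl_monom: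
  assumes "w \<in> S"
  shows "PIdl (\<Phi> (Polynomial.monom 1 w)) = (\<lambda>p. \<Phi> (star p (Polynomial.monom 1 w))) ` supported S"
  using assms by (auto simp: cgenideal_def carrier_eq \<Phi>_star)

end

locale graded_monomial_algebra_with_reduction =
  graded_monomial_algebra S ord G \<Phi> + semigroup_with_reduction S ord g r
  for S ord and G :: "('g, 'b) ring_scheme" (structure) and \<Phi> :: "'k::field poly \<Rightarrow> 'g" and g r
begin

lemma zero_colon_power: "zero_colon G (ideal_power G max_ideal k) = \<Phi> ` supported (torsion k)"
proof -
  have "zero_colon G (ideal_power G max_ideal k) =
      \<Phi> ` supported {u\<in>S. \<forall>s\<in>{s\<in>S. k \<le> ord s}. \<not> strict u s}"
    by (rule zero_colon_eq) (use max_ideal_power_subset[of k] monom_in_max_ideal_power in auto)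
  moreover have "{u\<in>S. \<forall>s\<in>{s\<in>S. k \<le> ord s}. \<not> strict u s} = torsion k"
    by (auto simp: torsion_def)
  ultimately show ?thesis by simp
qed

lemma zero_colon_max_ideal: "zero_colon G max_ideal = \<Phi> ` supported socle"
  unfolding socle_def by (rule zero_colon_eq) (auto simp: max_ideal_def)

lemma local_cohomology_eq: "local_cohomology_0 G max_ideal = \<Phi> ` supported (torsion r)"
proof -
  have "(\<Union>k\<in>{1..}. \<Phi> ` supported (torsion k)) = \<Phi> ` supported (torsion r)"
  proof safe
    fix p :: "'k poly" and k assume "p \<in> supported (torsion k)"
    thus "\<Phi> p \<in> \<Phi> ` supported (torsion r)" using supported_mono[OF torsion_le_r] by blast
  next
    fix p :: "'k poly" assume "p \<in> supported (torsion r)"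
    thus "\<Phi> p \<in> (\<Union>k\<in>{1..}. \<Phi> ` supported (torsion k))"
      \<comment> \<open>The union in \<open>local_cohomology_0\<close> starts at 1 while
        \<open>r\<close> may be 0, hence the index \<open>Suc r\<close>.\<close>
      using supported_mono[OF torsion_mono[of r "Suc r"]] by (intro UN_I[of "Suc r"]) auto
  qed
  thus ?thesis by (simp add: local_cohomology_0_def zero_colon_power)
qed

lemma torsion_subset: "torsion k \<subseteq> S" by (auto simp: torsion_def)
lemma socle_subset: "socle \<subseteq> S" by (auto simp: socle_def)

lemma is_buchsbaum_iff: "is_buchsbaum G max_ideal \<longleftrightarrow> torsion r \<subseteq> socle"
proof
  assume b: "is_buchsbaum G max_ideal"
  show "torsion r \<subseteq> socle"
  proof
    fix u assume u: "u \<in> torsion r"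
    hence "u \<in> S" by (auto simp: torsion_def)
    have "\<not> strict u s" if s: "s \<in> S" "s \<noteq> 0" for s
    proof
      assume "strict u s"
      have "\<Phi> (Polynomial.monom 1 s) \<otimes> \<Phi> (Polynomial.monom 1 u) \<in> ideal_prod G max_ideal (local_cohomology_0 G max_ideal)"
        unfolding local_cohomology_eq using s u
        by (intro ideal_prod.prod) (auto simp: max_ideal_def)
      hence "\<Phi> (Polynomial.monom 1 (s + u)) = \<Phi> 0"
        using b \<open>strict u s\<close> \<open>u \<in> S\<close> s strict_commute[of u s]
        by (simp add: is_buchsbaum_def star_monom_monom \<Phi>_0 flip: \<Phi>_star)
      thus False using \<Phi>_inject[of "Polynomial.monom 1 (s + u)" 0] add_mem[of s u] s \<open>u \<in> S\<close> by simp
    qed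
    thus "u \<in> socle" using \<open>u \<in> S\<close> by (auto simp: socle_def)
  qed
next
  assume *: "torsion r \<subseteq> socle"
  have "x = \<zero>" if "x \<in> ideal_prod G max_ideal (local_cohomology_0 G max_ideal)" for x
    using that
  proof (induction rule: ideal_prod.induct)
    case (prod i j)
    then obtain p q where pq: "p \<in> supported (S - {0})" "q \<in> supported (torsion r)" "i = \<Phi> p" "j = \<Phi> q"
      unfolding local_cohomology_eq by (auto simp: max_ideal_def)
    have "star p q = 0"
    proof (rule star_eq_0[OF pq(1,2)])
      fix a b assume "a \<in> S - {0}" "b \<in> torsion r"
      hence "\<not> strict b a" using * by (auto simp: socle_def)
      thus "\<not> strict a b" by (simp add: strict_commute)
    qed
    moreover have "p \<in> supported S" "q \<in> supported S"
      using pq torsion_subset[of r] by (auto simp: supported_def)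
    ultimately show ?case using pq \<Phi>_star[of p q] by (simp add: \<Phi>_0)
  qed auto
  \<comment> \<open>\<open>is_buchsbaum\<close> asks for equality with the zero ideal, and
    \<open>ideal_prod\<close> is generated by products, so zero has to be exhibited as one.\<close>
  moreover have "\<zero> \<otimes> \<zero> \<in> ideal_prod G max_ideal (local_cohomology_0 G max_ideal)"
    unfolding local_cohomology_eq unfolding max_ideal_def
    by (intro ideal_prod.prod image_eqI[of _ _ 0]) (simp_all add: \<Phi>_0)
  hence "\<zero> \<in> ideal_prod G max_ideal (local_cohomology_0 G max_ideal)" by simp
  ultimately show "is_buchsbaum G max_ideal" unfolding is_buchsbaum_def by blast
qed

text \<open>A multiplier of a socle monomial acts through its constant coefficient only, so the
  principal ideal is the line spanned by that monomial. Conversely, a one-element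
  \<open>torsion r\<close> lies in the socle.\<close>

lemma principal_socle_iff:
  assumes w: "w \<in> S"
  shows "\<Phi> ` supported (torsion r) = PIdl (\<Phi> (Polynomial.monom 1 w)) \<and> \<Phi> (Polynomial.monom 1 w) \<in> zero_colon G max_ideal
    \<longleftrightarrow> torsion r = {w}"
proof -
  have soc: "\<Phi> (Polynomial.monom 1 w) \<in> zero_colon G max_ideal \<longleftrightarrow> w \<in> socle"
    unfolding zero_colon_max_ideal using \<Phi>_mem_iff[OF socle_subset] w by simp
  have "PIdl (\<Phi> (Polynomial.monom 1 w)) = \<Phi> ` supported {w}" if "w \<in> socle"
  proof -
    have eq: "star p (Polynomial.monom 1 w) = Polynomial.monom (Polynomial.coeff p 0) w" if "p \<in> supported S" for p :: "'k poly"
    proof (rule poly_eqI)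
      fix n
      have "Polynomial.coeff p (n - w) = 0 \<or> n = w" if "w \<le> n" "strict (n - w) w"
        using that \<open>w \<in> socle\<close> \<open>p \<in> supported S\<close> strict_commute[of w "n - w"] by (auto simp: socle_def supported_def)
      thus "Polynomial.coeff (star p (Polynomial.monom 1 w)) n = Polynomial.coeff (Polynomial.monom (Polynomial.coeff p 0) w) n"
        by (auto simp: coeff_star_monom)
    qed
    have "PIdl (\<Phi> (Polynomial.monom 1 w)) = (\<lambda>p. \<Phi> (Polynomial.monom (Polynomial.coeff p 0) w)) ` supported S"
      unfolding PIdl_monom[OF w] using eq by auto
    also have "\<dots> = \<Phi> ` supported {w}"
    proof safe
      fix p :: "'k poly" assume "p \<in> supported {w}"
      hence "p = Polynomial.monom (Polynomial.coeff (Polynomial.monom (Polynomial.coeff p w) 0) 0) w" by (simp add: supported_singleton)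
      moreover have "Polynomial.monom (Polynomial.coeff p w) 0 \<in> supported S" using zero_mem by simp
      ultimately show "\<Phi> p \<in> (\<lambda>p. \<Phi> (Polynomial.monom (Polynomial.coeff p 0) w)) ` supported S" by (metis (no_types, lifting) image_eqI)
    qed auto
    finally show ?thesis .
  qed
  moreover note socle_if_torsion_singleton[of r w]
  moreover have "\<Phi> ` supported (torsion r) = \<Phi> ` supported {w} \<longleftrightarrow> torsion r = {w}"
    using image_supported_inject[OF torsion_subset, of "{w}"] w by simp
  ultimately show ?thesis using soc by metis
qed

end

section \<open>The length of the zeroth local cohomology\<close>

lemma Sup_enat_eqI:
  assumes "P n" "\<And>m. P m \<Longrightarrow> m \<le> n"
  shows "Sup {enat m |m. P m} = enat n"
  by (intro antisym Sup_least Sup_upper) (use assms in auto)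

lemma (in cring) module_ideal_module:
  assumes "ideal H R"
  shows "module R (ideal_module R H)"
proof -
  interpret H: ideal H R by fact
  show ?thesis
  proof (rule moduleI)
    show "abelian_group (ideal_module R H)"
    proof (rule abelian_groupI)
      fix x assume "x \<in> carrier (ideal_module R H)"
      hence x: "x \<in> H" by (simp add: ideal_module_def)
      show "\<exists>y\<in>carrier (ideal_module R H). y \<oplus>\<^bsub>ideal_module R H\<^esub> x = \<zero>\<^bsub>ideal_module R H\<^esub>"
        using x H.a_inv_closed[OF x] H.Icarr[OF x]
        by (intro bexI[of _ "\<ominus> x"]) (simp_all add: ideal_module_def l_neg)
    next
      fix x y z assume "x \<in> carrier (ideal_module R H)" "y \<in> carrier (ideal_module R H)"
        "z \<in> carrier (ideal_module R H)"
      thus "x \<oplus>\<^bsub>ideal_module R H\<^esub> y \<oplus>\<^bsub>ideal_module R H\<^esub> z =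
          x \<oplus>\<^bsub>ideal_module R H\<^esub> (y \<oplus>\<^bsub>ideal_module R H\<^esub> z)"
        by (simp add: ideal_module_def a_assoc H.Icarr)
    qed (auto simp: ideal_module_def a_comm H.Icarr)
  qed (auto simp: ideal_module_def H.I_l_closed H.Icarr l_distr r_distr m_assoc is_cring)
qed

lemma (in cring) submodule_ideal_module:
  assumes "ideal H R" "ideal C R" "C \<subseteq> H"
  shows "submodule C R (ideal_module R H)"
proof -
  interpret H: ideal H R by fact
  interpret C: ideal C R by fact
  interpret M: module R "ideal_module R H" using assms(1) by (rule module_ideal_module)
  show ?thesis
  proof (rule M.submoduleI)
    fix a assume a: "a \<in> C"
    have "\<ominus>\<^bsub>ideal_module R H\<^esub> a = \<ominus> a"
    proof (rule M.minus_equality)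
      show "\<ominus> a \<oplus>\<^bsub>ideal_module R H\<^esub> a = \<zero>\<^bsub>ideal_module R H\<^esub>"
        using a by (simp add: ideal_module_def l_neg C.Icarr)
    qed (use a assms(3) C.a_inv_closed in \<open>auto simp: ideal_module_def\<close>)
    thus "\<ominus>\<^bsub>ideal_module R H\<^esub> a \<in> C" using C.a_inv_closed[OF a] by simp
  qed (use assms(3) in \<open>auto simp: ideal_module_def C.I_l_closed\<close>)
qed

lemma (in cring) submodule_ideal_moduleD:
  assumes "ideal H R" "submodule C R (ideal_module R H)"
  shows "C \<subseteq> H" "\<zero> \<in> C" "\<And>a x. a \<in> carrier R \<Longrightarrow> x \<in> C \<Longrightarrow> a \<otimes> x \<in> C"
proof -
  interpret C: submodule C R "ideal_module R H" by fact
  show "C \<subseteq> H" "\<zero> \<in> C" using C.subset C.one_closed by (auto simp: ideal_module_def)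
  show "\<And>a x. a \<in> carrier R \<Longrightarrow> x \<in> C \<Longrightarrow> a \<otimes> x \<in> C"
    using C.smult_closed by (simp add: ideal_module_def)
qed

context graded_monomial_algebra_with_reduction
begin

text \<open>For one torsion exponent the module is a line over K and has no proper nonzero
  submodule. For none the length is 0; for several, omitting one suitable exponent gives a chain
  with two steps.\<close>

lemma module_length_local_cohomology:
  "module_length G (ideal_module G (local_cohomology_0 G max_ideal)) = 1 \<longleftrightarrow> (\<exists>w. torsion r = {w})"
proof -
  let ?H = "\<Phi> ` supported (torsion r)"
  let ?chain = "\<lambda>n C. (\<forall>i\<le>n. submodule (C i) G (ideal_module G ?H)) \<and> (\<forall>i<n. C i \<subset> C (Suc i))"
  let ?len = "module_length G (ideal_module G ?H)"
  have len: "?len = Sup {enat n |n. \<exists>C :: nat \<Rightarrow> 'g set. ?chain n C}"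
    by (simp add: module_length_def)
  have H: "ideal ?H G" by (rule ideal_supported[OF torsion_subset torsion_add])
  note D = submodule_ideal_moduleD[OF H]
  have sub: "submodule (\<Phi> ` supported A) G (ideal_module G ?H)"
    if "A \<subseteq> torsion r" "\<And>a s. a \<in> A \<Longrightarrow> s \<in> S \<Longrightarrow> strict a s \<Longrightarrow> a + s \<in> A" for A
    by (rule submodule_ideal_module[OF H ideal_supported])
      (use that torsion_subset[of r] supported_mono[of A "torsion r"] in auto)
  have psubset: "\<Phi> ` supported A \<subset> \<Phi> ` supported B" if "A \<subset> B" "B \<subseteq> torsion r" for A B
    using that image_supported_inject[of A B] supported_mono[of A B, where 'a = 'k] torsion_subset[of r] by blast
  have sub0: "submodule (\<Phi> ` supported {}) G (ideal_module G ?H)" by (rule sub) auto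
  have subT: "submodule ?H G (ideal_module G ?H)" by (rule sub) (auto intro: torsion_add)
  have "?len = 1" if T: "torsion r = {w}" for w
  proof -
    have wS: "w \<in> S" using T torsion_subset[of r] by blast
    have sub_cases: "C = {\<zero>} \<or> C = ?H" if C: "submodule C G (ideal_module G ?H)" for C
    proof (cases "C = {\<zero>}")
      case False
      then obtain x where x: "x \<in> C" "x \<noteq> \<zero>" using D(2)[OF C] by blast
      then obtain p where p: "p \<in> supported {w}" "x = \<Phi> p" using D(1)[OF C] T by auto
      define c where "c = Polynomial.coeff p w"
      have p': "p = Polynomial.monom c w" using p by (simp add: supported_singleton c_def)
      have "c \<noteq> 0" using x p p' by (auto simp: \<Phi>_0)
      have "?H \<subseteq> C"
      proof safe
        fix q :: "'k poly" assume "q \<in> supported (torsion r)"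
        hence q: "q = Polynomial.monom (Polynomial.coeff q w) w" using T by (simp add: supported_singleton)
        define d where "d = Polynomial.coeff q w"
        have "\<Phi> (Polynomial.monom (d / c) 0) \<otimes> x \<in> C"
          by (rule D(3)[OF C _ x(1)], rule \<Phi>_closed) (simp add: zero_mem)
        also have "\<Phi> (Polynomial.monom (d / c) 0) \<otimes> x = \<Phi> q"
        proof -
          have "\<Phi> (Polynomial.monom (d / c) 0) \<otimes> \<Phi> (Polynomial.monom c w) =
              \<Phi> (star (Polynomial.monom (d / c) 0) (Polynomial.monom c w))"
            using wS zero_mem by (intro \<Phi>_star[symmetric]) simp_all
          also have "\<dots> = \<Phi> (Polynomial.monom d w)"
            using \<open>c \<noteq> 0\<close> by (simp add: star_monom_monom)
          finally show ?thesis using p(2) p' q d_def by metis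
        qed
        finally show "\<Phi> q \<in> C" .
      qed
      thus ?thesis using D(1)[OF C] by blast
    qed simp
    have le1: "n \<le> 1" if C: "?chain n C" for n and C :: "nat \<Rightarrow> 'g set"
    proof (rule ccontr)
      assume "\<not> n \<le> 1"
      hence n: "0 < n" "1 < n" "0 \<le> n" "1 \<le> n" "2 \<le> n" by simp_all
      have psub: "C 0 \<subset> C 1" "C 1 \<subset> C 2"
        using C[THEN conjunct2, rule_format, OF n(1)] C[THEN conjunct2, rule_format, OF n(2)]
        by (simp_all add: numeral_2_eq_2)
      have "\<zero> \<in> C 0" "C 2 \<subseteq> ?H" "C 1 = {\<zero>} \<or> C 1 = ?H"
        using C[THEN conjunct1, rule_format] n D(1,2) sub_cases by simp_all
      moreover have "C 1 \<noteq> {\<zero>}" using \<open>\<zero> \<in> C 0\<close> psub(1) by force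
      moreover have "C 1 \<noteq> ?H" using \<open>C 2 \<subseteq> ?H\<close> psub(2) by force
      ultimately show False by simp
    qed
    have ex1: "?chain 1 (\<lambda>i. if i = 0 then \<Phi> ` supported {} else ?H)"
    proof -
      have "\<Phi> ` supported {} \<subset> ?H" by (rule psubset) (use T in auto)
      thus ?thesis using sub0 subT by simp
    qed
    have "Sup {enat n |n. \<exists>C :: nat \<Rightarrow> 'g set. ?chain n C} = enat 1"
    proof (rule Sup_enat_eqI)
      show "\<exists>C :: nat \<Rightarrow> 'g set. ?chain 1 C" 
        by (rule exI[of "?chain 1" "\<lambda>i. if i = 0 then \<Phi> ` supported {} else ?H"]) (rule ex1)
      show "m \<le> 1" if "\<exists>C :: nat \<Rightarrow> 'g set. ?chain m C" for m
        using that by (elim exE) (rule le1)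
    qed
    thus ?thesis by (simp only: len one_enat_def)
  qed
  moreover have "\<exists>w. torsion r = {w}" if len1: "?len = 1"
  proof (rule ccontr)
    assume no: "\<not> (\<exists>w. torsion r = {w})"
    show False
    proof (cases "torsion r = {}")
      case True
      have le0: "n = 0" if C: "?chain n C" for n and C :: "nat \<Rightarrow> 'g set"
      proof (rule ccontr)
        assume "n \<noteq> 0"
        hence n: "0 < n" "0 \<le> n" "1 \<le> n" by simp_all
        have "C 0 \<subset> C 1" using C[THEN conjunct2, rule_format, OF n(1)] by simp
        moreover have "\<zero> \<in> C 0" "C 1 \<subseteq> ?H" using C[THEN conjunct1, rule_format] n D(1,2) by simp_all
        moreover have "?H = {\<zero>}" using True by (simp add: supported_empty \<Phi>_0)
        ultimately show False by force
      qed
      have "Sup {enat n |n. \<exists>C :: nat \<Rightarrow> 'g set. ?chain n C} = enat 0"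
      proof (rule Sup_enat_eqI)
        show "\<exists>C :: nat \<Rightarrow> 'g set. ?chain 0 C"
          using subT by (intro exI[of _ "\<lambda>_. ?H"]) simp
        show "m \<le> 0" if "\<exists>C :: nat \<Rightarrow> 'g set. ?chain m C" for m
          using that by (elim exE) (drule le0, simp)
      qed
      thus False using len1 by (simp add: len one_enat_def)
    next
      case False
      \<comment> \<open>Least order guarantees that no other torsion exponent reaches
        \<open>w\<close> by a strict sum, so the remaining exponents still span an ideal.\<close>
      define w where "w = arg_min ord (\<lambda>u. u \<in> torsion r)"
      have w: "w \<in> torsion r" "\<And>u. u \<in> torsion r \<Longrightarrow> ord w \<le> ord u"
        using False arg_min_nat_lemma[of "\<lambda>u. u \<in> torsion r" _ ord] unfolding w_def by blast+
      let ?A = "torsion r - {w}"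
      have "submodule (\<Phi> ` supported ?A) G (ideal_module G ?H)"
      proof (rule sub)
        fix a s assume a: "a \<in> ?A" and s: "s \<in> S" "strict a s"
        have "a + s \<noteq> w"
        proof
          assume "a + s = w"
          hence "ord s = 0" using w(2)[of a] a s(2) by (auto simp: strict_def)
          thus False using ord_eq_0[of s] s a \<open>a + s = w\<close> by simp
        qed
        thus "a + s \<in> ?A" using torsion_add[of a r s] a s by simp
      qed auto
      moreover have "\<Phi> ` supported {} \<subset> \<Phi> ` supported ?A" "\<Phi> ` supported ?A \<subset> ?H"
        by (rule psubset; use no w in blast)+
      ultimately have ex2: "?chain 2 (\<lambda>i. if i = 0 then \<Phi> ` supported {} else if i = 1 then \<Phi> ` supported ?A else ?H)"
        using sub0 subT by (auto simp: less_2_cases_iff)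
      have "\<exists>C :: nat \<Rightarrow> 'g set. ?chain 2 C"
        by (rule exI[of "?chain 2" "\<lambda>i. if i = 0 then \<Phi> ` supported {} else if i = 1 then \<Phi> ` supported ?A else ?H"])
          (rule ex2)
      hence "enat 2 \<le> ?len" unfolding len by (intro Sup_upper CollectI exI[of _ 2] conjI refl)
      thus False using len1 by (simp add: one_enat_def)
    qed
  qed
  ultimately show ?thesis unfolding local_cohomology_eq by blast
qed

end

section \<open>Semigroups with three generators\<close>

locale three_generated =
  fixes g1 g2 g3 :: nat
  assumes g1_pos: "0 < g1" and g12: "g1 < g2" and g23: "g2 < g3"
begin

definition lengths :: "nat \<Rightarrow> nat set" where
  "lengths s = {a + b + c |a b c. s = a * g1 + b * g2 + c * g3}"

definition max_length :: "nat \<Rightarrow> nat" where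
  "max_length s = Max (lengths s)"

definition sgp :: "nat set" where
  "sgp = {s. lengths s \<noteq> {}}"

lemma mult_g1_length: "(a + b + c) * g1 \<le> a * g1 + b * g2 + c * g3"
proof -
  have "b * g1 \<le> b * g2" "c * g1 \<le> c * g3" using g12 g23 by auto
  thus ?thesis unfolding add_mult_distrib by linarith
qed

lemma length_le: "l \<in> lengths s \<Longrightarrow> l * g1 \<le> s"
  using mult_g1_length by (auto simp: lengths_def)

lemma finite_lengths: "finite (lengths s)"
proof (rule finite_subset)
  show "lengths s \<subseteq> {..s}"
  proof
    fix l assume "l \<in> lengths s"
    hence "l * g1 \<le> s" by (rule length_le)
    moreover have "l \<le> l * g1" using g1_pos by simp
    ultimately show "l \<in> {..s}" unfolding atMost_iff by (rule order_trans[rotated])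
  qed
qed simp

lemma sgpI: "s = a * g1 + b * g2 + c * g3 \<Longrightarrow> s \<in> sgp"
  by (auto simp: sgp_def lengths_def)

lemma length_le_max_length: "s = a * g1 + b * g2 + c * g3 \<Longrightarrow> a + b + c \<le> max_length s"
  unfolding max_length_def by (rule Max_ge[OF finite_lengths]) (auto simp: lengths_def)

lemma max_length_rep:
  assumes "s \<in> sgp"
  obtains a b c where "s = a * g1 + b * g2 + c * g3" "max_length s = a + b + c"
proof -
  have "max_length s \<in> lengths s"
    using assms finite_lengths unfolding max_length_def sgp_def by (intro Max_in) auto
  thus ?thesis using that by (auto simp: lengths_def)
qed

lemma mult_g1_max_length: "s \<in> sgp \<Longrightarrow> max_length s * g1 \<le> s"
  using mult_g1_length by (metis max_length_rep)

lemma add_mem_sgp: "s \<in> sgp \<Longrightarrow> u \<in> sgp \<Longrightarrow> s + u \<in> sgp"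
proof (elim max_length_rep)
  fix a b c a' b' c' assume "s = a * g1 + b * g2 + c * g3" "u = a' * g1 + b' * g2 + c' * g3"
  thus "s + u \<in> sgp"
    by (intro sgpI[of _ "a + a'" "b + b'" "c + c'"]) (simp add: algebra_simps)
qed

lemma max_length_add: "s \<in> sgp \<Longrightarrow> u \<in> sgp \<Longrightarrow> max_length s + max_length u \<le> max_length (s + u)"
proof (elim max_length_rep)
  fix a b c a' b' c'
  assume s: "s = a * g1 + b * g2 + c * g3" "max_length s = a + b + c"
    and u: "u = a' * g1 + b' * g2 + c' * g3" "max_length u = a' + b' + c'"
  have "s + u = (a + a') * g1 + (b + b') * g2 + (c + c') * g3"
    unfolding s(1) u(1) by (simp add: algebra_simps)
  from length_le_max_length[OF this] show "max_length s + max_length u \<le> max_length (s + u)"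
    using s(2) u(2) by simp
qed

lemma max_length_mult_g1: "max_length (k * g1) = k"
proof (rule antisym)
  have "k * g1 = k * g1 + 0 * g2 + 0 * g3" by simp
  from length_le_max_length[OF this] show "k \<le> max_length (k * g1)" by simp
  have "k * g1 \<in> sgp" by (rule sgpI[of _ k 0 0]) simp
  hence "max_length (k * g1) * g1 \<le> k * g1" by (rule mult_g1_max_length)
  thus "max_length (k * g1) \<le> k" using g1_pos by simp
qed

lemma max_length_eq_0: "s \<in> sgp \<Longrightarrow> max_length s = 0 \<Longrightarrow> s = 0"
  by (elim max_length_rep) auto

text \<open>A longer representation of the part, completed by the removed summands, would be a
  longer representation of \<open>s\<close>.\<close>

lemma max_length_sub:
  assumes s: "s = a * g1 + b * g2 + c * g3" "max_length s = a + b + c"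
    and le: "a' \<le> a" "b' \<le> b" "c' \<le> c"
  shows "max_length (a' * g1 + b' * g2 + c' * g3) = a' + b' + c'"
proof (rule antisym)
  define u where "u = a' * g1 + b' * g2 + c' * g3"
  define v where "v = (a - a') * g1 + (b - b') * g2 + (c - c') * g3"
  have "a * g1 = a' * g1 + (a - a') * g1" "b * g2 = b' * g2 + (b - b') * g2"
    "c * g3 = c' * g3 + (c - c') * g3"
    using le by (simp_all flip: add_mult_distrib)
  hence "s = u + v" unfolding s(1) u_def v_def by linarith
  moreover have "u \<in> sgp" "v \<in> sgp" unfolding u_def v_def by (auto intro: sgpI)
  ultimately have "max_length u + max_length v \<le> a + b + c"
    using max_length_add[of u v] s(2) by simp
  moreover have "(a - a') + (b - b') + (c - c') \<le> max_length v"
    by (rule length_le_max_length) (simp add: v_def)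
  ultimately show "max_length u \<le> a' + b' + c'" using le by linarith
qed (rule length_le_max_length, simp)

lemma max_length_split:
  assumes "s \<in> sgp" "s \<noteq> 0"
  shows "\<exists>u\<in>sgp. \<exists>v\<in>{g1, g2, g3}. s = u + v \<and> max_length v = 1 \<and> max_length s = Suc (max_length u)"
proof -
  obtain a b c where s: "s = a * g1 + b * g2 + c * g3" "max_length s = a + b + c"
    using assms by (elim max_length_rep)
  have split: ?thesis if "a' \<le> a" "b' \<le> b" "c' \<le> c" "v \<in> {g1, g2, g3}" "max_length v = 1"
    "s = a' * g1 + b' * g2 + c' * g3 + v" "a + b + c = Suc (a' + b' + c')" for a' b' c' v
    using that max_length_sub[OF s that(1-3)] s(2)
    by (intro bexI[of _ "a' * g1 + b' * g2 + c' * g3"] bexI[of _ v] sgpI[OF refl] conjI) simp_all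
  have "0 < a \<or> 0 < b \<or> 0 < c" using assms s by auto
  thus ?thesis
  proof (elim disjE)
    assume "0 < a"
    thus ?thesis
      using max_length_sub[OF s, of 1 0 0] s(1) by (intro split[of "a - 1" b c g1]) (cases a; simp)+
  next
    assume "0 < b"
    thus ?thesis
      using max_length_sub[OF s, of 0 1 0] s(1) by (intro split[of a "b - 1" c g2]) (cases b; simp)+
  next
    assume "0 < c"
    thus ?thesis
      using max_length_sub[OF s, of 0 0 1] s(1) by (intro split[of a b "c - 1" g3]) (cases c; simp)+
  qed
qed

lemma g_mem_sgp: "g1 \<in> sgp" "g2 \<in> sgp" "g3 \<in> sgp"
  by (rule sgpI[of _ 1 0 0] sgpI[of _ 0 1 0] sgpI[of _ 0 0 1]; simp)+

lemma zero_mem_sgp: "0 \<in> sgp"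
  by (rule sgpI[of _ 0 0 0]) simp

lemma max_length_0: "max_length 0 = 0"
  using max_length_mult_g1[of 0] by simp

sublocale semigroup_with_order sgp max_length
proof
  fix s assume "s \<in> sgp" "s \<noteq> 0"
  thus "\<exists>u\<in>sgp. \<exists>v\<in>sgp. s = u + v \<and> max_length v = 1 \<and> max_length s = Suc (max_length u)"
    using max_length_split[of s] g_mem_sgp by blast
qed (auto simp: zero_mem_sgp add_mem_sgp max_length_0 max_length_eq_0 max_length_add)

text \<open>This guarantees that the minimum defining the reduction number exists. In a long
  representation g1 copies of g2 can be exchanged for g2 copies of g1, and likewise for g3, without
  shortening it.\<close>

lemma reduction_exists:
  assumes "s \<in> sgp" "Suc (2 * g1) \<le> max_length s"
  shows "\<exists>u\<in>sgp. max_length s = Suc (max_length u) \<and> s = g1 + u"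
proof -
  have *: "\<exists>a b c. s = Suc a * g1 + b * g2 + c * g3 \<and> max_length s \<le> Suc a + b + c"
  proof -
    obtain a b c where s: "s = a * g1 + b * g2 + c * g3" "max_length s = a + b + c"
      using assms by (elim max_length_rep)
    \<comment> \<open>With a = 0 and both b and c below g1 the length would be below 2 g1; this is
      the origin of the bound.\<close>
    consider "0 < a" | "g1 \<le> b" | "g1 \<le> c" using s assms by linarith
    thus ?thesis
    proof cases
      case 1
      thus ?thesis using s by (intro exI[of _ "a - 1"] exI[of _ b] exI[of _ c]) auto
    next
      case 2
      hence "b * g2 = (b - g1) * g2 + g1 * g2" by (simp flip: add_mult_distrib)
      hence "s = Suc (a + g2 - 1) * g1 + (b - g1) * g2 + c * g3"
        using s g12 by (simp add: algebra_simps)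
      moreover have "max_length s \<le> Suc (a + g2 - 1) + (b - g1) + c" using s g12 2 by simp
      ultimately show ?thesis by blast
    next
      case 3
      hence "c * g3 = (c - g1) * g3 + g1 * g3" by (simp flip: add_mult_distrib)
      hence "s = Suc (a + g3 - 1) * g1 + b * g2 + (c - g1) * g3"
        using s g12 g23 by (simp add: algebra_simps)
      moreover have "max_length s \<le> Suc (a + g3 - 1) + b + (c - g1)" using s g12 g23 3 by simp
      ultimately show ?thesis by blast
    qed
  qed
  then obtain a b c where s: "s = Suc a * g1 + b * g2 + c * g3" "max_length s \<le> Suc a + b + c"
    by blast
  have eq: "max_length s = Suc a + b + c" using s length_le_max_length[OF s(1)] by simp
  show ?thesis
    using max_length_sub[OF s(1) eq, of a b c] eq s(1)
    by (intro bexI[of _ "a * g1 + b * g2 + c * g3"] sgpI[OF refl] conjI) auto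
qed

end

section \<open>Torsion exponents when the maximal ideal kills all of them\<close>

locale three_generated_with_reduction =
  three_generated g1 g2 g3 + semigroup_with_reduction sgp max_length g1 r for g1 g2 g3 r
begin

lemma socle_rep_no_g1:
  assumes "torsion r \<subseteq> socle" "s \<in> torsion r" "s = a * g1 + b * g2 + c * g3" "max_length s = a + b + c"
  shows "a = 0"
proof (rule ccontr)
  assume "a \<noteq> 0"
  define u where "u = (a - 1) * g1 + b * g2 + c * g3"
  have su: "s = u + g1" using assms(3) \<open>a \<noteq> 0\<close> by (cases a) (auto simp: u_def)
  have ord: "max_length s = Suc (max_length u)"
    using max_length_sub[OF assms(3,4), of "a - 1" b c] \<open>a \<noteq> 0\<close> assms(4) by (simp add: u_def)
  have uS: "u \<in> sgp" unfolding u_def by (rule sgpI) simp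
  obtain k where "\<not> strict s (k * g1)" using assms(2) torsion_iff by blast
  \<comment> \<open>\<open>s + k * g1\<close> is \<open>u + Suc k * g1\<close> and
    \<open>max_length s\<close> is one more than \<open>max_length u\<close>, so the same surplus in
    length shows up for \<open>u\<close> one multiple of \<open>g1\<close> later.\<close>
  hence "\<not> strict u (Suc k * g1)"
    using ord ord_mult_g[of k] ord_mult_g[of "Suc k"] by (simp add: strict_def su add.assoc)
  hence "u \<in> torsion r" using uS torsion_iff by blast
  hence "\<not> strict u g1" using assms(1) g_mem g_pos by (auto simp: socle_def)
  thus False using ord ord_g su by (simp add: strict_def)
qed

text \<open>The case k = 1 of \<open>torsion_iff\<close>: a representation with at least two more
  summands than \<open>max_length u\<close> shows that x already kills the class of
  \<open>u\<close>.\<close>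

lemma torsion_if_longer:
  assumes "u \<in> sgp" "u + g1 = b * g2 + c * g3" "max_length u + 1 < b + c"
  shows "u \<in> torsion r"
proof -
  have "b + c \<le> max_length (u + g1)" using length_le_max_length[of "u + g1" 0 b c] assms(2) by simp
  hence "\<not> strict u (1 * g1)" using assms(3) by (simp add: strict_def ord_g)
  thus ?thesis using assms(1) torsion_iff by blast
qed

lemma socle_not_add:
  assumes "torsion r \<subseteq> socle" "u \<in> torsion r" "v \<in> sgp" "v \<noteq> 0" "max_length (u + v) = max_length u + max_length v"
  shows False
  using assms by (auto simp: socle_def strict_def)

lemma torsion_relation:
  assumes "torsion r \<subseteq> socle" "s \<in> torsion r"
  obtains b c p q where "s = b * g2 + c * g3" "max_length s = b + c"
    "1 \<le> q" "q \<le> c" "q + 2 \<le> p" "g1 + q * g3 = p * g2"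
proof -
  have sS: "s \<in> sgp" using assms(2) by (simp add: torsion_def)
  obtain a b c where s0: "s = a * g1 + b * g2 + c * g3" "max_length s = a + b + c"
    using sS by (elim max_length_rep)
  have a: "a = 0" using socle_rep_no_g1[OF assms s0] .
  hence s: "s = b * g2 + c * g3" "max_length s = b + c" using s0 by simp_all
  have "s + g1 \<in> sgp" using sS add_mem g_mem by blast
  then obtain a' b' c' where s': "s + g1 = a' * g1 + b' * g2 + c' * g3" "max_length (s + g1) = a' + b' + c'"
    by (elim max_length_rep)
  have "\<not> strict s g1" using assms g_mem g_pos by (auto simp: socle_def)
  \<comment> \<open>One extra summand comes from \<open>g1\<close>, the other from the failure of
    strictness.\<close>
  hence long: "b + c + 2 \<le> a' + b' + c'"
    using ord_add[OF sS g_mem] ord_g s s' by (simp add: strict_def)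
  \<comment> \<open>A summand \<open>g1\<close> could be cancelled on both sides, leaving a
    representation of \<open>s\<close> with at least \<open>b + c + 1\<close> summands.\<close>
  have "a' = 0"
  proof (rule ccontr)
    assume "a' \<noteq> 0"
    then obtain a'' where a'': "a' = Suc a''" by (cases a') auto
    hence "s = a'' * g1 + b' * g2 + c' * g3" using s' by simp
    from length_le_max_length[OF this] show False using long s a'' by simp
  qed
  have eq: "b * g2 + c * g3 + g1 = b' * g2 + c' * g3" using s s' \<open>a' = 0\<close> by simp
  \<comment> \<open>Otherwise replace the \<open>d\<close> surplus copies of \<open>g3\<close> by
    the smaller \<open>g2\<close>. The right side then has at least \<open>b + 2\<close> copies of
    \<open>g2\<close>, yet is at most \<open>b * g2 + g1\<close>, which is less than
    \<open>(b + 1) * g2\<close>.\<close>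
  have "c' < c"
  proof (rule ccontr)
    assume "\<not> c' < c"
    define d where "d = c' - c"
    have c': "c' = c + d" using \<open>\<not> c' < c\<close> by (simp add: d_def)
    have "d * g2 \<le> d * g3" using g23 by simp
    hence "(b' + d) * g2 \<le> b * g2 + g1" using eq by (simp add: c' algebra_simps)
    moreover have "(b + 2) * g2 \<le> (b' + d) * g2" using long \<open>a' = 0\<close> c' by (intro mult_le_mono1) simp
    ultimately show False using g12 g1_pos by simp
  qed
  \<comment> \<open>Cancelling \<open>c'\<close> copies of \<open>g3\<close> and \<open>b\<close>
    copies of \<open>g2\<close> leaves the relation; the two extra summands in \<open>long\<close>
    become \<open>q + 2 \<le> p\<close>.\<close>
  define q where "q = c - c'"
  define p where "p = b' - b"
  have "c = c' + q" using \<open>c' < c\<close> by (simp add: q_def)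
  moreover have "b' = b + p" using long \<open>a' = 0\<close> \<open>c' < c\<close> by (simp add: p_def)
  ultimately have "g1 + q * g3 = p * g2" "1 \<le> q" "q \<le> c" "q + 2 \<le> p"
    using eq long \<open>a' = 0\<close> \<open>c' < c\<close> by (simp_all add: algebra_simps)
  thus ?thesis using s that by blast
qed

text \<open>The relation need not be the one obtained from \<open>s\<close>. Applying it to a
  torsion element from which it did not arise is what makes \<open>q\<close> unique.\<close>

lemma torsion_eq_relation:
  assumes "torsion r \<subseteq> socle" "s = b * g2 + c * g3" "max_length s = b + c" "s \<in> torsion r"
    and q: "q \<le> c" "q + 2 \<le> p" "g1 + q * g3 = p * g2"
  shows "b = 0" "c = q"
proof -
  \<comment> \<open>Since \<open>q \<le> c'\<close>, the relation rewrites \<open>u + g1\<close> as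
    \<open>b' + p\<close> copies of \<open>g2\<close> and \<open>c' - q\<close> of
    \<open>g3\<close>, at least two summands more than \<open>u\<close> has. So \<open>u\<close> is
    torsion, although adding \<open>v\<close> to it is strict.\<close>
  have step: False if "b' \<le> b" "c' \<le> c" "q \<le> c'" "b + c = Suc (b' + c')" "v \<in> {g2, g3}"
    "s = b' * g2 + c' * g3 + v" for b' c' v
  proof -
    define u where "u = b' * g2 + c' * g3"
    have "s = 0 * g1 + b * g2 + c * g3" "max_length s = 0 + b + c" using assms by simp_all
    from max_length_sub[OF this, of 0 b' c'] that have ord: "max_length u = b' + c'" by (simp add: u_def)
    have uS: "u \<in> sgp" by (rule sgpI[of _ 0 b' c']) (simp add: u_def)
    have c': "c' * g3 = (c' - q) * g3 + q * g3"
      using that(3) by (simp flip: add_mult_distrib)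
    have "u \<in> torsion r"
    proof (rule torsion_if_longer[OF uS])
      show "u + g1 = (b' + p) * g2 + (c' - q) * g3"
        using q(3) c' unfolding u_def add_mult_distrib by linarith
      show "max_length u + 1 < b' + p + (c' - q)" using ord q that by linarith
    qed
    moreover have "v \<in> sgp" "v \<noteq> 0" using that g_mem_sgp g12 g23 by auto
    moreover have "max_length v = 1"
      using ord_add[OF uS \<open>v \<in> sgp\<close>] ord_eq_0[OF \<open>v \<in> sgp\<close>] \<open>v \<noteq> 0\<close> that(4,6) ord assms(3)
      by (cases "max_length v") (auto simp: u_def)
    ultimately show False
      using socle_not_add[OF assms(1), of u v] that(4,6) ord assms(3) by (simp add: u_def)
  qed
  show "b = 0"
  proof (rule ccontr)
    assume "b \<noteq> 0"
    thus False using step[of "b - 1" c g2] q assms(2) by (cases b) auto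
  qed
  show "c = q"
  proof (rule ccontr)
    assume "c \<noteq> q"
    thus False using step[of b "c - 1" g3] q assms(2) by (cases c) auto
  qed
qed

lemma torsion_singleton:
  assumes "torsion r \<subseteq> socle" "torsion r \<noteq> {}"
  shows "\<exists>k\<ge>1. torsion r = {k * g3}"
proof -
  obtain s where s: "s \<in> torsion r" using assms by blast
  from torsion_relation[OF assms(1) s] obtain b c p q where
    1: "s = b * g2 + c * g3" "max_length s = b + c" "1 \<le> q" "q \<le> c" "q + 2 \<le> p" "g1 + q * g3 = p * g2" .
  have "t = q * g3" if t: "t \<in> torsion r" for t
  proof -
    from torsion_relation[OF assms(1) t] obtain b' c' p' q' where
      2: "t = b' * g2 + c' * g3" "max_length t = b' + c'" "1 \<le> q'" "q' \<le> c'" "q' + 2 \<le> p'" "g1 + q' * g3 = p' * g2" .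
    have t': "t = q' * g3" "b' = 0" "c' = q'"
      using torsion_eq_relation[OF assms(1) 2(1,2) t 2(4,5,6)] 2 by simp_all
    have s': "s = q * g3" "b = 0" "c = q"
      using torsion_eq_relation[OF assms(1) 1(1,2) s 1(4,5,6)] 1 by simp_all
    have "q' = q"
    \<comment> \<open>The relation with the smaller coefficient of \<open>g3\<close> applies to both
      elements, and it forces the other element to contain exactly that many copies of
      \<open>g3\<close>.\<close>
    proof (cases "q \<le> q'")
      case True
      thus ?thesis using torsion_eq_relation(2)[OF assms(1) 2(1,2) t, of q p] 1 2 t' by simp
    next
      case False
      thus ?thesis using torsion_eq_relation(2)[OF assms(1) 1(1,2) s, of q' p'] 1 2 s' by simp
    qed
    thus ?thesis using t' by simp
  qed
  thus ?thesis using s 1(3) by blast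
qed

end

section \<open>The associated graded ring of a semigroup ring\<close>

lemma semigroup_ring_simps [simp]:
  "x \<otimes>\<^bsub>semigroup_ring S\<^esub> y = x * y" "x \<oplus>\<^bsub>semigroup_ring S\<^esub> y = x + y"
  "\<one>\<^bsub>semigroup_ring S\<^esub> = 1" "\<zero>\<^bsub>semigroup_ring S\<^esub> = 0"
  "f \<in> carrier (semigroup_ring S) \<longleftrightarrow> (\<forall>n. fps_nth f n \<noteq> 0 \<longrightarrow> n \<in> S)"
  by (simp_all add: semigroup_ring_def ring_of_type_algebra_def)

lemma fps_mult_nth_nonzero:
  fixes f g :: "'k::field fps"
  assumes "fps_nth (f * g) n \<noteq> 0"
  obtains i where "i \<le> n" "fps_nth f i \<noteq> 0" "fps_nth g (n - i) \<noteq> 0"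
proof -
  have "(\<Sum>i=0..n. fps_nth f i * fps_nth g (n - i)) \<noteq> 0" using assms by (simp add: fps_mult_nth)
  then obtain i where "i \<in> {0..n}" "fps_nth f i * fps_nth g (n - i) \<noteq> 0"
    by (rule sum.not_neutral_contains_not_neutral)
  thus ?thesis using that by auto
qed

text \<open>A finite generating set is recorded because ideals are closed under finite sums only,
  whereas elements of the semigroup ring are infinite series. It also bounds each exponent by a
  multiple of its order.\<close>

locale generated_semigroup_with_order = semigroup_with_order +
  fixes A :: "nat set"
  assumes finite_gens: "finite A" and gens_mem: "A \<subseteq> S" and gens_nonzero: "0 \<notin> A"
    and split_gens: "s \<in> S \<Longrightarrow> s \<noteq> 0 \<Longrightarrow> \<exists>u\<in>S. \<exists>v\<in>A. s = u + v \<and> ord s = Suc (ord u)"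
begin

lemma gens_pos: "v \<in> A \<Longrightarrow> 0 < v"
  using gens_nonzero by (cases v) auto

lemma ord_pos: "s \<in> S \<Longrightarrow> s \<noteq> 0 \<Longrightarrow> 1 \<le> ord s"
  using ord_eq_0[of s] by (cases "ord s") auto

text \<open>\<open>s\<close> is a sum of \<open>ord s\<close> generators. Hence only finitely many
  exponents have a given order, and an element of the graded ring with finitely many nonzero degrees
  is given by a polynomial.\<close>

lemma le_ord_mult: "s \<in> S \<Longrightarrow> s \<le> ord s * Max A"
proof (induction "ord s" arbitrary: s)
  case 0
  thus ?case using ord_eq_0 by simp
next
  case (Suc h)
  have "s \<noteq> 0" using Suc.hyps(2) ord_zero by (cases "s = 0") auto
  then obtain u v where uv: "u \<in> S" "v \<in> A" "s = u + v" "ord s = Suc (ord u)"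
    using split_gens Suc.prems by blast
  have "v \<le> Max A" using uv finite_gens by simp
  moreover have "u \<le> ord u * Max A" using Suc.hyps(1)[of u] Suc.hyps(2) uv by simp
  ultimately have "u + v \<le> Suc (ord u) * Max A" by simp
  thus ?case using uv(3,4) by simp
qed

lemma finite_ord_eq: "finite {s \<in> S. ord s = h}"
  by (rule finite_subset[of _ "{..h * Max A}"]) (use le_ord_mult in auto)

lemma sumset_power_eq: "sumset_power S h = {s \<in> S. h \<le> ord s}"
proof (cases h)
  case 0
  thus ?thesis by (simp add: sumset_power_def)
next
  case (Suc k)
  have "sum_list xs \<in> S \<and> length xs \<le> ord (sum_list xs)" if "set xs \<subseteq> S - {0}" for xs
    using that
  proof (induction xs)
    case Nil
    thus ?case by (simp add: zero_mem)
  next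
    case (Cons x xs)
    hence "x \<in> S" "1 \<le> ord x" "sum_list xs \<in> S" "length xs \<le> ord (sum_list xs)"
      using ord_pos by auto
    thus ?case using ord_add[of x "sum_list xs"] add_mem by auto
  qed
  moreover have "\<exists>xs. s = sum_list xs \<and> length xs = Suc k \<and> set xs \<subseteq> S - {0}"
    if "s \<in> S" "Suc k \<le> ord s" for s
    using that
  proof (induction k arbitrary: s)
    case 0
    hence "s \<noteq> 0" using ord_zero by (cases "s = 0") auto
    thus ?case using 0 by (intro exI[of _ "[s]"]) simp
  next
    case (Suc k)
    hence "s \<noteq> 0" using ord_zero by (cases "s = 0") auto
    then obtain u v where uv: "u \<in> S" "v \<in> A" "s = u + v" "ord s = Suc (ord u)"
      using split_gens Suc.prems by blast
    then obtain xs where xs: "u = sum_list xs" "length xs = Suc k" "set xs \<subseteq> S - {0}"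
      using Suc.IH[of u] Suc.prems by auto
    thus ?case using uv gens_mem gens_pos[of v] by (intro exI[of _ "v # xs"]) auto
  qed
  ultimately show ?thesis unfolding Suc sumset_power_def by (auto, metis)
qed

lemma semigroup_order_eq: "s \<in> S \<Longrightarrow> semigroup_order S s = ord s"
  unfolding semigroup_order_def sumset_power_eq by (rule the_equality) auto

abbreviation R :: "'k::field fps ring" where "R \<equiv> semigroup_ring S"

text \<open>Candidate for the h-th power of the maximal ideal, with membership read off
  coefficientwise; \<open>ideal_power_max_ideal_R\<close> confirms it.\<close>

definition level :: "nat \<Rightarrow> 'k::field fps set" where
  "level h = {f. \<forall>n. fps_nth f n \<noteq> 0 \<longrightarrow> n \<in> S \<and> h \<le> ord n}"

lemma levelI: "(\<And>n. fps_nth f n \<noteq> 0 \<Longrightarrow> n \<in> S \<and> h \<le> ord n) \<Longrightarrow> f \<in> level h"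
  by (simp add: level_def)

lemma levelD: "f \<in> level h \<Longrightarrow> fps_nth f n \<noteq> 0 \<Longrightarrow> n \<in> S \<and> h \<le> ord n"
  by (simp add: level_def)

lemma level_0: "level 0 = carrier R"
  unfolding level_def by auto

lemma level_antimono: "h \<le> k \<Longrightarrow> level k \<subseteq> level h"
  by (auto simp: level_def)

lemma level_carrier: "f \<in> level h \<Longrightarrow> f \<in> carrier R"
  by (simp add: level_def)

lemma zero_level [simp]: "0 \<in> level h"
  by (simp add: level_def)

lemma level_add: "f \<in> level h \<Longrightarrow> f' \<in> level h \<Longrightarrow> f + f' \<in> level h"
  by (rule levelI) (metis add.right_neutral fps_add_nth levelD)

lemma level_uminus: "f \<in> level h \<Longrightarrow> - f \<in> level h"
  by (simp add: level_def)

lemma level_diff: "f \<in> level h \<Longrightarrow> f' \<in> level h \<Longrightarrow> f - f' \<in> level h"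
  using level_add[of f h "- f'"] level_uminus[of f' h] by simp

lemma level_sum: "(\<And>i. i \<in> I \<Longrightarrow> f i \<in> level h) \<Longrightarrow> sum f I \<in> level h"
  by (induction I rule: infinite_finite_induct) (auto intro: level_add)

lemma level_mult:
  assumes "f \<in> level h" "f' \<in> level k"
  shows "f * f' \<in> level (h + k)"
proof (rule levelI)
  fix n assume "fps_nth (f * f') n \<noteq> 0"
  then obtain i where i: "i \<le> n" "fps_nth f i \<noteq> 0" "fps_nth f' (n - i) \<noteq> 0"
    by (rule fps_mult_nth_nonzero)
  hence "i \<in> S" "h \<le> ord i" "n - i \<in> S" "k \<le> ord (n - i)" using assms levelD by blast+
  thus "n \<in> S \<and> h + k \<le> ord n"
    using ord_add[of i "n - i"] add_mem[of i "n - i"] i(1) by simp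
qed

lemma fps_X_power_level: "s \<in> S \<Longrightarrow> h \<le> ord s \<Longrightarrow> fps_X ^ s \<in> level h"
  by (auto simp: level_def split: if_splits)

lemma cring_semigroup_ring: "cring (R :: 'k::field fps ring)"
proof (rule cringI)
  have car: "f \<in> carrier R \<longleftrightarrow> f \<in> level 0" for f :: "'k fps" by (simp add: level_0)
  note * = level_add level_mult[of _ 0 _ 0, simplified] fps_X_power_level[of 0 0, simplified, OF zero_mem]
  show "abelian_group (R :: 'k fps ring)"
  proof (rule abelian_groupI)
    fix x :: "'k fps" assume "x \<in> carrier R"
    thus "\<exists>y\<in>carrier R. y \<oplus>\<^bsub>R\<^esub> x = \<zero>\<^bsub>R\<^esub>"
      using level_uminus[of x 0]
      by (intro bexI[of _ "- x"]) (simp_all only: car semigroup_ring_simps(2,4) left_minus)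
  qed (simp_all only: car semigroup_ring_simps(2,4) * zero_level ac_simps add_0_left add_0_right)
  show "comm_monoid (R :: 'k fps ring)"
    by (rule comm_monoidI)
      (simp_all only: car semigroup_ring_simps(1,3) * ac_simps mult_1_left mult_1_right)
qed (simp_all only: semigroup_ring_simps(1-4) distrib_right)

lemma uminus_semigroup_ring: "f \<in> level 0 \<Longrightarrow> \<ominus>\<^bsub>R\<^esub> f = - f"
proof -
  assume f: "f \<in> level 0"
  interpret cring R by (rule cring_semigroup_ring)
  show ?thesis
  proof (rule minus_equality)
    show "f \<in> carrier R" "- f \<in> carrier R"
      using level_uminus[OF f] f unfolding level_0 by blast+
  qed simp
qed

lemma ideal_level: "ideal (level h) (R :: 'k::field fps ring)"
proof -
  interpret cring "R :: 'k fps ring" by (rule cring_semigroup_ring)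
  show ?thesis
  proof (rule idealI)
    show "subgroup (level h) (add_monoid (R :: 'k fps ring))"
    proof (rule add.subgroupI)
      fix f :: "'k fps" assume f: "f \<in> level h"
      hence "f \<in> level 0" using level_antimono by blast
      hence "\<ominus>\<^bsub>R\<^esub> f = - f" by (rule uminus_semigroup_ring)
      thus "\<ominus>\<^bsub>R\<^esub> f \<in> level h" using level_uminus[OF f] by simp
    next
      show "(level h :: 'k fps set) \<noteq> {}" using zero_level by blast
    next
      show "level h \<subseteq> carrier (R :: 'k fps ring)" using level_carrier by blast
    qed (simp only: semigroup_ring_simps(2) level_add)
  next
    fix f x :: "'k fps" assume f: "f \<in> level h" and "x \<in> carrier R"
    hence "x \<in> level 0" by (simp only: level_0)
    thus "f \<otimes>\<^bsub>R\<^esub> x \<in> level h" "x \<otimes>\<^bsub>R\<^esub> f \<in> level h"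
      using level_mult[OF f, of x 0] level_mult[of x 0 f h] f by simp_all
  qed (rule ring_axioms)
qed

text \<open>A series with infinitely many terms has to become a finite combination of generators.
  Each exponent is assigned one generator that can be split off, and the terms are collected by
  assigned generator.\<close>

lemma level_Suc_subset_ideal:
  fixes I :: "'k::field fps set"
  assumes "ideal I R" "\<And>v f. v \<in> A \<Longrightarrow> f \<in> level h \<Longrightarrow> f * fps_X ^ v \<in> I"
  shows "level (Suc h) \<subseteq> I"
proof
  fix f :: "'k fps" assume f: "f \<in> level (Suc h)"
  interpret I: additive_subgroup I R using assms(1) by (rule ideal.axioms(1))
  define \<sigma> where "\<sigma> s = (SOME v. v \<in> A \<and> (\<exists>u\<in>S. s = u + v \<and> ord s = Suc (ord u)))" for s
  have split: "\<sigma> s \<in> A \<and> (\<exists>u\<in>S. s = u + \<sigma> s \<and> ord s = Suc (ord u))" if "s \<in> S" "s \<noteq> 0" for s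
    unfolding \<sigma>_def by (rule someI_ex) (use split_gens[OF that] in blast)
  \<comment> \<open>\<open>part v\<close> gathers the terms assigned to \<open>v\<close>, already
    divided by t^v. Splitting off the assigned generator lowers the order by exactly one, which
    places \<open>part v\<close> in \<open>level h\<close>.\<close>
  define part where "part v = Abs_fps (\<lambda>n. if \<sigma> (n + v) = v then fps_nth f (n + v) else 0)" for v
  have part: "part v \<in> level h" for v
  proof (rule levelI)
    fix n assume "fps_nth (part v) n \<noteq> 0"
    hence n: "\<sigma> (n + v) = v" "fps_nth f (n + v) \<noteq> 0" by (auto simp: part_def split: if_splits)
    hence "n + v \<in> S" "Suc h \<le> ord (n + v)" using levelD[OF f] by blast+
    moreover from this have "n + v \<noteq> 0" using ord_zero by (cases "n + v = 0") auto
    ultimately show "n \<in> S \<and> h \<le> ord n" using split[of "n + v"] n(1) by auto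
  qed
  have "fps_nth f n = fps_nth (\<Sum>v\<in>A. part v * fps_X ^ v) n" for n
  proof (cases "n \<in> S \<and> n \<noteq> 0")
    case True
    hence \<sigma>: "\<sigma> n \<in> A" "\<sigma> n \<le> n" using split[of n] by (blast, metis le_add2)
    have "fps_nth (part v * fps_X ^ v) n = (if v = \<sigma> n then fps_nth f n else 0)" if "v \<in> A" for v
      using \<sigma>(2) by (auto simp: fps_X_power_mult_right_nth part_def)
    hence "(\<Sum>v\<in>A. fps_nth (part v * fps_X ^ v) n) = (\<Sum>v\<in>A. if v = \<sigma> n then fps_nth f n else 0)"
      by (intro sum.cong) auto
    thus ?thesis using \<sigma>(1) finite_gens by (simp add: fps_sum_nth)
  next
    case False
    hence "fps_nth f n = 0" using levelD[OF f, of n] ord_zero by (cases "n = 0") auto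
    moreover have "fps_nth (part v * fps_X ^ v) n = 0" for v
      using \<open>fps_nth f n = 0\<close> by (auto simp: fps_X_power_mult_right_nth part_def)
    ultimately show ?thesis by (simp add: fps_sum_nth)
  qed
  hence eq: "f = (\<Sum>v\<in>A. part v * fps_X ^ v)" by (rule fps_ext)
  have "(\<Sum>v\<in>B. part v * fps_X ^ v) \<in> I" if "B \<subseteq> A" for B
    using finite_subset[OF that finite_gens] that
  proof (induction B rule: finite_induct)
    case empty
    thus ?case using I.zero_closed by simp
  next
    case (insert v B)
    thus ?case using I.a_closed[of "part v * fps_X ^ v" "\<Sum>v\<in>B. part v * fps_X ^ v"] assms(2) part by simp
  qed
  thus "f \<in> I" using eq by simp
qed

definition max_ideal_R :: "'k::field fps set" where
  "max_ideal_R = Idl\<^bsub>R\<^esub> ((\<lambda>v. fps_X ^ v) ` A)"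

lemma gens_carrier: "(\<lambda>v. fps_X ^ v) ` A \<subseteq> carrier (R :: 'k::field fps ring)"
  using gens_mem by (auto split: if_splits)

lemma max_ideal_R_eq: "max_ideal_R = (level 1 :: 'k::field fps set)"
proof
  interpret cring "R :: 'k fps ring" by (rule cring_semigroup_ring)
  show "max_ideal_R \<subseteq> (level 1 :: 'k fps set)"
    unfolding max_ideal_R_def
  proof (rule genideal_minimal[OF ideal_level])
    show "(\<lambda>v. fps_X ^ v) ` A \<subseteq> (level 1 :: 'k fps set)"
    proof safe
      fix v assume "v \<in> A"
      hence "v \<in> S" "v \<noteq> 0" using gens_mem gens_pos[of v] by auto
      thus "fps_X ^ v \<in> (level 1 :: 'k fps set)" using ord_pos by (intro fps_X_power_level) auto
    qed
  qed
  have I: "ideal max_ideal_R (R :: 'k fps ring)"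
    unfolding max_ideal_R_def by (rule genideal_ideal[OF gens_carrier])
  have "level (Suc 0) \<subseteq> (max_ideal_R :: 'k fps set)"
  proof (rule level_Suc_subset_ideal[OF I])
    fix v and f :: "'k fps" assume "v \<in> A" "f \<in> level 0"
    hence "fps_X ^ v \<in> (max_ideal_R :: 'k fps set)" "f \<in> carrier R"
      using genideal_self[OF gens_carrier] unfolding max_ideal_R_def level_0 by blast+
    from ideal.I_l_closed[OF I this] show "f * fps_X ^ v \<in> max_ideal_R" by simp
  qed
  thus "level 1 \<subseteq> (max_ideal_R :: 'k fps set)" by simp
qed

lemma ideal_power_max_ideal_R: "ideal_power R max_ideal_R h = (level h :: 'k::field fps set)"
proof (induction h)
  case 0
  thus ?case by (simp add: level_0)
next
  case (Suc h)
  interpret cring "R :: 'k fps ring" by (rule cring_semigroup_ring)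
  have "ideal_prod R (level h) (level 1) = (level (Suc h) :: 'k fps set)"
  proof
    show "ideal_prod R (level h) (level 1) \<subseteq> (level (Suc h) :: 'k fps set)"
    proof
      fix x :: "'k fps" assume "x \<in> ideal_prod R (level h) (level 1)"
      thus "x \<in> level (Suc h)"
        by (induction rule: ideal_prod.induct) (use level_mult[of _ h _ 1] in \<open>auto intro: level_add\<close>)
    qed
    show "(level (Suc h) :: 'k fps set) \<subseteq> ideal_prod R (level h) (level 1)"
    proof (rule level_Suc_subset_ideal)
      show "ideal (ideal_prod R (level h) (level 1)) (R :: 'k fps ring)"
        by (rule ideal_prod_is_ideal; rule ideal_level)
      fix v and f :: "'k fps" assume "v \<in> A" "f \<in> level h"
      moreover from this have "v \<in> S" "1 \<le> ord v" using gens_mem gens_pos[of v] ord_pos[of v] by auto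
      ultimately show "f * fps_X ^ v \<in> ideal_prod R (level h) (level 1)"
        using ideal_prod.prod[of f "level h" "fps_X ^ v" "level 1" R] fps_X_power_level[of v 1] by simp
    qed
  qed
  thus ?case using Suc by (simp add: max_ideal_R_eq)
qed

lemma coset_eq: "level k +>\<^bsub>R\<^esub> f = {y. y - f \<in> level k}"
proof safe
  fix y assume "y \<in> level k +>\<^bsub>R\<^esub> f"
  thus "y - f \<in> level k" by (auto simp: a_r_coset_def r_coset_def)
next
  fix y assume "y - f \<in> level k"
  thus "y \<in> level k +>\<^bsub>R\<^esub> f" by (auto simp: a_r_coset_def r_coset_def intro!: bexI[of _ "y - f"])
qed

lemma coset_eq_iff: "level k +>\<^bsub>R\<^esub> f = level k +>\<^bsub>R\<^esub> f' \<longleftrightarrow> f - f' \<in> level k"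
proof
  assume "level k +>\<^bsub>R\<^esub> f = level k +>\<^bsub>R\<^esub> f'"
  moreover have "f \<in> level k +>\<^bsub>R\<^esub> f" by (simp add: coset_eq)
  ultimately show "f - f' \<in> level k" by (simp add: coset_eq)
next
  assume *: "f - f' \<in> level k"
  have "y - f \<in> level k \<longleftrightarrow> y - f' \<in> level k" for y
    using level_add[OF *, of "y - f"] level_diff[OF _ *, of "y - f'"] by auto
  thus "level k +>\<^bsub>R\<^esub> f = level k +>\<^bsub>R\<^esub> f'" by (simp add: coset_eq)
qed

lemma coset_0: "level k +>\<^bsub>R\<^esub> 0 = level k"
  by (simp add: coset_eq)

text \<open>For other representatives a and b, the difference a b - f f' equals (a - f) b + f (b -
  f'), and both terms lie one level higher. So the union over representatives in
  \<open>rcoset_mult\<close> is a single coset.\<close>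

lemma rcoset_mult_level:
  assumes "f \<in> level h" "f' \<in> level k"
  shows "rcoset_mult R (level (Suc (h + k))) (level (Suc h) +>\<^bsub>R\<^esub> f) (level (Suc k) +>\<^bsub>R\<^esub> f') =
    level (Suc (h + k)) +>\<^bsub>R\<^esub> (f * f')"
proof -
  have "level (Suc (h + k)) +>\<^bsub>R\<^esub> (a * b) = level (Suc (h + k)) +>\<^bsub>R\<^esub> (f * f')"
    if a: "a - f \<in> level (Suc h)" and b: "b - f' \<in> level (Suc k)" for a b
  proof -
    have "(b - f') + f' \<in> level k"
      by (rule level_add[OF _ assms(2)]) (use b level_antimono[of k "Suc k"] in auto)
    hence "b \<in> level k" by simp
    hence "(a - f) * b \<in> level (Suc (h + k))" "f * (b - f') \<in> level (Suc (h + k))"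
      using level_mult[OF a] level_mult[OF assms(1) b] by simp_all
    hence "(a - f) * b + f * (b - f') \<in> level (Suc (h + k))" by (rule level_add)
    thus ?thesis unfolding coset_eq_iff by (simp add: algebra_simps)
  qed
  moreover have "f - f \<in> level (Suc h)" "f' - f' \<in> level (Suc k)" by simp_all
  ultimately show ?thesis unfolding rcoset_mult_def coset_eq[of "Suc h"] coset_eq[of "Suc k"] semigroup_ring_simps(1)
    by blast
qed

section \<open>Identification of the associated graded ring with polynomials under
  \<open>star\<close>\<close>

abbreviation \<GG> :: "(nat \<Rightarrow> 'k::field fps set) ring" where
  "\<GG> \<equiv> assoc_graded R max_ideal_R"

definition component :: "'k::field poly \<Rightarrow> nat \<Rightarrow> 'k fps" where
  "component p h = Abs_fps (\<lambda>s. if ord s = h then coeff p s else 0)"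

definition graded_of_poly :: "'k::field poly \<Rightarrow> nat \<Rightarrow> 'k fps set" where
  "graded_of_poly p h = level (Suc h) +>\<^bsub>R\<^esub> component p h"

lemma component_nth [simp]: "fps_nth (component p h) s = (if ord s = h then coeff p s else 0)"
  by (simp add: component_def)

lemma component_0: "component 0 h = 0"
  by (simp add: fps_eq_iff)

lemma component_level: "p \<in> supported S \<Longrightarrow> component p h \<in> level h"
  by (rule levelI) (auto simp: supported_def split: if_splits)

lemma component_diff_level:
  assumes "f \<in> level h" "f' \<in> level h" "\<And>s. s \<in> S \<Longrightarrow> ord s = h \<Longrightarrow> fps_nth f s = fps_nth f' s"
  shows "f - f' \<in> level (Suc h)"
proof (rule levelI)
  fix n assume n: "fps_nth (f - f') n \<noteq> 0"
  hence "n \<in> S" "h \<le> ord n" using levelD[OF level_diff[OF assms(1,2)]] by blast+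
  moreover have "ord n \<noteq> h" using n assms(3)[OF \<open>n \<in> S\<close>] by auto
  ultimately show "n \<in> S \<and> Suc h \<le> ord n" by simp
qed

lemma assoc_graded_carrier:
  "f \<in> carrier (\<GG> :: (nat \<Rightarrow> 'k::field fps set) ring) \<longleftrightarrow>
     (\<forall>i. \<exists>x\<in>level i. f i = level (Suc i) +>\<^bsub>R\<^esub> x) \<and> finite {i. f i \<noteq> level (Suc i)}"
  unfolding assoc_graded_def by (simp only: ideal_power_max_ideal_R partial_object.simps mem_Collect_eq)

lemma graded_of_poly_inj: "inj_on graded_of_poly (supported S :: 'k::field poly set)"
proof (rule inj_onI)
  fix p q :: "'k poly"
  assume p: "p \<in> supported S" and q: "q \<in> supported S" and eq: "graded_of_poly p = graded_of_poly q"
  have "coeff p s = coeff q s" for s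
  proof (cases "s \<in> S")
    case True
    have "component p (ord s) - component q (ord s) \<in> level (Suc (ord s))"
      using fun_cong[OF eq, of "ord s"] by (simp add: graded_of_poly_def coset_eq_iff)
    from levelD[OF this, of s] show ?thesis by auto
  next
    case False
    thus ?thesis using supportedD[OF p, of s] supportedD[OF q, of s] by metis
  qed
  thus "p = q" by (rule poly_eqI)
qed

lemma graded_of_poly_carrier:
  fixes p :: "'k::field poly"
  assumes "p \<in> supported S"
  shows "graded_of_poly p \<in> carrier \<GG>"
proof -
  have "{i. graded_of_poly p i \<noteq> level (Suc i)} \<subseteq> ord ` {n. coeff p n \<noteq> 0}"
  proof
    fix i assume "i \<in> {i. graded_of_poly p i \<noteq> level (Suc i)}"
    hence i: "graded_of_poly p i \<noteq> level (Suc i)" by simp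
    have "component p i \<noteq> 0"
      using i by (auto simp: graded_of_poly_def coset_0)
    then obtain n where "fps_nth (component p i) n \<noteq> 0" by (auto simp: fps_eq_iff)
    thus "i \<in> ord ` {n. coeff p n \<noteq> 0}" by (auto split: if_splits)
  qed
  moreover have "finite {n. coeff p n \<noteq> 0}"
    using MOST_coeff_eq_0[of p] by (simp add: eventually_cofinite)
  ultimately have "finite {i. graded_of_poly p i \<noteq> level (Suc i)}" by (rule finite_subset[OF _ finite_imageI])
  thus ?thesis unfolding assoc_graded_carrier graded_of_poly_def using component_level[OF assms] by blast
qed

lemma graded_of_poly_surj:
  fixes f :: "nat \<Rightarrow> 'k::field fps set"
  assumes f: "f \<in> carrier \<GG>"
  shows "\<exists>p\<in>supported S. f = graded_of_poly p"
proof -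
  have "\<forall>i. \<exists>x. x \<in> level i \<and> f i = level (Suc i) +>\<^bsub>R\<^esub> x"
    using f unfolding assoc_graded_carrier by blast
  then obtain x where x: "\<And>i. x i \<in> level i" "\<And>i. f i = level (Suc i) +>\<^bsub>R\<^esub> x i" by metis
  \<comment> \<open>The coefficient at \<open>s\<close> is read off in degree \<open>ord s\<close>;
    another representative of that degree would differ only at exponents of larger order.\<close>
  define c where "c s = (if s \<in> S then fps_nth (x (ord s)) s else 0)" for s
  have "{s. c s \<noteq> 0} \<subseteq> (\<Union>i\<in>{i. f i \<noteq> level (Suc i)}. {s \<in> S. ord s = i})"
  proof
    fix s assume "s \<in> {s. c s \<noteq> 0}"
    hence s: "s \<in> S" "fps_nth (x (ord s)) s \<noteq> 0" by (auto simp: c_def split: if_splits)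
    have "x (ord s) \<notin> level (Suc (ord s))" using levelD[OF _ s(2), of "Suc (ord s)"] by auto
    hence "f (ord s) \<noteq> level (Suc (ord s))"
      using coset_eq_iff[of "Suc (ord s)" "x (ord s)" 0] unfolding coset_0 x(2) by simp
    thus "s \<in> (\<Union>i\<in>{i. f i \<noteq> level (Suc i)}. {s \<in> S. ord s = i})" using s by blast
  qed
  moreover have "finite (\<Union>i\<in>{i. f i \<noteq> level (Suc i)}. {s \<in> S. ord s = i})"
    using f finite_ord_eq unfolding assoc_graded_carrier by (intro finite_UN_I) auto
  ultimately have "finite {s. c s \<noteq> 0}" by (rule finite_subset)
  hence coeff: "coeff (Abs_poly c) = c" by (intro Abs_poly_inverse) (simp add: eventually_cofinite)
  hence sup: "Abs_poly c \<in> supported S" by (auto simp: supported_def c_def split: if_splits)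
  have "f i = graded_of_poly (Abs_poly c) i" for i
    unfolding x(2) graded_of_poly_def coset_eq_iff
    by (rule component_diff_level[OF x(1) component_level[OF sup]]) (simp add: coeff c_def)
  thus ?thesis using sup by blast
qed

lemma finsum_semigroup_ring:
  assumes "finite I" "\<And>i. i \<in> I \<Longrightarrow> f i \<in> level 0"
  shows "finsum R f I = sum f I"
proof -
  interpret cring R by (rule cring_semigroup_ring)
  show ?thesis using assms
  proof (induction I rule: finite_induct)
    case (insert i I)
    hence "f \<in> I \<rightarrow> carrier R" "f i \<in> carrier R" unfolding level_0[symmetric] by auto
    thus ?case using insert by (simp del: semigroup_ring_simps(5))
  qed simp
qed

text \<open>Modulo \<open>level (Suc n)\<close> only exponents of order \<open>n\<close> count. At
  such an \<open>s\<close>, the terms at \<open>j\<close> and \<open>s - j\<close> contribute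
  exactly when their orders add up to \<open>n\<close>, which is strictness.\<close>

lemma component_star:
  assumes p: "p \<in> supported S" and q: "q \<in> supported S"
  shows "(\<Sum>i\<le>n. component p i * component q (n - i)) - component (star p q) n \<in> level (Suc n)"
proof (rule component_diff_level)
  show "(\<Sum>i\<le>n. component p i * component q (n - i)) \<in> level n"
  proof (rule level_sum)
    fix i assume "i \<in> {..n}"
    thus "component p i * component q (n - i) \<in> level n"
      using level_mult[OF component_level[OF p, of i] component_level[OF q, of "n - i"]] by simp
  qed
  show "component (star p q) n \<in> level n" using star_supported[OF p q] by (rule component_level)
  fix s assume s: "ord s = n"
  have "fps_nth (\<Sum>i\<le>n. component p i * component q (n - i)) s =
      (\<Sum>i\<le>n. \<Sum>j=0..s. (if ord j = i then coeff p j else 0) * (if ord (s - j) = n - i then coeff q (s - j) else 0))"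
    by (simp add: fps_sum_nth fps_mult_nth)
  also have "\<dots> = (\<Sum>j=0..s. \<Sum>i\<le>n. (if ord j = i then coeff p j else 0) * (if ord (s - j) = n - i then coeff q (s - j) else 0))"
    by (rule sum.swap)
  also have "\<dots> = (\<Sum>j=0..s. if strict j (s - j) then coeff p j * coeff q (s - j) else 0)"
  proof (rule sum.cong[OF refl])
    fix j assume j: "j \<in> {0..s}"
    have "(\<Sum>i\<le>n. (if ord j = i then coeff p j else 0) * (if ord (s - j) = n - i then coeff q (s - j) else 0))
      = (\<Sum>i\<le>n. if ord j = i then coeff p j * (if ord (s - j) = n - ord j then coeff q (s - j) else 0) else 0)"
      by (rule sum.cong) auto
    also have "\<dots> = (if strict j (s - j) then coeff p j * coeff q (s - j) else 0)"
      using j s by (auto simp: strict_def)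
    finally show "(\<Sum>i\<le>n. (if ord j = i then coeff p j else 0) * (if ord (s - j) = n - i then coeff q (s - j) else 0))
      = (if strict j (s - j) then coeff p j * coeff q (s - j) else 0)" .
  qed
  also have "\<dots> = fps_nth (component (star p q) n) s" using s by (simp add: coeff_star)
  finally show "fps_nth (\<Sum>i\<le>n. component p i * component q (n - i)) s = fps_nth (component (star p q) n) s" .
qed

lemma graded_of_poly_star:
  fixes p q :: "'k::field poly"
  assumes p: "p \<in> supported S" and q: "q \<in> supported S"
  shows "graded_of_poly (star p q) = graded_of_poly p \<otimes>\<^bsub>\<GG>\<^esub> graded_of_poly q"
proof
  fix n
  let ?I = "level (Suc n) :: 'k fps set"
  interpret I: ideal ?I R by (rule ideal_level)
  interpret hom: ring_hom_ring R "R Quot ?I" "(+>\<^bsub>R\<^esub>) ?I" by (rule I.rcos_ring_hom_ring)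
  have lev: "component p i * component q (n - i) \<in> level 0" for i
    using level_mult[OF component_level[OF p, of i] component_level[OF q, of "n - i"]] level_antimono[of 0] by blast
  have "(graded_of_poly p \<otimes>\<^bsub>\<GG>\<^esub> graded_of_poly q) n =
      finsum (R Quot ?I) (\<lambda>i. rcoset_mult R ?I (graded_of_poly p i) (graded_of_poly q (n - i))) {..n}"
    unfolding assoc_graded_def by (simp only: ideal_power_max_ideal_R monoid.simps)
  also have "\<dots> = finsum (R Quot ?I) (\<lambda>i. ?I +>\<^bsub>R\<^esub> (component p i * component q (n - i))) {..n}"
  proof (rule hom.S.finsum_cong')
    fix i assume "i \<in> {..n}"
    thus "rcoset_mult R ?I (graded_of_poly p i) (graded_of_poly q (n - i)) =
        ?I +>\<^bsub>R\<^esub> (component p i * component q (n - i))"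
      using rcoset_mult_level[OF component_level[OF p, of i] component_level[OF q, of "n - i"]]
      by (simp add: graded_of_poly_def)
  next
    show "(\<lambda>i. ?I +>\<^bsub>R\<^esub> (component p i * component q (n - i))) \<in> {..n} \<rightarrow> carrier (R Quot ?I)"
      using lev unfolding level_0 by (intro Pi_I hom.hom_closed)
  qed simp
  also have "\<dots> = ?I +>\<^bsub>R\<^esub> (finsum R (\<lambda>i. component p i * component q (n - i)) {..n})"
    using lev unfolding level_0 by (subst hom.hom_finsum) (auto simp only: comp_def)
  also have "\<dots> = ?I +>\<^bsub>R\<^esub> (\<Sum>i\<le>n. component p i * component q (n - i))"
    using lev by (subst finsum_semigroup_ring) simp_all
  also have "\<dots> = graded_of_poly (star p q) n"
    unfolding graded_of_poly_def coset_eq_iff by (rule component_star[OF p q])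
  finally show "graded_of_poly (star p q) n = (graded_of_poly p \<otimes>\<^bsub>\<GG>\<^esub> graded_of_poly q) n" ..
qed

lemma graded_of_poly_add:
  fixes p q :: "'k::field poly"
  assumes p: "p \<in> supported S" and q: "q \<in> supported S"
  shows "graded_of_poly (p + q) = graded_of_poly p \<oplus>\<^bsub>\<GG>\<^esub> graded_of_poly q"
proof
  fix n
  interpret I: ideal "level (Suc n) :: 'k fps set" R by (rule ideal_level)
  have "(graded_of_poly p \<oplus>\<^bsub>\<GG>\<^esub> graded_of_poly q) n =
      level (Suc n) +>\<^bsub>R\<^esub> (component p n \<oplus>\<^bsub>R\<^esub> component q n)"
    unfolding assoc_graded_def graded_of_poly_def ring_record_simps
    using I.a_rcos_sum level_carrier[OF component_level[OF p]] level_carrier[OF component_level[OF q]] by blast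
  also have "component p n \<oplus>\<^bsub>R\<^esub> component q n = component (p + q) n"
    by (simp add: fps_eq_iff)
  finally show "graded_of_poly (p + q) n = (graded_of_poly p \<oplus>\<^bsub>\<GG>\<^esub> graded_of_poly q) n"
    by (simp add: graded_of_poly_def[of "p + q"])
qed

lemma graded_of_poly_0: "graded_of_poly (0 :: 'k::field poly) = \<zero>\<^bsub>\<GG>\<^esub>"
proof -
  have "\<zero>\<^bsub>\<GG>\<^esub> = (\<lambda>n. level (Suc n) :: 'k fps set)"
    unfolding assoc_graded_def by (simp only: ideal_power_max_ideal_R ring.simps)
  thus ?thesis by (auto simp: graded_of_poly_def component_0 coset_0)
qed

lemma graded_class_eq:
  assumes "s \<in> S"
  shows "graded_class R max_ideal_R (semigroup_order S s) (fps_X ^ s) = graded_of_poly (monom (1 :: 'k::field) s)"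
proof -
  have "component (monom (1 :: 'k) s) n = (if n = ord s then fps_X ^ s else 0)" for n
    by (auto simp: fps_eq_iff)
  thus ?thesis
    unfolding graded_class_def graded_of_poly_def ideal_power_max_ideal_R semigroup_order_eq[OF assms]
    by (intro ext) (auto simp: coset_0)
qed

lemma graded_of_poly_1: "graded_of_poly (1 :: 'k::field poly) = \<one>\<^bsub>\<GG>\<^esub>"
proof -
  have "component (1 :: 'k poly) n = (if n = 0 then 1 else 0)" for n
  proof (rule fps_ext)
    fix s show "fps_nth (component (1 :: 'k poly) n) s = fps_nth (if n = 0 then 1 else 0) s"
      by (cases "s = 0") (simp_all add: ord_zero)
  qed
  moreover have "\<one>\<^bsub>\<GG>\<^esub> = (\<lambda>n. if n = 0 then level 1 +>\<^bsub>R\<^esub> 1 else level (Suc n) :: 'k fps set)"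
    unfolding assoc_graded_def by (simp only: ideal_power_max_ideal_R monoid.simps semigroup_ring_simps(3))
  ultimately show ?thesis by (intro ext) (simp add: graded_of_poly_def coset_0)
qed

sublocale graded_monomial_algebra S ord "\<GG> :: (nat \<Rightarrow> 'k::field fps set) ring" graded_of_poly
proof
  show "bij_betw graded_of_poly (supported S) (carrier (\<GG> :: (nat \<Rightarrow> 'k fps set) ring))"
    unfolding bij_betw_def
    using graded_of_poly_inj graded_of_poly_carrier graded_of_poly_surj by blast
qed (rule graded_of_poly_add graded_of_poly_star graded_of_poly_0 graded_of_poly_1; assumption?)+

lemma graded_max_ideal_eq: "graded_max_ideal R max_ideal_R = (max_ideal :: (nat \<Rightarrow> 'k::field fps set) set)"
proof -
  have "graded_of_poly p 0 = \<zero>\<^bsub>\<GG>\<^esub> 0 \<longleftrightarrow> p \<in> supported (S - {0})"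
    if p: "p \<in> supported S" for p :: "'k poly"
  proof -
    have "\<zero>\<^bsub>\<GG>\<^esub> 0 = (level 1 +>\<^bsub>R\<^esub> 0 :: 'k fps set)"
      by (simp add: graded_of_poly_0[symmetric] graded_of_poly_def component_0)
    hence "graded_of_poly p 0 = \<zero>\<^bsub>\<GG>\<^esub> 0 \<longleftrightarrow> component p 0 \<in> level 1"
      using coset_eq_iff[of 1 "component p 0" 0] by (simp add: graded_of_poly_def)
    also have "\<dots> \<longleftrightarrow> p \<in> supported (S - {0})"
    proof
      assume *: "component p 0 \<in> level 1"
      have "Polynomial.coeff p 0 = 0"
      proof (rule ccontr)
        assume "Polynomial.coeff p 0 \<noteq> 0"
        thus False using levelD[OF *, of 0] ord_zero by simp
      qed
      show "p \<in> supported (S - {0})"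
      proof (rule supportedI)
        fix n assume "Polynomial.coeff p n \<noteq> 0"
        thus "n \<in> S - {0}" using supportedD[OF p] \<open>Polynomial.coeff p 0 = 0\<close> by (cases "n = 0") auto
      qed
    next
      assume *: "p \<in> supported (S - {0})"
      show "component p 0 \<in> level 1"
      proof (rule levelI)
        fix n assume "fps_nth (component p 0) n \<noteq> 0"
        hence "n \<in> S - {0}" "ord n = 0" using supportedD[OF *, of n] by (auto split: if_splits)
        thus "n \<in> S \<and> 1 \<le> ord n" using ord_eq_0[of n] by auto
      qed
    qed
    finally show ?thesis .
  qed
  moreover have "supported (S - {0}) \<subseteq> (supported S :: 'k poly set)" by (rule supported_mono) blast
  ultimately show ?thesis unfolding graded_max_ideal_def max_ideal_def carrier_eq by blast
qed

text \<open>The \<open>LEAST\<close> in the definition is meaningful only once some number satisfies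
  the equality; \<open>ex\<close> supplies \<open>k\<close>, since multiplication by t^g is a shift
  of coefficients. The equality at \<open>r\<close> is then tested on the single series t^s.\<close>

lemma reduction_number_spec:
  assumes g: "g \<in> S" "0 < g"
    and ex: "\<And>s. s \<in> S \<Longrightarrow> Suc k \<le> ord s \<Longrightarrow> \<exists>u\<in>S. k \<le> ord u \<and> s = g + u"
    and r: "r = reduction_number (R :: 'k::field fps ring) max_ideal_R (fps_X ^ g)"
    and s: "s \<in> S" "Suc r \<le> ord s"
  shows "\<exists>u\<in>S. r \<le> ord u \<and> s = g + u"
proof -
  let ?P = "\<lambda>k. (level (Suc k) :: 'k fps set) = (\<lambda>y. fps_X ^ g * y) ` level k"
  have r': "r = (LEAST k. ?P k)"
    unfolding r reduction_number_def ideal_power_max_ideal_R semigroup_ring_simps ..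
  have "?P k"
  proof
    have "fps_X ^ g \<in> (level 1 :: 'k fps set)"
      by (rule fps_X_power_level) (use ord_pos g in auto)
    thus "(\<lambda>y. fps_X ^ g * y) ` level k \<subseteq> (level (Suc k) :: 'k fps set)"
      using level_mult[of "fps_X ^ g" 1 _ k] by auto
    show "(level (Suc k) :: 'k fps set) \<subseteq> (\<lambda>y. fps_X ^ g * y) ` level k"
    proof
      fix f :: "'k fps" assume f: "f \<in> level (Suc k)"
      have nz: "g \<le> n \<and> n - g \<in> S \<and> k \<le> ord (n - g)" if "fps_nth f n \<noteq> 0" for n
        using levelD[OF f that] ex[of n] by auto
      have "f = fps_X ^ g * fps_shift g f"
      proof (rule fps_ext)
        fix n show "fps_nth f n = fps_nth (fps_X ^ g * fps_shift g f) n"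
          using nz[of n] by (cases "fps_nth f n = 0") (auto simp: fps_X_power_mult_nth)
      qed
      moreover have "fps_shift g f \<in> level k"
      proof (rule levelI)
        fix n assume "fps_nth (fps_shift g f) n \<noteq> 0"
        thus "n \<in> S \<and> k \<le> ord n" using nz[of "n + g"] by simp
      qed
      ultimately show "f \<in> (\<lambda>y. fps_X ^ g * y) ` level k" by (rule image_eqI)
    qed
  qed
  hence "?P r" unfolding r' by (rule LeastI)
  moreover have "(fps_X ^ s :: 'k fps) \<in> level (Suc r)" using s by (rule fps_X_power_level)
  ultimately have "(fps_X ^ s :: 'k fps) \<in> (\<lambda>y. fps_X ^ g * y) ` level r" by simp
  then obtain f :: "'k fps" where f: "f \<in> level r" "fps_X ^ s = fps_X ^ g * f" by blast
  have "fps_nth (fps_X ^ g * f) s \<noteq> 0" unfolding f(2)[symmetric] by simp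
  hence "g \<le> s" "fps_nth f (s - g) \<noteq> 0" by (auto simp: fps_X_power_mult_nth split: if_splits)
  thus ?thesis using levelD[OF f(1)] by (intro bexI[of _ "s - g"]) auto
qed

end

lemma (in three_generated) generated_semigroup:
  "generated_semigroup_with_order sgp max_length {g1, g2, g3}"
proof
  fix s assume "s \<in> sgp" "s \<noteq> 0"
  thus "\<exists>u\<in>sgp. \<exists>v\<in>{g1, g2, g3}. s = u + v \<and> max_length s = Suc (max_length u)"
    using max_length_split[of s] by blast
qed (use g1_pos g12 g23 g_mem_sgp in auto)

lemma (in three_generated) semigroup_gen_eq: "semigroup_gen {g1, g2, g3} = sgp"
proof safe
  fix s assume "s \<in> semigroup_gen {g1, g2, g3}"
  thus "s \<in> sgp" by induction (use zero_mem_sgp add_mem_sgp g_mem_sgp in auto)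
next
  interpret generated_semigroup_with_order sgp max_length "{g1, g2, g3}" by (rule generated_semigroup)
  fix s assume "s \<in> sgp"
  thus "s \<in> semigroup_gen {g1, g2, g3}"
  proof (induction s rule: less_induct)
    case (less s)
    show ?case
    proof (cases "s = 0")
      case True
      thus ?thesis by (simp add: semigroup_gen.zero)
    next
      case False
      then obtain u v where "u \<in> sgp" "v \<in> {g1, g2, g3}" "s = u + v" using split_gens less.prems by blast
      moreover from this have "0 < v" using gens_pos by blast
      ultimately show ?thesis using less.IH[of u] by (auto intro: semigroup_gen.add)
    qed
  qed
qed

text \<open>Dropping 0 leaves the generated semigroup unchanged, against minimality. In the theorem
  this yields \<open>0 < g1\<close>.\<close>

lemma minimal_generators_nonzero:
  assumes "minimal_generators A S"
  shows "0 \<notin> A"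
proof
  assume "0 \<in> A"
  have "semigroup_gen A \<subseteq> semigroup_gen (A - {0})"
  proof
    fix s assume "s \<in> semigroup_gen A"
    thus "s \<in> semigroup_gen (A - {0})"
    proof induction
      case (add s g)
      thus ?case using semigroup_gen.add[of s "A - {0}" g] by (cases "g = 0") auto
    qed (rule semigroup_gen.zero)
  qed
  moreover have "semigroup_gen (A - {0}) \<subseteq> semigroup_gen A"
  proof
    fix s assume "s \<in> semigroup_gen (A - {0})"
    thus "s \<in> semigroup_gen A" by induction (auto intro: semigroup_gen.intros)
  qed
  moreover have "A - {0} \<subset> A" using \<open>0 \<in> A\<close> by blast
  ultimately show False using assms unfolding minimal_generators_def by blast
qed

section \<open>Rings with a polynomial retract\<close>

text \<open>The binomial expansion modulo \<open>a\<close>, used to pass between an element and its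
  image in K[x] up to a nilpotent.\<close>

lemma (in cring) add_pow_congruence:
  fixes n :: nat
  assumes "a \<in> carrier R" "b \<in> carrier R"
  shows "\<exists>w\<in>carrier R. (a \<oplus> b) [^] n = a \<otimes> w \<oplus> b [^] n"
proof (induction n)
  case 0
  thus ?case using assms by (intro bexI[of _ \<zero>]) simp_all
next
  case (Suc n)
  then obtain w where w: "w \<in> carrier R" "(a \<oplus> b) [^] n = a \<otimes> w \<oplus> b [^] n" by blast
  have "(a \<oplus> b) [^] Suc n = (a \<otimes> w \<oplus> b [^] n) \<otimes> (a \<oplus> b)" using w by simp
  also have "\<dots> = a \<otimes> (w \<otimes> (a \<oplus> b) \<oplus> b [^] n) \<oplus> b [^] n \<otimes> b"
    using assms w(1) nat_pow_closed[OF assms(2), of n] by algebra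
  finally show ?case using assms w(1) by (intro bexI[of _ "w \<otimes> (a \<oplus> b) \<oplus> b [^] n"]) simp_all
qed

lemma (in primeideal) pow_mem: "a \<in> carrier R \<Longrightarrow> a [^] (n :: nat) \<in> I \<Longrightarrow> a \<in> I"
proof (induction n)
  case 0
  thus ?case using I_notcarr one_imp_carrier by simp
next
  case (Suc n)
  thus ?case using I_prime[of "a [^] n" a] by auto
qed

lemma poly_split_power:
  fixes q b :: "'k::field poly"
  assumes q: "q \<noteq> 0" "\<not> q dvd 1"
  shows "b \<noteq> 0 \<Longrightarrow> \<exists>e b'. b = q ^ e * b' \<and> \<not> q dvd b'"
proof (induction "degree b" arbitrary: b rule: less_induct)
  case less
  show ?case
  proof (cases "q dvd b")
    case True
    then obtain c where c: "b = q * c" by (rule dvdE)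
    have "c \<noteq> 0" using c less.prems by auto
    moreover have "0 < degree q" using q is_unit_iff_degree[of q] by auto
    ultimately obtain e c' where "c = q ^ e * c'" "\<not> q dvd c'"
      using less.hyps[of c] c q(1) by (auto simp: degree_mult_eq)
    thus ?thesis using c by (intro exI[of _ "Suc e"] exI[of _ c']) (simp add: ac_simps)
  next
    case False
    thus ?thesis by (intro exI[of _ 0] exI[of _ b]) simp
  qed
qed

text \<open>$K[x]$ is a retract of $G$ via $\iota$ and $\pi$, with nil kernel, so that $G$ has the
  spectrum of $K[x]$.\<close>

locale poly_retract = cring G for G (structure) +
  fixes \<iota> :: "'k::field poly \<Rightarrow> 'a" and \<pi> :: "'a \<Rightarrow> 'k poly"
  assumes \<iota>_closed: "\<iota> a \<in> carrier G"
    and \<iota>_add: "\<iota> (a + b) = \<iota> a \<oplus> \<iota> b" and \<iota>_mult: "\<iota> (a * b) = \<iota> a \<otimes> \<iota> b" and \<iota>_1: "\<iota> 1 = \<one>"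
    and \<pi>_add: "f \<in> carrier G \<Longrightarrow> h \<in> carrier G \<Longrightarrow> \<pi> (f \<oplus> h) = \<pi> f + \<pi> h"
    and \<pi>_mult: "f \<in> carrier G \<Longrightarrow> h \<in> carrier G \<Longrightarrow> \<pi> (f \<otimes> h) = \<pi> f * \<pi> h"
    and \<pi>_\<iota>: "\<pi> (\<iota> a) = a"
    and nil: "f \<in> carrier G \<Longrightarrow> \<exists>n::nat. (\<iota> (\<pi> f) \<ominus> f) [^] n = \<zero>"
begin

lemma \<iota>_0: "\<iota> 0 = \<zero>"
  using \<iota>_add[of 0 0] \<iota>_closed[of 0] by simp

lemma \<pi>_1: "\<pi> \<one> = 1"
  using \<pi>_\<iota>[of 1] by (simp add: \<iota>_1)

lemma \<pi>_0: "\<pi> \<zero> = 0"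
  using \<pi>_\<iota>[of 0] by (simp add: \<iota>_0)

lemma \<iota>_pow: "\<iota> (a ^ n) = \<iota> a [^] n"
  by (induction n) (simp_all add: \<iota>_1 \<iota>_mult \<iota>_closed m_comm)

text \<open>The two elements differ by a nilpotent, which lies in every prime. So a prime of
  \<open>G\<close> is determined by its contraction to K[x].\<close>

lemma \<iota>_\<pi>_mem_iff:
  assumes "primeideal Q G" "f \<in> carrier G"
  shows "\<iota> (\<pi> f) \<in> Q \<longleftrightarrow> f \<in> Q"
proof -
  interpret Q: primeideal Q G by fact
  define d where "d = \<iota> (\<pi> f) \<ominus> f"
  have d: "d \<in> carrier G" "\<iota> (\<pi> f) = f \<oplus> d" "f = \<iota> (\<pi> f) \<oplus> (\<ominus> d)"
    using assms(2) \<iota>_closed[of "\<pi> f"] unfolding d_def by (simp, algebra, algebra)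
  obtain n :: nat where "d [^] n = \<zero>" using nil assms(2) d_def by blast
  hence dQ: "d \<in> Q" using Q.pow_mem[of d n] d(1) Q.zero_closed by simp
  show ?thesis
  proof
    assume "\<iota> (\<pi> f) \<in> Q"
    hence "\<iota> (\<pi> f) \<oplus> (\<ominus> d) \<in> Q" using dQ by (intro Q.a_closed Q.a_inv_closed)
    thus "f \<in> Q" using d(3) by simp
  next
    assume "f \<in> Q"
    thus "\<iota> (\<pi> f) \<in> Q" using dQ d(2) by simp
  qed
qed

text \<open>K[x] is a principal ideal domain: by division with remainder, an element of least degree
  in the contraction divides all others. It is not a unit because \<open>Q\<close> is
  proper.\<close>

lemma \<iota>_contract_generator:
  assumes "primeideal Q G" "a \<noteq> 0" "\<iota> a \<in> Q"
  obtains q where "q \<noteq> 0" "\<not> q dvd 1" "\<And>c. \<iota> c \<in> Q \<longleftrightarrow> q dvd c"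
proof -
  interpret Q: primeideal Q G by fact
  define q where "q = arg_min Polynomial.degree (\<lambda>a. a \<noteq> 0 \<and> \<iota> a \<in> Q)"
  have q: "q \<noteq> 0" "\<iota> q \<in> Q" and
    min: "\<And>a. a \<noteq> 0 \<Longrightarrow> \<iota> a \<in> Q \<Longrightarrow> Polynomial.degree q \<le> Polynomial.degree a"
    using arg_min_nat_lemma[of "\<lambda>a. a \<noteq> 0 \<and> \<iota> a \<in> Q" a Polynomial.degree] assms(2,3)
    unfolding q_def by blast+
  have mult: "\<iota> (q * c) \<in> Q" for c
    using q(2) \<iota>_closed Q.I_r_closed by (simp add: \<iota>_mult)
  have dvd: "\<iota> c \<in> Q \<longleftrightarrow> q dvd c" for c
  proof
    assume c: "\<iota> c \<in> Q"
    have "c mod q = c + q * - (c div q)" by (simp add: minus_mult_div_eq_mod)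
    hence "\<iota> (c mod q) = \<iota> c \<oplus> \<iota> (q * - (c div q))" by (simp only: \<iota>_add)
    also have "\<dots> \<in> Q" using c mult by blast
    finally have "\<iota> (c mod q) \<in> Q" .
    hence "c mod q = 0" using min[of "c mod q"] degree_mod_less'[OF q(1), of c] by (cases "c mod q = 0") auto
    thus "q dvd c" by (simp add: mod_eq_0_iff_dvd)
  next
    assume "q dvd c"
    thus "\<iota> c \<in> Q" using mult by (auto elim!: dvdE)
  qed
  moreover have "\<iota> 1 \<notin> Q" unfolding \<iota>_1 using Q.I_notcarr Q.one_imp_carrier by blast
  ultimately show ?thesis using that q(1) by blast
qed

text \<open>The kernel of \<open>\<pi>\<close> lies in every prime; it is the bottom of the chain
  showing that the height is at least one.\<close>

definition nil_prime :: "'a set" where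
  "nil_prime = {f \<in> carrier G. \<pi> f = 0}"

lemma primeideal_nil_prime: "primeideal nil_prime G"
proof (rule primeidealI)
  have neg: "\<pi> (\<ominus> f) = 0" if "f \<in> carrier G" "\<pi> f = 0" for f
    using \<pi>_add[of "\<ominus> f" f] that by (simp add: l_neg \<pi>_0)
  show "ideal nil_prime G"
  proof (rule idealI)
    show "subgroup nil_prime (add_monoid G)"
    proof (rule add.subgroupI)
      show "nil_prime \<noteq> {}" using \<pi>_0 by (auto simp: nil_prime_def)
    qed (auto simp: nil_prime_def \<pi>_add neg)
  qed (auto simp: nil_prime_def \<pi>_mult intro: ring_axioms)
  have "\<one> \<notin> nil_prime" by (simp add: nil_prime_def \<pi>_1)
  thus "carrier G \<noteq> nil_prime" using one_closed by blast
qed (auto simp: nil_prime_def \<pi>_mult is_cring)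

text \<open>If \<open>P\<close> met K[x] only in 0, then x would lie outside \<open>P\<close> and 1
  = p + u x for some p in \<open>P\<close>. Applying \<open>\<pi>\<close> shows that
  \<open>\<pi> p\<close> has constant coefficient 1, so it is a nonzero polynomial in the
  contraction.\<close>

lemma maximal_contract_nonzero:
  assumes "maximalideal P G"
  shows "\<exists>a. a \<noteq> 0 \<and> \<iota> a \<in> P"
proof (rule ccontr)
  assume no: "\<nexists>a. a \<noteq> 0 \<and> \<iota> a \<in> P"
  interpret P: maximalideal P G by fact
  define x where "x = \<iota> [:0, 1:]"
  have "[:0, 1 :: 'k:] \<noteq> 0" by simp
  hence x: "x \<in> carrier G" "x \<notin> P" using no \<iota>_closed unfolding x_def by blast+
  have idl: "ideal (P <+> PIdl x) G"
    by (rule add_ideals[OF P.is_ideal cgenideal_ideal[OF x(1)]])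
  have mem: "y \<oplus> z \<in> P <+> PIdl x" if "y \<in> P" "z \<in> PIdl x" for y z
    using that by (auto simp: set_add_def')
  have "P \<subseteq> P <+> PIdl x"
  proof
    fix y assume y: "y \<in> P"
    have "\<zero> \<in> PIdl x"
      using cgenideal_ideal[OF x(1)] by (simp add: additive_subgroup.zero_closed ideal.axioms(1))
    from mem[OF y this] show "y \<in> P <+> PIdl x" using y by simp
  qed
  moreover have "x \<in> P <+> PIdl x"
    using mem[OF P.zero_closed cgenideal_self[OF x(1)]] x(1) by simp
  moreover have "P <+> PIdl x \<subseteq> carrier G" using ideal.Icarr[OF idl] by blast
  ultimately have "P <+> PIdl x = carrier G" using P.I_maximal[OF idl] x(2) by blast
  hence "\<one> \<in> P <+> PIdl x" by simp
  then obtain p u where pu: "p \<in> P" "u \<in> carrier G" "\<one> = p \<oplus> u \<otimes> x"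
    by (auto simp: set_add_def' cgenideal_def)
  have "1 = \<pi> p + \<pi> u * [:0, 1:]"
    using arg_cong[OF pu(3), of \<pi>] pu(1,2) x(1) by (simp add: \<pi>_1 \<pi>_add \<pi>_mult x_def \<pi>_\<iota>)
  hence "Polynomial.coeff (\<pi> p) 0 = 1" by (auto simp: poly_eq_iff dest!: spec[of _ 0])
  hence "\<pi> p \<noteq> 0" by auto
  moreover have "\<iota> (\<pi> p) \<in> P"
    using \<iota>_\<pi>_mem_iff[OF maximalideal_prime[OF assms] P.Icarr[OF pu(1)]] pu(1) by simp
  ultimately show False using no by blast
qed

text \<open>In a chain Q \<subset> Q' \<subset> P the contractions of Q' and P are generated by
  nonzero q' and q with q' = q h. Primality of Q' leaves two cases: q' divides q, which puts P
  inside Q', or q' divides h, which makes q a unit.\<close>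

lemma prime_height_maximal:
  assumes P: "maximalideal P G"
  shows "prime_height G P = 1"
proof -
  have Pp: "primeideal P G" by (rule maximalideal_prime[OF P])
  interpret P: primeideal P G by (rule Pp)
  let ?chain = "\<lambda>n C. (\<forall>i\<le>n. primeideal (C i) G) \<and> (\<forall>i<n. C i \<subset> C (Suc i)) \<and> C n = P"
  obtain a where a: "a \<noteq> 0" "\<iota> a \<in> P" using maximal_contract_nonzero[OF P] by blast
  obtain q where q: "q \<noteq> 0" "\<not> q dvd 1" "\<And>c. \<iota> c \<in> P \<longleftrightarrow> q dvd c"
    using \<iota>_contract_generator[OF Pp a] by blast
  have no: False if Q: "primeideal Q G" "primeideal Q' G" "Q \<subset> Q'" "Q' \<subset> P" for Q Q'
  proof -
    interpret Q': primeideal Q' G by (rule Q(2))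
    obtain f where f: "f \<in> Q'" "f \<notin> Q" using Q(3) by blast
    have fG: "f \<in> carrier G" using f Q'.Icarr by blast
    have "\<iota> (\<pi> f) \<in> Q'" "\<iota> (\<pi> f) \<notin> Q"
      using \<iota>_\<pi>_mem_iff[OF Q(1) fG] \<iota>_\<pi>_mem_iff[OF Q(2) fG] f by auto
    moreover have "\<zero> \<in> Q" using Q(1)
      by (simp add: additive_subgroup.zero_closed ideal.axioms(1) primeideal.axioms(1))
    ultimately have "\<pi> f \<noteq> 0" using \<iota>_0 by auto
    then obtain q' where q': "q' \<noteq> 0" "\<not> q' dvd 1" "\<And>c. \<iota> c \<in> Q' \<longleftrightarrow> q' dvd c"
      using \<iota>_contract_generator[OF Q(2) _ \<open>\<iota> (\<pi> f) \<in> Q'\<close>] by blast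
    have "\<iota> q' \<in> P" using q'(3)[of q'] Q(4) by auto
    then obtain h where h: "q' = q * h" using q(3) by (auto elim: dvdE)
    hence "\<iota> q \<otimes> \<iota> h \<in> Q'" using q'(3)[of q'] by (simp add: \<iota>_mult)
    hence "q' dvd q \<or> q' dvd h" using Q'.I_prime[OF \<iota>_closed \<iota>_closed] q'(3) by blast
    thus False
    proof
      assume *: "q' dvd q"
      have "P \<subseteq> Q'"
      proof
        fix y assume "y \<in> P"
        hence y: "y \<in> carrier G" "q dvd \<pi> y"
          using P.Icarr \<iota>_\<pi>_mem_iff[OF Pp] q(3) by blast+
        hence "q' dvd \<pi> y" using * dvd_trans by blast
        thus "y \<in> Q'" using q'(3) \<iota>_\<pi>_mem_iff[OF Q(2) y(1)] by blast
      qed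
      thus False using Q(4) by blast
    next
      assume "q' dvd h"
      then obtain k where "h = q * h * k" unfolding h by (rule dvdE)
      hence "h * (q * k) = h * 1" by (simp add: ac_simps)
      moreover have "h \<noteq> 0" using h q'(1) by auto
      ultimately have "q * k = 1" by (simp only: mult_cancel_left) simp
      thus False using q(2) by (metis dvd_triv_left)
    qed
  qed
  have "Sup {enat n |n. \<exists>C :: nat \<Rightarrow> 'a set. ?chain n C} = enat 1"
  proof (rule Sup_enat_eqI)
    have "nil_prime \<subseteq> P"
    proof
      fix f assume "f \<in> nil_prime"
      hence "f \<in> carrier G" "\<iota> (\<pi> f) \<in> P" using \<iota>_0 P.zero_closed by (auto simp: nil_prime_def)
      thus "f \<in> P" using \<iota>_\<pi>_mem_iff[OF Pp] by blast
    qed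
    moreover have "\<iota> a \<notin> nil_prime" using a by (simp add: nil_prime_def \<pi>_\<iota>)
    ultimately have "nil_prime \<subset> P" using a by blast
    hence ex1: "?chain 1 (\<lambda>i. if i = 0 then nil_prime else P)"
      using Pp primeideal_nil_prime by simp
    show "\<exists>C :: nat \<Rightarrow> 'a set. ?chain 1 C"
      by (rule exI[of "?chain 1" "\<lambda>i. if i = 0 then nil_prime else P"]) (rule ex1)
    show "m \<le> 1" if "\<exists>C :: nat \<Rightarrow> 'a set. ?chain m C" for m
    proof (rule ccontr)
      assume "\<not> m \<le> 1"
      then obtain k where k: "m = Suc (Suc k)" by (cases m; cases "m - 1") auto
      from \<open>\<exists>C :: nat \<Rightarrow> 'a set. ?chain m C\<close> obtain C :: "nat \<Rightarrow> 'a set" where C: "?chain m C" by (elim exE)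
      have "C k \<subset> C (Suc k)" "C (Suc k) \<subset> P" "primeideal (C k) G" "primeideal (C (Suc k)) G"
        using C[THEN conjunct1, rule_format, of k] C[THEN conjunct1, rule_format, of "Suc k"]
          C[THEN conjunct2, THEN conjunct1, rule_format, of k]
          C[THEN conjunct2, THEN conjunct1, rule_format, of "Suc k"]
          C[THEN conjunct2, THEN conjunct2] unfolding k by simp_all
      thus False using no by blast
    qed
  qed
  thus ?thesis unfolding prime_height_def one_enat_def .
qed

lemma genideal_empty: "Idl {} = {\<zero>}"
proof
  show "Idl {} \<subseteq> {\<zero>}" by (rule genideal_minimal[OF zeroideal]) simp
  show "{\<zero>} \<subseteq> Idl {}"
    using genideal_ideal[of "{}"] by (simp add: additive_subgroup.zero_closed ideal.axioms(1))
qed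

text \<open>The first member of a regular sequence in \<open>P\<close> would kill \<open>w\<close>,
  so the depth is 0 while the height is 1.\<close>

lemma not_cohen_macaulay_if_socle:
  assumes "maximalideal P G" "w \<in> carrier G" "w \<noteq> \<zero>" "\<And>y. y \<in> P \<Longrightarrow> y \<otimes> w = \<zero>"
  shows "\<not> cohen_macaulay G"
proof
  assume "cohen_macaulay G"
  hence "ideal_depth G P = 1"
    using assms(1) prime_height_maximal by (simp add: cohen_macaulay_def)
  moreover have "ideal_depth G P \<le> 0"
    unfolding ideal_depth_def
  proof (rule Sup_least, safe)
    fix xs assume xs: "set xs \<subseteq> P" "regular_sequence G xs"
    have "xs = []"
    proof (rule ccontr)
      assume "xs \<noteq> []"
      hence "xs ! 0 \<otimes> w = \<zero>" using xs(1) assms(4) nth_mem[of 0 xs] by blast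
      hence "w \<in> Idl {}"
        using xs(2) \<open>xs \<noteq> []\<close> assms(2) unfolding regular_sequence_def
        by (auto simp: genideal_empty dest!: spec[of _ 0])
      thus False using assms(3) by (simp add: genideal_empty)
    qed
    thus "enat (length xs) \<le> 0" by (simp add: zero_enat_def)
  qed
  ultimately show False by simp
qed

end

locale torsion_free_poly_retract = poly_retract +
  assumes torsion_free: "a \<noteq> 0 \<Longrightarrow> f \<in> carrier G \<Longrightarrow> \<iota> a \<otimes> f = \<zero> \<Longrightarrow> f = \<zero>"
begin

text \<open>Since \<open>\<iota> (\<pi> y)\<close> is \<open>y\<close> plus a nilpotent, some power
  of it is a multiple of \<open>y\<close>. That power is nonzero, because \<open>\<pi> y = 0\<close>
  would make the regular element \<open>y\<close> nilpotent.\<close>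

lemma regular_element_multiple:
  assumes y: "y \<in> carrier G" and reg: "\<And>v. v \<in> carrier G \<Longrightarrow> y \<otimes> v = \<zero> \<Longrightarrow> v = \<zero>"
    and one: "\<one> \<noteq> \<zero>"
  shows "\<exists>b w. b \<noteq> 0 \<and> w \<in> carrier G \<and> \<iota> b = y \<otimes> w"
proof -
  define d where "d = \<iota> (\<pi> y) \<ominus> y"
  have d: "d \<in> carrier G" "\<iota> (\<pi> y) = y \<oplus> d"
    using y \<iota>_closed[of "\<pi> y"] unfolding d_def by (simp, algebra)
  obtain n :: nat where n: "d [^] n = \<zero>" using nil y d_def by blast
  obtain w where w: "w \<in> carrier G" "(y \<oplus> d) [^] n = y \<otimes> w \<oplus> d [^] n"
    using add_pow_congruence[OF y d(1)] by blast
  have eq: "\<iota> (\<pi> y ^ n) = y \<otimes> w" using w n y d(2) by (simp add: \<iota>_pow)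
  have "\<pi> y \<noteq> 0"
  proof
    assume "\<pi> y = 0"
    hence "d = \<ominus> y" using y by (simp add: d_def \<iota>_0 minus_eq)
    have "v = \<zero>" if "v \<in> carrier G" "d [^] k \<otimes> v = \<zero>" for v and k :: nat
      using that
    proof (induction k arbitrary: v)
      case (Suc k)
      hence "d [^] k \<otimes> (d \<otimes> v) = \<zero>" using d(1) by (simp add: m_assoc)
      hence "d \<otimes> v = \<zero>" using Suc d(1) by simp
      hence "y \<otimes> v = \<zero>" using \<open>d = \<ominus> y\<close> y Suc.prems(1) by (simp add: l_minus)
      thus ?case using reg Suc.prems(1) by blast
    qed simp
    from this[of \<one> n] n one show False by simp
  qed
  hence "\<pi> y ^ n \<noteq> 0" by simp
  thus ?thesis using eq w(1) by blast
qed

text \<open>By torsion-freeness \<open>q\<close> alone is a regular sequence. For a regular sequence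
  starting with y, z, the ideal of y contains a nonzero polynomial b; cancelling powers of z forces
  the factor of b that is not divisible by \<open>q\<close> into \<open>P\<close>, a
  contradiction.\<close>

lemma ideal_depth_maximal:
  assumes P: "maximalideal P G"
  shows "ideal_depth G P = 1"
proof -
  have Pp: "primeideal P G" by (rule maximalideal_prime[OF P])
  interpret P: primeideal P G by (rule Pp)
  obtain a where a: "a \<noteq> 0" "\<iota> a \<in> P" using maximal_contract_nonzero[OF P] by blast
  obtain q where q: "q \<noteq> 0" "\<not> q dvd 1" "\<And>c. \<iota> c \<in> P \<longleftrightarrow> q dvd c"
    using \<iota>_contract_generator[OF Pp a] by blast
  have one_P: "\<one> \<notin> P" using P.I_notcarr P.one_imp_carrier by blast
  hence one: "\<one> \<noteq> \<zero>" using P.zero_closed by auto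
  have le: "length xs \<le> 1" if xs: "set xs \<subseteq> P" "regular_sequence G xs" for xs
  proof (rule ccontr)
    assume "\<not> length xs \<le> 1"
    then obtain y z zs where yz: "xs = y # z # zs" by (cases xs; cases "tl xs") auto
    hence P': "y \<in> P" "z \<in> P" using xs(1) by auto
    hence car: "y \<in> carrier G" "z \<in> carrier G" using P.Icarr by blast+
    let ?I = "Idl {y}"
    interpret I: ideal ?I G using car by (intro genideal_ideal) simp
    have yI: "y \<in> ?I" using car genideal_self[of "{y}"] by simp
    have IP: "?I \<subseteq> P" by (rule genideal_minimal[OF P.is_ideal]) (use P' in simp)
    have reg: "\<forall>i<length xs. \<forall>u\<in>carrier G. xs ! i \<otimes> u \<in> Idl (set (take i xs)) \<longrightarrow> u \<in> Idl (set (take i xs))"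
      using xs(2) unfolding regular_sequence_def by blast
    have regy: "u = \<zero>" if "u \<in> carrier G" "y \<otimes> u = \<zero>" for u
      using reg[rule_format, of 0 u] that yz by (simp add: genideal_empty)
    have regz: "u \<in> ?I" if "u \<in> carrier G" "z \<otimes> u \<in> ?I" for u
      using reg[rule_format, of 1 u] that yz by simp
    have regz_pow: "u \<in> ?I" if "u \<in> carrier G" "z [^] n \<otimes> u \<in> ?I" for u and n :: nat
      using that
    proof (induction n arbitrary: u)
      case (Suc n)
      have "z [^] Suc n \<otimes> u = z [^] n \<otimes> (z \<otimes> u)"
        using Suc.prems(1) car by (simp add: m_assoc)
      hence "z [^] n \<otimes> (z \<otimes> u) \<in> ?I" using Suc.prems(2) by (simp only:)
      hence "z \<otimes> u \<in> ?I" by (rule Suc.IH[rotated]) (intro m_closed car Suc.prems(1))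
      thus ?case by (rule regz[rotated]) (rule Suc.prems(1))
    qed simp
    obtain b w where b: "b \<noteq> 0" "w \<in> carrier G" "\<iota> b = y \<otimes> w"
      using regular_element_multiple[OF car(1) regy one] by blast
    have bI: "\<iota> b \<in> ?I" using b yI I.I_r_closed by simp
    obtain e b' where b': "b = q ^ e * b'" "\<not> q dvd b'"
      using poly_split_power[OF q(1,2) b(1)] by blast
    have "\<iota> (\<pi> z) \<in> P" using \<iota>_\<pi>_mem_iff[OF Pp car(2)] P'(2) by simp
    then obtain c' where c': "\<pi> z = q * c'" using q(3) by (auto elim: dvdE)
    \<comment> \<open>The factor \<open>q ^ e\<close> missing from \<open>b'\<close> is supplied by
      \<open>\<pi> z ^ e\<close>, since \<open>q\<close> divides \<open>\<pi> z\<close>.\<close>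
    have "b' * \<pi> z ^ e = b * c' ^ e" by (simp add: b'(1) c' power_mult_distrib ac_simps)
    hence b'z: "\<iota> b' \<otimes> \<iota> (\<pi> z) [^] e \<in> ?I"
      using I.I_r_closed[OF bI, of "\<iota> (c' ^ e)"] \<iota>_closed by (simp flip: \<iota>_mult \<iota>_pow)
    define d where "d = \<iota> (\<pi> z) \<ominus> z"
    have d: "d \<in> carrier G" "z = \<ominus> d \<oplus> \<iota> (\<pi> z)"
      using car \<iota>_closed[of "\<pi> z"] unfolding d_def by (simp, algebra)
    obtain n :: nat where n: "d [^] n = \<zero>" using nil car d_def by blast
    obtain v where v: "v \<in> carrier G" "(\<ominus> d \<oplus> \<iota> (\<pi> z)) [^] e = \<ominus> d \<otimes> v \<oplus> \<iota> (\<pi> z) [^] e"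
      using add_pow_congruence[of "\<ominus> d" "\<iota> (\<pi> z)" e] d \<iota>_closed by blast
    define j where "j = \<iota> b' \<otimes> \<iota> (\<pi> z) [^] e"
    define k where "k = \<iota> b' \<otimes> \<ominus> v"
    have jk: "j \<in> carrier G" "k \<in> carrier G" using \<iota>_closed v by (simp_all add: j_def k_def)
    have "\<iota> b' \<otimes> z [^] e = \<iota> b' \<otimes> (\<ominus> d \<otimes> v \<oplus> \<iota> (\<pi> z) [^] e)" using v(2) d(2) by simp
    also have "\<dots> = j \<oplus> d \<otimes> k"
      using \<iota>_closed[of b'] nat_pow_closed[OF \<iota>_closed[of "\<pi> z"], of e] v(1) d(1)
      unfolding j_def k_def by algebra
    finally have bz: "\<iota> b' \<otimes> z [^] e = j \<oplus> d \<otimes> k" .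
    \<comment> \<open>Replacing \<open>\<pi> z\<close> by \<open>z\<close> costs a multiple of the
      nilpotent \<open>d\<close>; the n-th power removes it modulo the ideal of
      \<open>y\<close>.\<close>
    obtain u where u: "u \<in> carrier G" "(j \<oplus> d \<otimes> k) [^] n = j \<otimes> u \<oplus> (d \<otimes> k) [^] n"
      using add_pow_congruence[of j "d \<otimes> k" n] jk d by blast
    have "(d \<otimes> k) [^] n = \<zero>" using d jk n by (simp add: nat_pow_distrib)
    hence "(\<iota> b' \<otimes> z [^] e) [^] n = j \<otimes> u" using u jk bz by simp
    moreover have "j \<otimes> u \<in> ?I" using b'z u I.I_r_closed unfolding j_def by blast
    ultimately have "(\<iota> b' \<otimes> z [^] e) [^] n \<in> ?I" by simp
    hence "\<iota> b' [^] n \<otimes> z [^] (e * n) \<in> ?I"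
      using car \<iota>_closed by (simp add: nat_pow_distrib nat_pow_pow)
    hence "z [^] (e * n) \<otimes> \<iota> b' [^] n \<in> ?I" using car \<iota>_closed by (simp add: m_comm)
    hence "\<iota> b' [^] n \<in> P" using regz_pow[of "\<iota> b' [^] n" "e * n"] \<iota>_closed IP by auto
    hence "\<iota> b' \<in> P" using P.pow_mem \<iota>_closed by blast
    thus False using b'(2) q(3) by blast
  qed
  have "\<iota> q \<in> P" using q(3) by simp
  hence "Idl {\<iota> q} \<subseteq> P" by (intro genideal_minimal P.is_ideal) simp
  hence "Idl {\<iota> q} \<noteq> carrier G" using one_P one_closed by blast
  moreover have "y = \<zero>" if "y \<in> carrier G" "\<iota> q \<otimes> y = \<zero>" for y
    using torsion_free[OF q(1) that] .
  ultimately have "regular_sequence G [\<iota> q]"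
    unfolding regular_sequence_def using \<iota>_closed[of q] by (simp add: genideal_empty)
  hence "\<exists>xs. 1 = length xs \<and> set xs \<subseteq> P \<and> regular_sequence G xs"
    using \<open>\<iota> q \<in> P\<close> by (intro exI[of _ "[\<iota> q]"]) simp
  hence "Sup {enat n |n. \<exists>xs. n = length xs \<and> set xs \<subseteq> P \<and> regular_sequence G xs} = enat 1"
    by (rule Sup_enat_eqI) (use le in blast)
  moreover have "{enat (length xs) |xs. set xs \<subseteq> P \<and> regular_sequence G xs} =
      {enat n |n. \<exists>xs. n = length xs \<and> set xs \<subseteq> P \<and> regular_sequence G xs}" by blast
  ultimately show ?thesis unfolding ideal_depth_def one_enat_def by simp
qed

lemma cohen_macaulay_if_noetherian: "noetherian_ring G \<Longrightarrow> cohen_macaulay G"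
  by (simp add: cohen_macaulay_def is_cring ideal_depth_maximal prime_height_maximal)

end

section \<open>Cohen-Macaulayness of the associated graded ring\<close>

text \<open>The gap \<open>s - ord s * g\<close> acts as a second degree whose part of degree 0 is
  spanned by the multiples of \<open>g\<close>; projecting to that part gives the map onto
  K[x].\<close>

locale sloped_graded_algebra = graded_monomial_algebra_with_reduction S ord G \<Phi> g r
  for S ord and G :: "('g, 'b) ring_scheme" (structure) and \<Phi> :: "'k::field poly \<Rightarrow> 'g" and g r +
  assumes slope: "s \<in> S \<Longrightarrow> ord s * g \<le> s"
    and bounded_gap: "\<exists>B. \<forall>s\<in>S. s \<le> ord s * g + B"
begin

definition inflate :: "'k poly \<Rightarrow> 'k poly" where
  "inflate a = pcompose a (Polynomial.monom 1 g)"

definition deflate :: "'k poly \<Rightarrow> 'k poly" where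
  "deflate p = Abs_poly (\<lambda>i. Polynomial.coeff p (i * g))"

lemma coeff_deflate: "Polynomial.coeff (deflate p) i = Polynomial.coeff p (i * g)"
proof -
  have "Polynomial.coeff p (i * g) = 0" if "i > Polynomial.degree p" for i
  proof (rule coeff_eq_0)
    have "i * 1 \<le> i * g" using g_pos by (intro mult_le_mono2) simp
    with that show "Polynomial.degree p < i * g" by linarith
  qed
  thus ?thesis unfolding deflate_def by (subst coeff_Abs_poly) auto
qed

lemma coeff_inflate:
  "Polynomial.coeff (inflate a) n = (if g dvd n then Polynomial.coeff a (n div g) else 0)"
proof (induction a arbitrary: n rule: pCons_induct)
  case 0
  thus ?case by (simp add: inflate_def)
next
  case (pCons c a)
  have "inflate (pCons c a) = [:c:] + Polynomial.monom 1 g * inflate a"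
    by (simp add: inflate_def pcompose_pCons)
  hence "Polynomial.coeff (inflate (pCons c a)) n =
      Polynomial.coeff [:c:] n + (if g \<le> n then Polynomial.coeff (inflate a) (n - g) else 0)"
    by (simp add: coeff_monom_mult)
  also have "\<dots> = (if g dvd n then Polynomial.coeff (pCons c a) (n div g) else 0)"
  proof (cases "g \<le> n")
    case True
    then obtain m where m: "n = g + m" by (auto simp: le_iff_add)
    thus ?thesis using g_pos pCons.IH[of m]
      by (simp add: coeff_pCons split: nat.split)
  next
    case False
    thus ?thesis using g_pos by (auto simp: coeff_pCons dvd_imp_le split: nat.split)
  qed
  finally show ?case .
qed

lemma inflate_supported: "inflate a \<in> supported (range (\<lambda>k. k * g))"
  by (rule supportedI) (auto simp: coeff_inflate elim!: dvdE split: if_splits)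

lemma range_mult_g_subset: "range (\<lambda>k. k * g) \<subseteq> S"
  using mult_g_mem by auto

lemma inflate_supported_S: "inflate a \<in> supported S"
  using inflate_supported supported_mono[OF range_mult_g_subset] by blast

lemma deflate_inflate: "deflate (inflate a) = a"
  using g_pos by (intro poly_eqI) (simp add: coeff_deflate coeff_inflate)

lemma star_eq_mult:
  assumes "\<And>i j. Polynomial.coeff p i \<noteq> 0 \<Longrightarrow> Polynomial.coeff q j \<noteq> 0 \<Longrightarrow> strict i j"
  shows "star p q = p * q"
proof (rule poly_eqI)
  fix n
  show "Polynomial.coeff (star p q) n = Polynomial.coeff (p * q) n"
    unfolding coeff_star coeff_mult
  proof (rule sum.cong)
    fix i assume "i \<in> {..n}"
    show "(if strict i (n - i) then Polynomial.coeff p i * Polynomial.coeff q (n - i) else 0) =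
        Polynomial.coeff p i * Polynomial.coeff q (n - i)"
      using assms[of i "n - i"] by auto
  qed auto
qed

lemma strict_mult_g: "strict (i * g) (j * g)"
  using ord_mult_g[of i] ord_mult_g[of j] ord_mult_g[of "i + j"]
  by (simp add: strict_def add_mult_distrib)

lemma inflate_mult: "inflate (a * b) = star (inflate a) (inflate b)"
proof -
  have "star (inflate a) (inflate b) = inflate a * inflate b"
  proof (rule star_eq_mult)
    fix i j assume "Polynomial.coeff (inflate a) i \<noteq> 0" "Polynomial.coeff (inflate b) j \<noteq> 0"
    hence "i \<in> range (\<lambda>k. k * g)" "j \<in> range (\<lambda>k. k * g)"
      using supportedD[OF inflate_supported] by blast+
    thus "strict i j" using strict_mult_g by auto
  qed
  thus ?thesis by (simp add: inflate_def pcompose_mult)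
qed

text \<open>Gaps are nonnegative and add up on strict pairs, so a sum with gap 0 has summands with
  gap 0. This is why \<open>deflate\<close> respects products.\<close>

lemma multiples_of_strict:
  assumes "i \<in> S" "j \<in> S" "strict i j" "i + j = m * g"
  shows "i = ord i * g" "j = ord j * g"
proof -
  have "m = ord i + ord j" using assms(3,4) ord_mult_g[of m] by (simp add: strict_def)
  hence "i + j = ord i * g + ord j * g" using assms(4) by (simp add: add_mult_distrib)
  thus "i = ord i * g" "j = ord j * g" using slope[OF assms(1)] slope[OF assms(2)] by linarith+
qed

lemma deflate_star:
  assumes p: "p \<in> supported S" and q: "q \<in> supported S"
  shows "deflate (star p q) = deflate p * deflate q"
proof (rule poly_eqI)
  fix m
  let ?f = "\<lambda>i. if strict i (m * g - i) then Polynomial.coeff p i * Polynomial.coeff q (m * g - i) else 0"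
  have "Polynomial.coeff (deflate (star p q)) m = (\<Sum>i=0..m * g. ?f i)"
    by (simp add: coeff_deflate coeff_star)
  also have "\<dots> = (\<Sum>i\<in>(\<lambda>j. j * g) ` {..m}. ?f i)"
  proof (rule sum.mono_neutral_right)
    show "\<forall>i\<in>{0..m * g} - (\<lambda>j. j * g) ` {..m}. ?f i = 0"
    proof
      fix i assume i: "i \<in> {0..m * g} - (\<lambda>j. j * g) ` {..m}"
      show "?f i = 0"
      proof (rule ccontr)
        assume "?f i \<noteq> 0"
        hence st: "strict i (m * g - i)" "Polynomial.coeff p i \<noteq> 0" "Polynomial.coeff q (m * g - i) \<noteq> 0"
          by (auto split: if_splits)
        have "i = ord i * g"
          by (rule multiples_of_strict(1)[OF supportedD[OF p st(2)] supportedD[OF q st(3)] st(1)]) (use i in auto)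
        moreover have "ord i \<le> m"
        proof -
          have "ord i * g \<le> m * g" using i \<open>i = ord i * g\<close> by auto
          thus ?thesis using g_pos by simp
        qed
        ultimately show False using i by blast
      qed
    qed
  qed auto
  also have "\<dots> = (\<Sum>j\<le>m. ?f (j * g))"
    using g_pos by (subst sum.reindex) (auto simp: inj_on_def)
  also have "\<dots> = (\<Sum>j\<le>m. Polynomial.coeff (deflate p) j * Polynomial.coeff (deflate q) (m - j))"
  proof (rule sum.cong[OF refl])
    fix j assume "j \<in> {..m}"
    hence "m * g - j * g = (m - j) * g" by (simp add: diff_mult_distrib)
    thus "?f (j * g) = Polynomial.coeff (deflate p) j * Polynomial.coeff (deflate q) (m - j)"
      using strict_mult_g by (simp add: coeff_deflate)
  qed
  also have "\<dots> = Polynomial.coeff (deflate p * deflate q) m" by (simp add: coeff_mult)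
  finally show "Polynomial.coeff (deflate (star p q)) m = Polynomial.coeff (deflate p * deflate q) m" .
qed

lemma deflate_add: "deflate (p + q) = deflate p + deflate q"
  by (rule poly_eqI) (simp add: coeff_deflate)

definition poly_of :: "'g \<Rightarrow> 'k poly" where
  "poly_of x = (THE p. p \<in> supported S \<and> \<Phi> p = x)"

lemma poly_of_\<Phi>: "p \<in> supported S \<Longrightarrow> poly_of (\<Phi> p) = p"
  unfolding poly_of_def using \<Phi>_inject by (intro the_equality) auto

text \<open>The gap $s - g \cdot \mathrm{ord}(s)$ is additive on strict sums and bounded, so an element
  all of whose exponents have positive gap is nilpotent.\<close>

lemma nilpotent_if_positive_gap:
  assumes p: "p \<in> supported {s \<in> S. ord s * g < s}"
  shows "\<exists>n::nat. \<Phi> p [^] n = \<zero>"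
proof -
  obtain B where B: "\<And>s. s \<in> S \<Longrightarrow> s \<le> ord s * g + B" using bounded_gap by blast
  have pS: "p \<in> supported S" using p supported_mono[of "{s \<in> S. ord s * g < s}" S] by blast
  have pow: "\<exists>q\<in>supported {s \<in> S. ord s * g + n \<le> s}. \<Phi> p [^] n = \<Phi> q" for n :: nat
  proof (induction n)
    case 0
    have "1 \<in> supported {s \<in> S. ord s * g + 0 \<le> s}"
      using zero_mem ord_zero by (auto simp: supported_def)
    thus ?case by (intro bexI[of _ 1]) (simp_all add: \<Phi>_1)
  next
    case (Suc n)
    then obtain q where q: "q \<in> supported {s \<in> S. ord s * g + n \<le> s}" "\<Phi> p [^] n = \<Phi> q" by blast
    have qS: "q \<in> supported S" using q(1) supported_mono[of "{s \<in> S. ord s * g + n \<le> s}" S] by blast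
    have "star q p \<in> supported {s \<in> S. ord s * g + Suc n \<le> s}"
      by (rule star_in_supported[OF q(1) p]) (auto simp: add_mem strict_def add_mult_distrib)
    moreover have "\<Phi> p [^] Suc n = \<Phi> (star q p)" using q(2) pS qS by (simp add: \<Phi>_star)
    ultimately show ?case by blast
  qed
  \<comment> \<open>Each factor raises the gap by at least one, so \<open>Suc B\<close> factors
    exceed the bound \<open>B\<close>.\<close>
  obtain q where q: "q \<in> supported {s \<in> S. ord s * g + Suc B \<le> s}" "\<Phi> p [^] Suc B = \<Phi> q"
    using pow[of "Suc B"] by blast
  have "{s \<in> S. ord s * g + Suc B \<le> s} = {}" using B by fastforce
  hence "q = 0" using q(1) supported_empty by (metis singletonD)
  thus ?thesis using q(2) \<Phi>_0 by metis
qed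

sublocale poly_retract G "\<lambda>a. \<Phi> (inflate a)" "\<lambda>x. deflate (poly_of x)"
proof
  fix f h a b
  show "\<Phi> (inflate a) \<in> carrier G" by (rule \<Phi>_closed[OF inflate_supported_S])
  show "\<Phi> (inflate (a + b)) = \<Phi> (inflate a) \<oplus> \<Phi> (inflate b)"
    using inflate_supported_S by (simp add: inflate_def pcompose_add flip: \<Phi>_add)
  show "\<Phi> (inflate (a * b)) = \<Phi> (inflate a) \<otimes> \<Phi> (inflate b)"
    using inflate_supported_S by (simp add: inflate_mult \<Phi>_star)
  show "\<Phi> (inflate 1) = \<one>" by (simp add: inflate_def pcompose_1 \<Phi>_1)
  show "deflate (poly_of (\<Phi> (inflate a))) = a"
    by (simp add: poly_of_\<Phi> inflate_supported_S deflate_inflate)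
  assume f: "f \<in> carrier G"
  then obtain p where p: "p \<in> supported S" "f = \<Phi> p" by (auto simp: carrier_eq)
  show "\<exists>n::nat. (\<Phi> (inflate (deflate (poly_of f))) \<ominus> f) [^] n = \<zero>"
  proof -
    have eq: "\<Phi> (inflate (deflate (poly_of f))) \<ominus> f = \<Phi> (inflate (deflate p) - p)"
      using p inflate_supported_S[of "deflate p"] \<Phi>_add[of "inflate (deflate p)" "- p"]
      by (simp add: minus_eq poly_of_\<Phi> \<Phi>_uminus)
    \<comment> \<open>The two polynomials agree at the multiples of \<open>g\<close>; every other
      exponent differs from \<open>ord n * g\<close> and so has positive gap.\<close>
    have "inflate (deflate p) - p \<in> supported {s \<in> S. ord s * g < s}"
    proof (rule supportedI)
      fix n assume n: "Polynomial.coeff (inflate (deflate p) - p) n \<noteq> 0"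
      have "\<not> g dvd n" using n by (auto simp: coeff_inflate coeff_deflate)
      hence "Polynomial.coeff p n \<noteq> 0" using n by (simp add: coeff_inflate)
      hence "n \<in> S" using supportedD[OF p(1)] by blast
      moreover have "ord n * g \<noteq> n" using \<open>\<not> g dvd n\<close> by (metis dvd_triv_right)
      ultimately show "n \<in> {s \<in> S. ord s * g < s}" using slope[of n] by simp
    qed
    from nilpotent_if_positive_gap[OF this] show ?thesis unfolding eq .
  qed
  assume h: "h \<in> carrier G"
  then obtain q where q: "q \<in> supported S" "h = \<Phi> q" by (auto simp: carrier_eq)
  show "deflate (poly_of (f \<oplus> h)) = deflate (poly_of f) + deflate (poly_of h)"
    using p q by (simp add: poly_of_\<Phi> supported_add deflate_add flip: \<Phi>_add)
  show "deflate (poly_of (f \<otimes> h)) = deflate (poly_of f) * deflate (poly_of h)"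
    using p q by (simp add: poly_of_\<Phi> star_supported deflate_star flip: \<Phi>_star)
qed

text \<open>Modulo \<open>max_ideal\<close> every element is a constant, so a larger ideal contains
  a nonzero constant, which is invertible.\<close>

lemma maximalideal_max_ideal: "maximalideal max_ideal G"
proof (rule maximalidealI[OF ideal_max_ideal])
  have "\<Phi> 1 \<notin> max_ideal"
    unfolding max_ideal_def
    using \<Phi>_mem_iff[OF Diff_subset one_supported, of "{0}"] supportedD[of 1 "S - {0}" 0] by auto
  thus "carrier G \<noteq> max_ideal" using \<Phi>_closed[OF one_supported] by blast
  fix J assume J: "ideal J G" "max_ideal \<subseteq> J" "J \<subseteq> carrier G"
  interpret J: ideal J G by (rule J(1))
  show "J = max_ideal \<or> J = carrier G"
  proof (cases "J = max_ideal")
    case False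
    then obtain p where p: "p \<in> supported S" "\<Phi> p \<in> J" "\<Phi> p \<notin> max_ideal"
      using J(2,3) unfolding carrier_eq by blast
    define c where "c = Polynomial.coeff p 0"
    have "p - Polynomial.monom c 0 \<in> supported (S - {0})"
      using p(1) by (auto simp: supported_def c_def)
    hence m: "p - Polynomial.monom c 0 \<in> supported (S - {0})" "\<Phi> (p - Polynomial.monom c 0) \<in> J"
      using J(2) by (auto simp: max_ideal_def)
    have mS: "p - Polynomial.monom c 0 \<in> supported S"
      using m(1) supported_mono[of "S - {0}" S] by blast
    have "c \<noteq> 0" using p(3) m(1) by (auto simp: max_ideal_def)
    have "\<Phi> (p + - (p - Polynomial.monom c 0)) = \<Phi> p \<oplus> \<ominus> \<Phi> (p - Polynomial.monom c 0)"
      unfolding \<Phi>_uminus[OF mS] by (rule \<Phi>_add[OF p(1)]) (simp only: supported_uminus mS)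
    also have "\<dots> \<in> J" using p(2) m(2) by (intro J.a_closed J.a_inv_closed)
    finally have "\<Phi> (Polynomial.monom c 0) \<in> J" by simp
    hence "\<Phi> (Polynomial.monom (1 / c) 0) \<otimes> \<Phi> (Polynomial.monom c 0) \<in> J"
      using J.I_l_closed \<Phi>_closed[of "Polynomial.monom (1 / c) 0"] zero_mem by simp
    also have "\<Phi> (Polynomial.monom (1 / c) 0) \<otimes> \<Phi> (Polynomial.monom c 0) = \<one>"
      using \<open>c \<noteq> 0\<close> zero_mem by (simp add: star_monom_monom monom_eq_1 \<Phi>_1 flip: \<Phi>_star)
    finally show ?thesis using J.one_imp_carrier by simp
  qed simp
qed

lemma not_cohen_macaulay_if_socle_mem:
  assumes "w \<in> socle"
  shows "\<not> cohen_macaulay G"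
proof (rule not_cohen_macaulay_if_socle[OF maximalideal_max_ideal])
  have w: "w \<in> S" using assms by (simp add: socle_def)
  show "\<Phi> (Polynomial.monom 1 w) \<in> carrier G" "\<Phi> (Polynomial.monom 1 w) \<noteq> \<zero>"
    using w \<Phi>_eq_0[of "Polynomial.monom 1 w"] by (simp_all add: \<Phi>_closed)
  fix y assume y: "y \<in> max_ideal"
  hence "y \<in> carrier G" using ideal.Icarr[OF ideal_max_ideal] by blast
  moreover have "\<Phi> (Polynomial.monom 1 w) \<in> zero_colon G max_ideal"
    unfolding zero_colon_max_ideal using \<Phi>_mem_iff[OF socle_subset] w assms by simp
  ultimately show "y \<otimes> \<Phi> (Polynomial.monom 1 w) = \<zero>"
    using y m_comm by (auto simp: zero_colon_def)
qed

text \<open>Without torsion every exponent is strict with every multiple of \<open>g\<close>.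
  Torsion-freeness over K[x] then reduces to polynomials having no zero divisors.\<close>

lemma star_inflate:
  assumes "torsion r = {}" "p \<in> supported S"
  shows "star (inflate a) p = inflate a * p"
proof (rule star_eq_mult)
  fix i j assume "Polynomial.coeff (inflate a) i \<noteq> 0" "Polynomial.coeff p j \<noteq> 0"
  hence "i \<in> range (\<lambda>k. k * g)" "j \<in> S" using supportedD[OF inflate_supported] supportedD[OF assms(2)] by blast+
  thus "strict i j" using assms(1) torsion_iff[of j] strict_commute by auto
qed

text \<open>Without torsion, $x = \overline{t^g}$ acts as multiplication by $t^g$ and shifts degrees, so an
  ideal is generated by elements of least degree in each residue class modulo $g$.\<close>

lemma noetherian_if_torsion_free:
  assumes tf: "torsion r = {}"
  shows "noetherian_ring G"
proof
  fix I assume I: "ideal I G"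
  interpret I: ideal I G by (rule I)
  define P where "P i p \<longleftrightarrow> p \<in> supported S \<and> p \<noteq> 0 \<and> \<Phi> p \<in> I \<and> Polynomial.degree p mod g = i"
    for i and p :: "'k poly"
  define f where "f i = arg_min Polynomial.degree (P i)" for i
  have f: "P i (f i)" "Polynomial.degree (f i) \<le> Polynomial.degree p" if "P i p" for i p
    using arg_min_nat_lemma[of "P i" p Polynomial.degree] that unfolding f_def by blast+
  define F where "F = (\<lambda>i. \<Phi> (f i)) ` {i. i < g \<and> (\<exists>p. P i p)}"
  have "finite F" by (simp add: F_def)
  have FI: "F \<subseteq> I" using f(1) by (auto simp: F_def P_def)
  hence FG: "F \<subseteq> carrier G" using I.Icarr by blast
  interpret F: ideal "Idl F" G by (rule genideal_ideal[OF FG])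
  have "\<Phi> p \<in> Idl F" if "p \<in> supported S" "\<Phi> p \<in> I" for p
    using that
  proof (induction "Polynomial.degree p" arbitrary: p rule: less_induct)
    case less
    show ?case
    proof (cases "p = 0")
      case True
      thus ?thesis using F.zero_closed by (simp add: \<Phi>_0)
    next
      case False
      define i where "i = Polynomial.degree p mod g"
      have Pp: "P i p" using less.prems False by (simp add: P_def i_def)
      note fi = f[OF Pp]
      have fiS: "f i \<in> supported S" "f i \<noteq> 0" using fi(1) by (simp_all add: P_def)
      have "\<Phi> (f i) \<in> F" using Pp g_pos by (auto simp: F_def i_def)
      hence fF: "\<Phi> (f i) \<in> Idl F" using genideal_self[OF FG] by blast
      have "g dvd Polynomial.degree p - Polynomial.degree (f i)"
        using fi Pp by (intro mod_eq_dvd_iff_nat[THEN iffD1]) (simp_all add: P_def)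
      then obtain k where "Polynomial.degree p - Polynomial.degree (f i) = g * k" by (rule dvdE)
      hence k: "Polynomial.degree p = k * g + Polynomial.degree (f i)" using fi(2) by (simp add: ac_simps)
      define c where "c = Polynomial.lead_coeff p / Polynomial.lead_coeff (f i)"
      define a where "a = Polynomial.monom c k"
      have a: "inflate a = Polynomial.monom c (k * g)"
      proof (rule poly_eqI)
        fix n show "Polynomial.coeff (inflate a) n = Polynomial.coeff (Polynomial.monom c (k * g)) n"
          using g_pos by (cases "g dvd n") (auto simp: coeff_inflate a_def elim!: dvdE)
      qed
      \<comment> \<open>\<open>k\<close> adjusts the degree and \<open>c\<close> the leading
        coefficient, so that \<open>p - h\<close> is zero or of smaller degree than
        \<open>p\<close>.\<close>
      define h where "h = star (inflate a) (f i)"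
      have h_eq: "h = Polynomial.monom c (k * g) * f i"
        using star_inflate[OF tf fiS(1), of a] by (simp add: h_def a)
      have "c \<noteq> 0" using False fiS(2) by (simp add: c_def)
      have deg_h: "Polynomial.degree h = Polynomial.degree p"
        using \<open>c \<noteq> 0\<close> fiS(2) k by (simp add: h_eq degree_mult_eq degree_monom_eq)
      have lead_h: "Polynomial.lead_coeff h = Polynomial.lead_coeff p"
      proof -
        have "Polynomial.coeff h (Polynomial.degree p) = c * Polynomial.lead_coeff (f i)"
          using k by (simp add: h_eq coeff_monom_mult)
        thus ?thesis using fiS(2) deg_h by (simp add: c_def)
      qed
      have hS: "h \<in> supported S" unfolding h_def by (rule star_supported[OF inflate_supported_S fiS(1)])
      have \<Phi>h: "\<Phi> h = \<Phi> (inflate a) \<otimes> \<Phi> (f i)"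
        unfolding h_def by (rule \<Phi>_star[OF inflate_supported_S fiS(1)])
      have hF: "\<Phi> h \<in> Idl F" unfolding \<Phi>h by (rule F.I_l_closed[OF fF \<Phi>_closed[OF inflate_supported_S]])
      have hI: "\<Phi> h \<in> I"
        unfolding \<Phi>h using fi(1) by (intro I.I_l_closed \<Phi>_closed[OF inflate_supported_S]) (simp add: P_def)
      have dS: "p - h \<in> supported S" using less.prems(1) hS by (rule supported_diff)
      have eq: "\<Phi> (p - h) = \<Phi> p \<oplus> \<ominus> \<Phi> h"
        using \<Phi>_add[OF less.prems(1), of "- h"] hS \<Phi>_uminus[OF hS] by simp
      hence dI: "\<Phi> (p - h) \<in> I" using less.prems(2) hI by (simp add: I.a_closed I.a_inv_closed)
      have "\<Phi> (p - h) \<in> Idl F"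
      proof (cases "p - h = 0")
        case True
        thus ?thesis using F.zero_closed by (simp add: \<Phi>_0)
      next
        case False
        have "Polynomial.degree (p - h) \<noteq> Polynomial.degree p"
        proof
          assume "Polynomial.degree (p - h) = Polynomial.degree p"
          hence "Polynomial.lead_coeff (p - h) = 0" using lead_h deg_h by simp
          thus False using False leading_coeff_0_iff[of "p - h"] by blast
        qed
        moreover have "Polynomial.degree (p - h) \<le> Polynomial.degree p"
          using degree_diff_le[of p "Polynomial.degree p" h] deg_h by simp
        ultimately show ?thesis using less.hyps[of "p - h"] dS dI by simp
      qed
      hence "\<Phi> (p - h) \<oplus> \<Phi> h \<in> Idl F" using hF by (rule F.a_closed)
      thus ?thesis using \<Phi>_add[OF dS hS] by simp
    qed
  qed
  hence "I \<subseteq> Idl F" using I.Icarr unfolding carrier_eq by blast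
  moreover have "Idl F \<subseteq> I" by (rule genideal_minimal[OF I FI])
  ultimately show "\<exists>A\<subseteq>carrier G. finite A \<and> I = Idl A" using \<open>finite F\<close> FG by blast
qed

lemma cohen_macaulay_if_torsion_free:
  assumes tf: "torsion r = {}"
  shows "cohen_macaulay G"
proof -
  interpret torsion_free_poly_retract G "\<lambda>a. \<Phi> (inflate a)" "\<lambda>x. deflate (poly_of x)"
  proof
    fix a f assume a: "a \<noteq> 0" and "f \<in> carrier G" "\<Phi> (inflate a) \<otimes> f = \<zero>"
    then obtain p where p: "p \<in> supported S" "f = \<Phi> p" "\<Phi> (star (inflate a) p) = \<zero>"
      using inflate_supported_S by (auto simp: carrier_eq \<Phi>_star)
    hence "inflate a * p = 0"
      using \<Phi>_eq_0[OF star_supported[OF inflate_supported_S p(1)]] star_inflate[OF tf p(1)] by simp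
    moreover have "inflate a \<noteq> 0"
    proof
      assume "inflate a = 0"
      hence "Polynomial.coeff a i = 0" for i using coeff_inflate[of a "i * g"] g_pos by simp
      thus False using a by (simp add: poly_eq_iff)
    qed
    ultimately show "f = \<zero>" using p(2) \<Phi>_0 by simp
  qed
  show ?thesis by (rule cohen_macaulay_if_noetherian[OF noetherian_if_torsion_free[OF tf]])
qed

end

text \<open>Removing \<open>g\<close> from an element of order above \<open>r\<close> lowers the
  order by one and keeps the gap. It thus suffices to consider orders up to \<open>r\<close>, where
  \<open>s \<le> r * Max A\<close>.\<close>

lemma (in generated_semigroup_with_order) gap_bounded:
  assumes "semigroup_with_reduction S ord g r"
  shows "\<exists>B. \<forall>s\<in>S. s \<le> ord s * g + B"
proof -
  interpret semigroup_with_reduction S ord g r by fact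
  have "s \<le> ord s * g + r * Max A" if "s \<in> S" for s
    using that
  proof (induction s rule: less_induct)
    case (less s)
    show ?case
    proof (cases "Suc r \<le> ord s")
      case True
      then obtain u where u: "u \<in> S" "r \<le> ord u" "s = g + u" using reduction less.prems by blast
      have "ord s = Suc (ord u)"
        using strict_g_of_large[OF u(1,2)] u(3) by (simp add: strict_def ord_g add.commute)
      moreover have "u \<le> ord u * g + r * Max A" using less.IH[of u] u g_pos by simp
      ultimately show ?thesis using u(3) by simp
    next
      case False
      hence "ord s * Max A \<le> r * Max A" by (intro mult_le_mono1) simp
      thus ?thesis using le_ord_mult[OF less.prems] by linarith
    qed
  qed
  thus ?thesis by blast
qed

theorem proposition4p3:
  fixes g1 g2 g3 r :: nat and S :: "nat set"
    and R :: "'k::field fps ring" and \<mm> :: "'k fps set"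
    and G :: "(nat \<Rightarrow> 'k fps set) ring" and \<M> H0 :: "(nat \<Rightarrow> 'k fps set) set"
    and tbar :: "nat \<Rightarrow> nat \<Rightarrow> 'k fps set" and len :: enat
  assumes K_infinite: "infinite (UNIV :: 'k set)"
    and less: "g1 < g2" "g2 < g3"
    and gcd: "Gcd {g1, g2, g3} = 1"
    and S: "minimal_generators {g1, g2, g3} S"
    and R: "R = semigroup_ring S"
    and \<mm>: "\<mm> = Idl\<^bsub>R\<^esub> {fps_X ^ g1, fps_X ^ g2, fps_X ^ g3}"
    and G: "G = assoc_graded R \<mm>"
    and \<M>: "\<M> = graded_max_ideal R \<mm>"
    and r: "r = reduction_number R \<mm> (fps_X ^ g1)"
    and H0: "H0 = local_cohomology_0 G \<M>"
    and len: "len = module_length G (ideal_module G H0)"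
    and tbar: "\<And>s. tbar s = graded_class R \<mm> (semigroup_order S s) (fps_X ^ s)"
  shows "(is_buchsbaum G \<M> \<and> \<not> cohen_macaulay G \<longleftrightarrow>
           (\<exists>k::nat. k \<ge> 1 \<and>
              zero_colon G (ideal_power G \<M> r) = PIdl\<^bsub>G\<^esub> (tbar (k * g3)) \<and>
              tbar (k * g3) \<in> zero_colon G \<M>)) \<and>
         ((\<exists>k::nat. k \<ge> 1 \<and>
              zero_colon G (ideal_power G \<M> r) = PIdl\<^bsub>G\<^esub> (tbar (k * g3)) \<and>
              tbar (k * g3) \<in> zero_colon G \<M>) \<longleftrightarrow>
           len = 1)"
proof -
  have "0 < g1" using minimal_generators_nonzero[OF S] by simp
  then interpret T: three_generated g1 g2 g3 using less by unfold_locales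
  have S_eq: "S = T.sgp" using S T.semigroup_gen_eq by (simp add: minimal_generators_def)
  interpret gen: generated_semigroup_with_order T.sgp T.max_length "{g1, g2, g3}"
    by (rule T.generated_semigroup)
  have \<mm>_eq: "\<mm> = gen.max_ideal_R"
    unfolding \<mm> R S_eq gen.max_ideal_R_def by simp
  have G_eq: "G = gen.\<GG>" unfolding G R S_eq \<mm>_eq ..
  have \<M>_eq: "\<M> = gen.max_ideal"
    unfolding \<M> R S_eq \<mm>_eq by (rule gen.graded_max_ideal_eq)
  have r_eq: "r = reduction_number (gen.R :: 'k fps ring) gen.max_ideal_R (fps_X ^ g1)"
    unfolding r R S_eq \<mm>_eq ..
  have red: "semigroup_with_reduction T.sgp T.max_length g1 r"
  proof
    fix s assume s: "s \<in> T.sgp" "Suc r \<le> T.max_length s"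
    \<comment> \<open>\<open>2 * g1\<close> is a witness that the minimum defining \<open>r\<close>
      exists, not its value.\<close>
    have "\<exists>u\<in>T.sgp. 2 * g1 \<le> T.max_length u \<and> s = g1 + u"
      if "s \<in> T.sgp" "Suc (2 * g1) \<le> T.max_length s" for s
      using T.reduction_exists[OF that] that(2) by auto
    from gen.reduction_number_spec[OF T.g_mem_sgp(1) T.g1_pos this r_eq s]
    show "\<exists>u\<in>T.sgp. r \<le> T.max_length u \<and> s = g1 + u" .
  qed (simp_all add: T.g_mem_sgp T.g1_pos T.max_length_mult_g1)
  interpret red: three_generated_with_reduction g1 g2 g3 r
    by (intro three_generated_with_reduction.intro T.three_generated_axioms red)
  interpret A: sloped_graded_algebra T.sgp T.max_length "gen.\<GG> :: (nat \<Rightarrow> 'k fps set) ring" gen.graded_of_poly g1 r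
    by unfold_locales (use T.mult_g1_max_length gen.gap_bounded[OF red] in auto)
  have tbar_eq: "tbar s = gen.graded_of_poly (Polynomial.monom 1 s)" if "s \<in> T.sgp" for s
    unfolding tbar R S_eq \<mm>_eq by (rule gen.graded_class_eq[OF that])
  have mult_g3: "k * g3 \<in> T.sgp" for k by (rule T.sgpI[of _ 0 0 k]) simp
  have ii: "(\<exists>k\<ge>1. zero_colon G (ideal_power G \<M> r) = PIdl\<^bsub>G\<^esub> (tbar (k * g3)) \<and>
      tbar (k * g3) \<in> zero_colon G \<M>) \<longleftrightarrow> (\<exists>k\<ge>1. red.torsion r = {k * g3})"
    unfolding tbar_eq[OF mult_g3] G_eq \<M>_eq A.zero_colon_power A.principal_socle_iff[OF mult_g3] ..
  have iii: "len = 1 \<longleftrightarrow> (\<exists>w. red.torsion r = {w})"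
    unfolding len H0 G_eq \<M>_eq by (rule A.module_length_local_cohomology)
  have singleton_socle: "red.torsion r \<subseteq> red.socle" if "red.torsion r = {w}" for w
    using red.socle_if_torsion_singleton[OF that] that by simp
  have i: "is_buchsbaum G \<M> \<and> \<not> cohen_macaulay G \<longleftrightarrow> red.torsion r \<subseteq> red.socle \<and> red.torsion r \<noteq> {}"
  proof -
    \<comment> \<open>Under the Buchsbaum condition any torsion exponent is a socle exponent, which
      gives depth 0 at the homogeneous maximal ideal.\<close>
    have "\<not> cohen_macaulay G" if soc: "red.torsion r \<subseteq> red.socle" "red.torsion r \<noteq> {}"
    proof -
      obtain w where "w \<in> red.socle" using soc by blast
      thus ?thesis unfolding G_eq by (rule A.not_cohen_macaulay_if_socle_mem)
    qed
    moreover have "cohen_macaulay G" if "red.torsion r = {}"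
      unfolding G_eq using that by (rule A.cohen_macaulay_if_torsion_free)
    moreover have "is_buchsbaum G \<M> \<longleftrightarrow> red.torsion r \<subseteq> red.socle"
      unfolding G_eq \<M>_eq by (rule A.is_buchsbaum_iff)
    ultimately show ?thesis by argo
  qed
  have "red.torsion r \<subseteq> red.socle \<and> red.torsion r \<noteq> {} \<longleftrightarrow> (\<exists>k\<ge>1. red.torsion r = {k * g3})"
    using red.torsion_singleton singleton_socle by (metis insert_not_empty)
  \<comment> \<open>A one-element torsion set lies in the socle, so the combinatorial argument
    forces the arbitrary \<open>w\<close> to be a positive multiple of \<open>g3\<close>.\<close>
  moreover have "(\<exists>k\<ge>1. red.torsion r = {k * g3}) \<longleftrightarrow> (\<exists>w. red.torsion r = {w})"
    using red.torsion_singleton singleton_socle by (metis insert_not_empty)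
  ultimately show ?thesis using i ii iii by simp
qed

end
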